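(* Let $\Gamma$ be a non-elementary, torsion-free hyperbolic group. Then the metric space $(\mathscr{H}^{++}_\Gamma,\Delta)$ is not complete.
   Context: Let $o\in\Gamma$ be the identity. A pseudometric on $\Gamma$ is a function $d:\Gamma\times\Gamma\to[0,\infty)$ with $d(x,x)=0$ and $d(x,z)\le d(x,y)+d(y,z)$. For $\psi:\Gamma\times\Gamma\to\mathbb{R}$ put $(x|y)^\psi_w=\frac12(\psi(x,w)+\psi(w,y)-\psi(x,y))$. A pseudometric $d$ is hyperbolic if for some $\delta\ge0$, $(x|z)^d_w\ge\min\{(x|y)^d_w,(y|z)^d_w\}-\delta$ for all $x,y,z,w$. $\mathcal{D}_\Gamma$ is the set of symmetric, left-invariant, hyperbolic pseudometrics on $\Gamma$ quasi-isometric (via the identity map) to a word metric for a finite symmetric generating set. $\mathcal{H}_\Gamma$ is the set of left-invariant functions $\psi:\Gamma\times\Gamma\to\mathbb{R}$ such that for any $d_0\in\mathcal{D}_\Gamma$ there is $\lambda>0$ with $|(x|y)^\psi_w|\le\lambda(x|y)^{d_0}_w+\lambda$ for all $x,y,w$. $\mathcal{H}^{++}_\Gamma$ is the set of $\psi\in\mathcal{H}_\Gamma$ that are proper ($\{g:\psi(o,g)\le T\}$ is finite for all $T$) and bounded below. $\mathscr{H}^{++}_\Gamma$ is the set of classes $[\psi]$ of $\psi\in\mathcal{H}^{++}_\Gamma$ where $\psi\sim\varphi$ iff $\sup_g|\psi(o,g)-\lambda\varphi(o,g)|<\infty$ for some $\lambda>0$. With $[\Gamma]'$ the set of non-torsion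 conjugacy classes, $\ell_\psi[g]=\lim_k\psi(o,g^k)/k$ and $\mathrm{Dil}(\varphi,\psi)=\sup_{[g]\in[\Gamma]'}\ell_\varphi[g]/\ell_\psi[g]$, the metric is $\Delta([\varphi],[\psi])=\log(\mathrm{Dil}(\varphi,\psi)\,\mathrm{Dil}(\psi,\varphi))$. *)

theory Defs
  imports "HOL-Analysis.Analysis" "HOL-Algebra.Elementary_Groups"
begin

text \<open>
  Functions \<open>\<psi> :: 'a \<Rightarrow> 'a \<Rightarrow> real\<close> stand for real functions on
  \<open>carrier G \<times> carrier G\<close>; all conditions below only look at their values there.
\<close>

definition torsion_elem :: "('a, 'b) monoid_scheme \<Rightarrow> 'a \<Rightarrow> bool" where
  "torsion_elem G g \<longleftrightarrow> (\<exists>n::nat. n > 0 \<and> g [^]\<^bsub>G\<^esub> n = \<one>\<^bsub>G\<^esub>)"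

definition torsion_free :: "('a, 'b) monoid_scheme \<Rightarrow> bool" where
  "torsion_free G \<longleftrightarrow> (\<forall>g\<in>carrier G. torsion_elem G g \<longrightarrow> g = \<one>\<^bsub>G\<^esub>)"

text \<open>Elementary groups: virtually cyclic, which includes the finite groups.\<close>

definition elementary_group :: "('a, 'b) monoid_scheme \<Rightarrow> bool" where
  "elementary_group G \<longleftrightarrow>
     (\<exists>H. subgroup H G \<and> cyclic_group (G\<lparr>carrier := H\<rparr>) \<and> finite (rcosets\<^bsub>G\<^esub> H))"

definition finite_sym_gen_set :: "('a, 'b) monoid_scheme \<Rightarrow> 'a set \<Rightarrow> bool" where
  "finite_sym_gen_set G S \<longleftrightarrow>
     finite S \<and> S \<subseteq> carrier G \<and> (\<forall>s\<in>S. inv\<^bsub>G\<^esub> s \<in> S) \<and> generate G S = carrier G"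

definition word_length :: "('a, 'b) monoid_scheme \<Rightarrow> 'a set \<Rightarrow> 'a \<Rightarrow> nat" where
  "word_length G S g =
     (LEAST n. \<exists>ws. length ws = n \<and> set ws \<subseteq> S \<and> foldr (\<otimes>\<^bsub>G\<^esub>) ws \<one>\<^bsub>G\<^esub> = g)"

definition word_metric :: "('a, 'b) monoid_scheme \<Rightarrow> 'a set \<Rightarrow> 'a \<Rightarrow> 'a \<Rightarrow> real" where
  "word_metric G S x y = real (word_length G S (inv\<^bsub>G\<^esub> x \<otimes>\<^bsub>G\<^esub> y))"

definition gromov_product :: "('a \<Rightarrow> 'a \<Rightarrow> real) \<Rightarrow> 'a \<Rightarrow> 'a \<Rightarrow> 'a \<Rightarrow> real" where
  "gromov_product \<psi> x y w = (\<psi> x w + \<psi> w y - \<psi> x y) / 2"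

definition pseudometric_on :: "'a set \<Rightarrow> ('a \<Rightarrow> 'a \<Rightarrow> real) \<Rightarrow> bool" where
  "pseudometric_on X d \<longleftrightarrow>
     (\<forall>x\<in>X. \<forall>y\<in>X. 0 \<le> d x y) \<and> (\<forall>x\<in>X. d x x = 0) \<and>
     (\<forall>x\<in>X. \<forall>y\<in>X. \<forall>z\<in>X. d x z \<le> d x y + d y z)"

definition hyperbolic_on :: "'a set \<Rightarrow> ('a \<Rightarrow> 'a \<Rightarrow> real) \<Rightarrow> bool" where
  "hyperbolic_on X d \<longleftrightarrow>
     (\<exists>\<delta>\<ge>0. \<forall>x\<in>X. \<forall>y\<in>X. \<forall>z\<in>X. \<forall>w\<in>X.
        gromov_product d x z w \<ge> min (gromov_product d x y w) (gromov_product d y z w) - \<delta>)"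

definition hyperbolic_group :: "('a, 'b) monoid_scheme \<Rightarrow> bool" where
  "hyperbolic_group G \<longleftrightarrow>
     group G \<and> (\<exists>S. finite_sym_gen_set G S \<and> hyperbolic_on (carrier G) (word_metric G S))"

definition left_invariant :: "('a, 'b) monoid_scheme \<Rightarrow> ('a \<Rightarrow> 'a \<Rightarrow> real) \<Rightarrow> bool" where
  "left_invariant G \<psi> \<longleftrightarrow>
     (\<forall>g\<in>carrier G. \<forall>x\<in>carrier G. \<forall>y\<in>carrier G. \<psi> (g \<otimes>\<^bsub>G\<^esub> x) (g \<otimes>\<^bsub>G\<^esub> y) = \<psi> x y)"

definition quasi_isometric_id_on ::
    "'a set \<Rightarrow> ('a \<Rightarrow> 'a \<Rightarrow> real) \<Rightarrow> ('a \<Rightarrow> 'a \<Rightarrow> real) \<Rightarrow> bool" where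
  "quasi_isometric_id_on X d d' \<longleftrightarrow>
     (\<exists>L\<ge>1. \<exists>A\<ge>0. \<forall>x\<in>X. \<forall>y\<in>X. d' x y / L - A \<le> d x y \<and> d x y \<le> L * d' x y + A)"

definition metrics_D :: "('a, 'b) monoid_scheme \<Rightarrow> ('a \<Rightarrow> 'a \<Rightarrow> real) set" where
  "metrics_D G = {d. pseudometric_on (carrier G) d \<and>
     (\<forall>x\<in>carrier G. \<forall>y\<in>carrier G. d x y = d y x) \<and>
     left_invariant G d \<and> hyperbolic_on (carrier G) d \<and>
     (\<exists>S. finite_sym_gen_set G S \<and> quasi_isometric_id_on (carrier G) d (word_metric G S))}"

definition potentials_H :: "('a, 'b) monoid_scheme \<Rightarrow> ('a \<Rightarrow> 'a \<Rightarrow> real) set" where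
  "potentials_H G = {\<psi>. left_invariant G \<psi> \<and>
     (\<forall>d\<in>metrics_D G. \<exists>c>0. \<forall>x\<in>carrier G. \<forall>y\<in>carrier G. \<forall>w\<in>carrier G.
        \<bar>gromov_product \<psi> x y w\<bar> \<le> c * gromov_product d x y w + c)}"

definition potentials_Hpp :: "('a, 'b) monoid_scheme \<Rightarrow> ('a \<Rightarrow> 'a \<Rightarrow> real) set" where
  "potentials_Hpp G = {\<psi> \<in> potentials_H G.
     (\<forall>T. finite {g \<in> carrier G. \<psi> \<one>\<^bsub>G\<^esub> g \<le> T}) \<and>
     (\<exists>b. \<forall>x\<in>carrier G. \<forall>y\<in>carrier G. b \<le> \<psi> x y)}"

definition rough_similarity ::
    "('a, 'b) monoid_scheme \<Rightarrow> (('a \<Rightarrow> 'a \<Rightarrow> real) \<times> ('a \<Rightarrow> 'a \<Rightarrow> real)) set" where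
  "rough_similarity G = {(\<psi>, \<phi>). \<psi> \<in> potentials_Hpp G \<and> \<phi> \<in> potentials_Hpp G \<and>
     (\<exists>c>0. bdd_above ((\<lambda>g. \<bar>\<psi> \<one>\<^bsub>G\<^esub> g - c * \<phi> \<one>\<^bsub>G\<^esub> g\<bar>) ` carrier G))}"

definition space_Hpp :: "('a, 'b) monoid_scheme \<Rightarrow> ('a \<Rightarrow> 'a \<Rightarrow> real) set set" where
  "space_Hpp G = potentials_Hpp G // rough_similarity G"

definition conj_class :: "('a, 'b) monoid_scheme \<Rightarrow> 'a \<Rightarrow> 'a set" where
  "conj_class G g = {h \<otimes>\<^bsub>G\<^esub> g \<otimes>\<^bsub>G\<^esub> inv\<^bsub>G\<^esub> h | h. h \<in> carrier G}"

definition nontorsion_classes :: "('a, 'b) monoid_scheme \<Rightarrow> 'a set set" where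
  "nontorsion_classes G = {conj_class G g | g. g \<in> carrier G \<and> \<not> torsion_elem G g}"

text \<open>
  The limit exists and is constant on conjugacy classes for every \<open>\<psi>\<close> in
  \<open>potentials_H G\<close>, so the length of a class is the common limit of its elements.
\<close>

definition stable_length ::
    "('a, 'b) monoid_scheme \<Rightarrow> ('a \<Rightarrow> 'a \<Rightarrow> real) \<Rightarrow> 'a set \<Rightarrow> real" where
  "stable_length G \<psi> C =
     (THE l. \<forall>g\<in>C. (\<lambda>k::nat. \<psi> \<one>\<^bsub>G\<^esub> (g [^]\<^bsub>G\<^esub> k) / real k) \<longlonglongrightarrow> l)"

text \<open>
  For \<open>\<phi>\<close>, \<open>\<psi>\<close> in \<open>potentials_Hpp G\<close> stable lengths of non-torsion classes are positive and
  the ratios are bounded, so that a real supremum suffices.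
\<close>

definition Dil ::
    "('a, 'b) monoid_scheme \<Rightarrow> ('a \<Rightarrow> 'a \<Rightarrow> real) \<Rightarrow> ('a \<Rightarrow> 'a \<Rightarrow> real) \<Rightarrow> real" where
  "Dil G \<phi> \<psi> = (SUP C\<in>nontorsion_classes G. stable_length G \<phi> C / stable_length G \<psi> C)"

text \<open>
  The value does not depend on the representatives. The locale \<open>Metric_space\<close>
  asks for symmetry and nonnegativity on the whole type, hence the value 0 off the space.
\<close>

definition Delta_dist ::
    "('a, 'b) monoid_scheme \<Rightarrow> ('a \<Rightarrow> 'a \<Rightarrow> real) set \<Rightarrow> ('a \<Rightarrow> 'a \<Rightarrow> real) set \<Rightarrow> real" where
  "Delta_dist G A B =
     (if A \<in> space_Hpp G \<and> B \<in> space_Hpp G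
      then THE r. \<forall>\<phi>\<in>A. \<forall>\<psi>\<in>B. r = ln (Dil G \<phi> \<psi> * Dil G \<psi> \<phi>)
      else 0)"

end

theory Submission
  imports Defs
begin

text \<open>
  Fix a word metric \<open>d\<close> that is hyperbolic, write \<open>|x|\<close> for the word length and \<open>(x|y)\<^sub>w\<close> for its Gromov
  product. A potential is almost additive where \<open>d\<close> does not backtrack, and the whole argument uses
  potentials in this form: \<open>\<psi>(1, xy)\<close> differs from
  \<open>\<psi>(1, x) + \<psi>(1, y)\<close> by at most a multiple of \<open>(x\<inverse>|y)\<^sub>1 + 1\<close> (\<open>potential_almost_additive\<close>).

  Why \<open>\<Delta>\<close> is a metric. No nontrivial element is parabolic (\<open>no_parabolic\<close>), so the powers
  of such an element are quasi-geodesic, stable lengths exist, and for proper potentials they are positive with bounded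
  ratios. All axioms except that distance 0 implies equality are then formal. For the latter, two
  independent axes provide finitely many elements of which one turns any long \<open>g\<close>, by right
  multiplication, into an \<open>h\<close> whose powers do not backtrack (\<open>straight_closing\<close>). For such \<open>h\<close> the
  stable length of \<open>h\<close> is \<open>\<psi>(1, g)\<close> up to a bounded error, so proportional stable lengths force proportional
  potentials up to a bounded error (\<open>rigidity\<close>).

  Why it is not complete. Take \<open>a \<noteq> 1\<close> and \<open>t\<close> such that no nontrivial power of \<open>a\<close> is conjugated by \<open>t\<close>
  to a power of \<open>a\<close>, and let \<open>g\<^sub>n = a\<^sup>p t a\<^sup>p\<close> with \<open>p = p(n)\<close> growing fast. Let \<open>d\<^sub>n\<close> be the word metric
  in which each letter \<open>g\<^sub>i\<close>, \<open>i \<le> n\<close>, may be used as a shortcut that saves \<open>i\<close>. The savings are small relative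
  to \<open>|g\<^sub>i|\<close>, so the classes of \<open>d\<^sub>n\<close> form a Cauchy sequence. No translate of \<open>g\<^sub>i\<close> follows the axis of \<open>a\<close>
  closely (\<open>translates_avoid_axis\<close>), so shortcuts do not help there, and all \<open>d\<^sub>n(1, a\<^sup>k)\<close> equal
  \<open>|a\<^sup>k|\<close>. Scale a hypothetical limit \<open>\<psi>\<close> so that it has the same stable length as \<open>d\<close> on \<open>a\<close>. Almost
  additivity gives \<open>\<psi>(1, g\<^sub>n) \<ge> |g\<^sub>n| - O(1)\<close>, whereas comparison of stable lengths with \<open>d\<^sub>n\<close> and
  \<open>straight_closing\<close> give \<open>\<psi>(1, g\<^sub>n) \<le> |g\<^sub>n| - n + O(1)\<close>. So the unbounded sequence of savings \<open>n\<close>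
  is what no single potential can accommodate.

  That \<open>d\<^sub>n\<close> is a potential at all is the Morse lemma in one direction: a point at which the Gromov product
  of the ends of a quasi-geodesic is small lies near the quasi-geodesic (\<open>quasi_geodesic_near\<close>).
\<close>

section \<open>Hyperbolic pseudometrics\<close>

locale hyperbolic_pseudometric =
  fixes X :: "'a set" and d :: "'a \<Rightarrow> 'a \<Rightarrow> real" and \<delta> :: real
  assumes nonneg: "\<lbrakk>x \<in> X; y \<in> X\<rbrakk> \<Longrightarrow> 0 \<le> d x y"
    and refl: "x \<in> X \<Longrightarrow> d x x = 0"
    and sym: "\<lbrakk>x \<in> X; y \<in> X\<rbrakk> \<Longrightarrow> d x y = d y x"
    and triangle: "\<lbrakk>x \<in> X; y \<in> X; z \<in> X\<rbrakk> \<Longrightarrow> d x z \<le> d x y + d y z"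
    and delta_nonneg: "0 \<le> \<delta>"
    and hyperbolic: "\<lbrakk>x \<in> X; y \<in> X; z \<in> X; w \<in> X\<rbrakk> \<Longrightarrow>
          gromov_product d x z w \<ge> min (gromov_product d x y w) (gromov_product d y z w) - \<delta>"
begin

abbreviation gp :: "'a \<Rightarrow> 'a \<Rightarrow> 'a \<Rightarrow> real" where
  "gp \<equiv> gromov_product d"

lemma gp_commute: "\<lbrakk>x \<in> X; y \<in> X; w \<in> X\<rbrakk> \<Longrightarrow> gp x y w = gp y x w"
  using sym by (simp add: gromov_product_def)

lemma gp_nonneg: "\<lbrakk>x \<in> X; y \<in> X; w \<in> X\<rbrakk> \<Longrightarrow> 0 \<le> gp x y w"
  using triangle[of x w y] by (simp add: gromov_product_def)

lemma gp_le_dist: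
  assumes "x \<in> X" "y \<in> X" "w \<in> X"
  shows "gp x y w \<le> d w x" "gp x y w \<le> d w y"
  using assms triangle[of w x y] triangle[of x y w] sym[of w x] sym[of w y]
  by (simp_all add: gromov_product_def)

lemma gp_ge_dist: "\<lbrakk>x \<in> X; y \<in> X; w \<in> X\<rbrakk> \<Longrightarrow> d w x - d x y \<le> gp x y w"
  using triangle[of w y x] triangle[of x y w] sym[of w x] sym[of x y]
  by (simp add: gromov_product_def)

lemma gp_add_gp: "\<lbrakk>x \<in> X; y \<in> X; z \<in> X\<rbrakk> \<Longrightarrow> gp y z x + gp x z y = d x y"
  using sym[of x y] sym[of y z] sym[of x z] by (simp add: gromov_product_def field_simps)

lemma gp_change_base:
  assumes "x \<in> X" "y \<in> X" "w \<in> X" "v \<in> X"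
  shows "gp x y w \<le> gp x y v + d w v"
  using assms triangle[of x v w] triangle[of w v y] sym[of v w]
  unfolding gromov_product_def by simp argo

lemma gp_change_left:
  assumes "x \<in> X" "y \<in> X" "w \<in> X" "v \<in> X"
  shows "gp x y w \<le> gp v y w + d x v"
  using assms triangle[of x v w] triangle[of v x y] sym[of v x]
  unfolding gromov_product_def by simp argo

lemma gp_change_right:
  assumes "x \<in> X" "y \<in> X" "w \<in> X" "v \<in> X"
  shows "gp x y w \<le> gp x v w + d y v"
  using assms gp_change_left[of y x w v] gp_commute by simp

lemma hyperbolic_cases:
  assumes "x \<in> X" "y \<in> X" "z \<in> X" "w \<in> X" "gp x z w \<le> c"
  shows "gp x y w \<le> c + \<delta> \<or> gp y z w \<le> c + \<delta>"
  using hyperbolic[OF assms(1-4)] assms(5) by linarith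

text \<open>
  At each point of the chain hyperbolicity compares the direction back to the start with the direction
  to the previous point. A long step forces these to agree, so that small backtracking at consecutive
  points cannot accumulate.
\<close>

lemma local_to_global_step:
  fixes x :: "nat \<Rightarrow> 'a"
  assumes x: "\<And>i. x i \<in> X"
    and c: "0 \<le> c"
    and turn: "\<And>i. gp (x i) (x (i + 2)) (x (i + 1)) \<le> c"
    and long: "\<And>i. 2 * c + 3 * \<delta> + 1 \<le> d (x i) (x (i + 1))"
  shows "gp (x i) (x (i + k + 2)) (x (i + k + 1)) \<le> c + \<delta>"
proof (induction k)
  case 0
  then show ?case using turn[of i] delta_nonneg by simp
next
  case (Suc k)
  let ?p = "x (i + k + 1)" and ?q = "x (i + k + 2)" and ?r = "x (i + k + 3)"
  have "gp ?p ?r ?q \<le> c" using turn[of "i + k + 1"] by (simp add: numeral_eq_Suc)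
  then have "gp ?p (x i) ?q \<le> c + \<delta> \<or> gp (x i) ?r ?q \<le> c + \<delta>"
    by (intro hyperbolic_cases x)
  moreover have "gp ?p (x i) ?q > c + \<delta>"
    using gp_add_gp[OF x[of "i+k+2"] x[of "i+k+1"] x[of i]] long[of "i + k + 1"] Suc
      sym[OF x[of "i+k+1"] x[of "i+k+2"]]
      gp_commute[OF x[of "i+k+2"] x[of i] x[of "i+k+1"]] c delta_nonneg
    by (simp add: numeral_eq_Suc)
  ultimately show ?case by (simp add: numeral_eq_Suc)
qed

text \<open>
  The mirror image of the previous estimate, from the far end; as the chain is indexed by all natural
  numbers, it is obtained by repeating the induction instead of reversing the chain.
\<close>

lemma local_to_global_step_back:
  fixes x :: "nat \<Rightarrow> 'a"
  assumes x: "\<And>i. x i \<in> X"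
    and c: "0 \<le> c"
    and turn: "\<And>i. gp (x i) (x (i + 2)) (x (i + 1)) \<le> c"
    and long: "\<And>i. 2 * c + 3 * \<delta> + 1 \<le> d (x i) (x (i + 1))"
  shows "gp (x i) (x (i + k + 1)) (x (i + 1)) \<le> c + \<delta>"
proof (induction k arbitrary: i)
  case 0
  show ?case using c delta_nonneg refl[OF x] sym[OF x x] by (simp add: gromov_product_def)
next
  case (Suc k)
  let ?e = "x (i + Suc k + 1)"
  have "gp (x i) ?e (x (i + 1)) \<le> c + \<delta> \<or> gp ?e (x (i + 2)) (x (i + 1)) \<le> c + \<delta>"
    by (intro hyperbolic_cases x turn)
  moreover have "gp ?e (x (i + 2)) (x (i + 1)) > c + \<delta>"
    using gp_add_gp[OF x[of "i+1"] x[of "i+2"] x[of "i + Suc k + 1"]] long[of "i + 1"]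
      Suc[of "i + 1"] gp_commute[OF x[of "i + Suc k + 1"] x[of "i+2"] x[of "i+1"]] c delta_nonneg
    by (simp add: numeral_eq_Suc)
  ultimately show ?case by auto
qed

lemma local_to_global:
  fixes x :: "nat \<Rightarrow> 'a"
  assumes x: "\<And>i. x i \<in> X"
    and c: "0 \<le> c"
    and turn: "\<And>i. gp (x i) (x (i + 2)) (x (i + 1)) \<le> c"
    and long: "\<And>i. 2 * c + 3 * \<delta> + 1 \<le> d (x i) (x (i + 1))"
  shows "gp (x i) (x (i + j + k)) (x (i + j)) \<le> c + 2 * \<delta>"
    and "real n \<le> d (x i) (x (i + n))"
proof -
  note step = local_to_global_step[OF assms]
  show "real n \<le> d (x i) (x (i + n))"
  proof (induction n)
    case 0
    then show ?case using nonneg x by simp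
  next
    case (Suc n)
    show ?case
    proof (cases n)
      case 0
      then show ?thesis using long[of i] c delta_nonneg by simp
    next
      case (Suc m)
      have "gp (x i) (x (i + m + 2)) (x (i + m + 1)) \<le> c + \<delta>" by (rule step)
      then show ?thesis using Suc long[of "i + m + 1"] Suc.IH c delta_nonneg
        by (simp add: gromov_product_def numeral_eq_Suc)
    qed
  qed
  let ?b = "x (i + j)" and ?b' = "x (i + j + 1)" and ?e = "x (i + j + k)"
  show "gp (x i) ?e ?b \<le> c + 2 * \<delta>"
  proof (cases "j = 0 \<or> k = 0")
    case True
    then show ?thesis using c delta_nonneg refl[OF x] sym[OF x x]
      by (auto simp add: gromov_product_def)
  next
    case False
    then obtain j' k' where jk: "j = Suc j'" "k = Suc k'" using not0_implies_Suc by blast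
    have "gp ?b ?e ?b' \<le> c + \<delta>"
      using local_to_global_step_back[OF assms, of "i + j" k'] jk by simp
    then have "gp ?e ?b' ?b > c + 2 * \<delta>"
      using gp_add_gp[OF x[of "i+j"] x[of "i+j+1"] x[of "i+j+k"]] long[of "i+j"]
        gp_commute[OF x[of "i+j+k"] x[of "i+j+1"] x[of "i+j"]] c delta_nonneg by simp
    moreover have "gp (x i) ?e ?b \<le> (c + \<delta>) + \<delta> \<or> gp ?e ?b' ?b \<le> (c + \<delta>) + \<delta>"
      using step[of i j'] jk by (intro hyperbolic_cases x) simp
    ultimately show ?thesis by auto
  qed
qed

text \<open>
  Seen from \<open>w\<close>, the points \<open>p\<^sub>i\<close> move away linearly in \<open>i\<close>. Taking every \<open>s\<close>-th point with \<open>s \<ge> 4 L \<delta>\<close> makes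
  the distance gain at least the \<open>\<delta>\<close> that hyperbolicity loses when one more point is inserted, so the
  bound for the last product \<open>(p\<^sub>i|p\<^sub>n)\<^sub>w\<close> survives all the way down to \<open>i = 0\<close>. Half of \<open>D\<close> is spent on
  getting linear growth from the start.
\<close>

lemma quasi_geodesic_half:
  fixes p :: "nat \<Rightarrow> 'a"
  assumes p: "\<And>i. i \<le> n \<Longrightarrow> p i \<in> X"
    and A: "\<And>i. i < n \<Longrightarrow> d (p i) (p (Suc i)) \<le> A" "0 \<le> A"
    and L: "\<And>i. i \<le> n \<Longrightarrow> real i \<le> L * d (p 0) (p i) + L" "0 < L"
    and w: "w \<in> X"
    and nearest: "\<And>i. i \<le> n \<Longrightarrow> D \<le> d w (p i)" "D = d w (p 0)"
    and s: "4 * L * \<delta> \<le> real s" "0 < s"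
  shows "D / 2 - real s * A - \<delta> - 1 \<le> gp (p 0) (p n) w"
proof -
  have far: "D / 2 + (real i / L - 1) / 4 \<le> d w (p i)" if i: "i \<le> n" for i
  proof -
    have "real i / L \<le> d (p 0) (p i) + 1" using L(1)[OF i] L(2) by (simp add: field_simps)
    moreover have "d (p 0) (p i) \<le> D + d w (p i)"
      using triangle[of "p 0" w "p i"] sym[of w "p 0"] p i w nearest(2) by simp
    ultimately show ?thesis using nearest(1)[OF i] by argo
  qed
  have steps: "d (p i) (p (i + k)) \<le> real k * A" if "i + k \<le> n" for i k
    using that
  proof (induction k)
    case 0
    then show ?case using refl p by simp
  next
    case (Suc k)
    then show ?case using triangle[of "p i" "p (i+k)" "p (i + Suc k)"] p A(1)[of "i+k"]
      by (simp add: algebra_simps)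
  qed
  have main: "D / 2 + real i * \<delta> / real s - real s * A - \<delta> - 1 \<le> gp (p i) (p n) w"
    if "i \<le> n" for i
    using that
  proof (induction "n - i" arbitrary: i rule: less_induct)
    case less
    have "\<delta> / real s \<le> 1 / (4 * L)" using s L(2) by (simp add: field_simps)
    then have "real i * (\<delta> / real s) \<le> real i * (1 / (4 * L))" by (intro mult_left_mono) auto
    then have far': "D / 2 + real i * \<delta> / real s - 1 \<le> d w (p i)"
      using far[OF less.prems] by (simp add: field_simps)
    have near: "d w (p i) - real s * A \<le> gp (p i) (p (i + k)) w" if "i + k \<le> n" "k \<le> s" for k
    proof -
      have "real k * A \<le> real s * A" using that A(2) by (intro mult_right_mono) auto
      then show ?thesis using gp_ge_dist[of "p i" "p (i + k)" w] p w that steps[of i k] by simp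
    qed
    show ?case
    proof (cases "n \<le> i + s")
      case True
      then have "n - i \<le> s" by simp
      then show ?thesis using near[of "n - i"] far' less.prems delta_nonneg by simp
    next
      case False
      then have "D / 2 + real (i + s) * \<delta> / real s - real s * A - \<delta> - 1 \<le> gp (p (i + s)) (p n) w"
        using s by (intro less.hyps) auto
      moreover have "real (i + s) * \<delta> / real s = real i * \<delta> / real s + \<delta>"
        using s by (simp add: field_simps)
      moreover have "d w (p i) - real s * A \<le> gp (p i) (p (i + s)) w" using False by (intro near) auto
      moreover have "min (gp (p i) (p (i+s)) w) (gp (p (i+s)) (p n) w) - \<delta> \<le> gp (p i) (p n) w"
        using False less.prems p w by (intro hyperbolic) auto
      ultimately show ?thesis using far' by linarith
    qed
  qed
  show ?thesis using main[of 0] by simp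
qed

text \<open>
  One direction of the Morse lemma: cutting the quasi-geodesic at the point nearest to \<open>w\<close> gives two
  halves, seen from which the distance to \<open>w\<close> is bounded by the previous estimate. The bound is
  linear in the Gromov product, as the definition of a potential requires.
\<close>

lemma quasi_geodesic_near:
  assumes "0 \<le> A" "0 < L"
  obtains C where "\<And>n (p :: nat \<Rightarrow> 'a) w.
    \<lbrakk>\<And>i. i \<le> n \<Longrightarrow> p i \<in> X; \<And>i. i < n \<Longrightarrow> d (p i) (p (Suc i)) \<le> A;
     \<And>i j. \<lbrakk>i \<le> j; j \<le> n\<rbrakk> \<Longrightarrow> real (j - i) \<le> L * d (p i) (p j) + L; w \<in> X\<rbrakk>
    \<Longrightarrow> \<exists>i\<le>n. d w (p i) \<le> 2 * gp (p 0) (p n) w + C"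
proof -
  obtain s :: nat where s: "4 * L * \<delta> \<le> real s" "0 < s"
    by (metis gr0I linorder_not_le real_nat_ceiling_ge not_one_le_zero order.trans
        of_nat_le_iff real_arch_simple nle_le zero_less_iff_neq_zero less_one)
  define C where "C = 2 * (real s * A + 2 * \<delta> + 1)"
  show ?thesis
  proof (rule that[of C])
    fix n and p :: "nat \<Rightarrow> 'a" and w
    assume p: "\<And>i. i \<le> n \<Longrightarrow> p i \<in> X" and A: "\<And>i. i < n \<Longrightarrow> d (p i) (p (Suc i)) \<le> A"
      and L: "\<And>i j. \<lbrakk>i \<le> j; j \<le> n\<rbrakk> \<Longrightarrow> real (j - i) \<le> L * d (p i) (p j) + L" and w: "w \<in> X"
    obtain m where m: "m \<le> n" "\<And>i. i \<le> n \<Longrightarrow> d w (p m) \<le> d w (p i)"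
      using ex_min_if_finite[of "(\<lambda>i. d w (p i)) ` {..n}"]
      by (auto simp: linorder_not_less)
    have "d w (p m) / 2 - real s * A - \<delta> - 1 \<le> gp (p (m + 0)) (p (m + (n - m))) w"
    proof (rule quasi_geodesic_half[where p = "\<lambda>i. p (m + i)" and L = L])
      show "real i \<le> L * d (p (m + 0)) (p (m + i)) + L" if "i \<le> n - m" for i
        using L[of m "m + i"] that m by simp
    qed (use m p A assms w s in auto)
    moreover have "d w (p m) / 2 - real s * A - \<delta> - 1 \<le> gp (p (m - 0)) (p (m - m)) w"
    proof (rule quasi_geodesic_half[where p = "\<lambda>i. p (m - i)" and L = L])
      show "real i \<le> L * d (p (m - 0)) (p (m - i)) + L" if "i \<le> m" for i
        using L[of "m - i" m] that m sym[OF p p, of "m - i" m] by simp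
      show "d (p (m - i)) (p (m - Suc i)) \<le> A" if "i < m" for i
        using A[of "m - Suc i"] that m sym[OF p p, of "m - i" "m - Suc i"]
        by (simp add: Suc_diff_Suc)
    qed (use m p assms w s in auto)
    moreover have "min (gp (p 0) (p m) w) (gp (p m) (p n) w) - \<delta> \<le> gp (p 0) (p n) w"
      using m p w by (intro hyperbolic) auto
    ultimately have "d w (p m) \<le> 2 * gp (p 0) (p n) w + C"
      using m gp_commute[OF p p w, of 0 m] by (simp add: C_def)
    then show "\<exists>i\<le>n. d w (p i) \<le> 2 * gp (p 0) (p n) w + C" using m by blast
  qed
qed

end

section \<open>Word length in a hyperbolic group\<close>

locale marked_group = group G for G (structure) +
  fixes S :: "'a set"
  assumes gens: "finite_sym_gen_set G S"
begin

abbreviation word_prod :: "'a list \<Rightarrow> 'a" where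
  "word_prod ws \<equiv> foldr (\<otimes>) ws \<one>"

abbreviation len :: "'a \<Rightarrow> real" where
  "len x \<equiv> real (word_length G S x)"

lemma S_carrier: "s \<in> S \<Longrightarrow> s \<in> carrier G"
  and S_inv: "s \<in> S \<Longrightarrow> inv s \<in> S"
  and S_finite: "finite S"
  using gens by (auto simp: finite_sym_gen_set_def)

lemma word_prod_closed [simp]: "set ws \<subseteq> carrier G \<Longrightarrow> word_prod ws \<in> carrier G"
  by (induction ws) auto

lemma foldr_mult:
  "\<lbrakk>set us \<subseteq> carrier G; y \<in> carrier G\<rbrakk> \<Longrightarrow> foldr (\<otimes>) us y = word_prod us \<otimes> y"
  by (induction us) (auto simp: m_assoc)

lemma word_prod_append:
  "\<lbrakk>set us \<subseteq> carrier G; set vs \<subseteq> carrier G\<rbrakk> \<Longrightarrow> word_prod (us @ vs) = word_prod us \<otimes> word_prod vs"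
  by (simp add: foldr_mult[of us "word_prod vs"])

lemma word_prod_rev_inv:
  "set ws \<subseteq> carrier G \<Longrightarrow> word_prod (rev (map (m_inv G) ws)) = inv (word_prod ws)"
proof (induction ws)
  case (Cons a ws)
  then have "set (rev (map (m_inv G) ws)) \<subseteq> carrier G" by auto
  then show ?case using Cons by (simp add: foldr_mult[of _ "inv a"] inv_mult_group)
qed simp

lemma ex_word:
  assumes "x \<in> carrier G"
  shows "\<exists>ws. set ws \<subseteq> S \<and> word_prod ws = x"
proof -
  have "x \<in> generate G S" using assms gens by (simp add: finite_sym_gen_set_def)
  then show ?thesis
  proof induction
    case one
    then show ?case by (intro exI[of _ "[]"]) auto
  next
    case (incl h)
    then show ?case using S_carrier by (intro exI[of _ "[h]"]) auto
  next
    case (inv h)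
    then show ?case using S_carrier S_inv by (intro exI[of _ "[inv h]"]) auto
  next
    case (eng h1 h2)
    then obtain u v where "set u \<subseteq> S" "word_prod u = h1" "set v \<subseteq> S" "word_prod v = h2" by blast
    moreover have "word_prod (u @ v) = word_prod u \<otimes> word_prod v"
      using calculation S_carrier by (intro word_prod_append) auto
    ultimately show ?case by (intro exI[of _ "u @ v"]) auto
  qed
qed

lemma shortest_word:
  assumes "x \<in> carrier G"
  obtains ws where "set ws \<subseteq> S" "word_prod ws = x" "length ws = word_length G S x"
proof -
  obtain ws where ws: "set ws \<subseteq> S \<and> word_prod ws = x" using ex_word[OF assms] ..
  have "\<exists>ws. length ws = word_length G S x \<and> set ws \<subseteq> S \<and> word_prod ws = x"
    unfolding word_length_def by (rule LeastI[of _ "length ws"], rule exI[of _ ws]) (simp add: ws)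
  then show ?thesis by (elim exE conjE) (rule that)
qed

lemma word_length_le: "set ws \<subseteq> S \<Longrightarrow> word_length G S (word_prod ws) \<le> length ws"
  unfolding word_length_def by (rule Least_le, rule exI[of _ ws]) simp

lemma len_one [simp]: "len \<one> = 0"
  using word_length_le[of "[]"] by simp

lemma len_mult:
  assumes "x \<in> carrier G" "y \<in> carrier G"
  shows "len (x \<otimes> y) \<le> len x + len y"
proof -
  obtain u where u: "set u \<subseteq> S" "word_prod u = x" "length u = word_length G S x"
    by (rule shortest_word[OF assms(1)])
  obtain v where v: "set v \<subseteq> S" "word_prod v = y" "length v = word_length G S y"
    by (rule shortest_word[OF assms(2)])
  note uv = u v
  then have "word_prod (u @ v) = x \<otimes> y" using S_carrier by (subst word_prod_append) auto
  then show ?thesis using word_length_le[of "u @ v"] uv by simp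
qed

lemma len_inv_le:
  assumes "x \<in> carrier G"
  shows "len (inv x) \<le> len x"
proof -
  obtain u where u: "set u \<subseteq> S" "word_prod u = x" "length u = word_length G S x"
    by (rule shortest_word[OF assms])
  then have "word_prod (rev (map (m_inv G) u)) = inv x" using S_carrier
    by (subst word_prod_rev_inv) auto
  moreover have "set (rev (map (m_inv G) u)) \<subseteq> S" using u S_inv by auto
  ultimately show ?thesis using word_length_le[of "rev (map (m_inv G) u)"] u by simp
qed

lemma len_inv [simp]: "x \<in> carrier G \<Longrightarrow> len (inv x) = len x"
  using len_inv_le[of x] len_inv_le[of "inv x"] by simp

lemma finite_ball: "finite {x \<in> carrier G. len x \<le> r}"
proof -
  have "{x \<in> carrier G. len x \<le> r} \<subseteq> word_prod ` {ws. set ws \<subseteq> S \<and> length ws \<le> nat \<lfloor>r\<rfloor>}"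
  proof
    fix x assume x: "x \<in> {x \<in> carrier G. len x \<le> r}"
    then obtain u where u: "set u \<subseteq> S" "word_prod u = x" "length u = word_length G S x"
      using shortest_word[of x] by auto
    have "length u \<le> nat \<lfloor>r\<rfloor>" using x u by (simp add: le_nat_floor)
    then show "x \<in> word_prod ` {ws. set ws \<subseteq> S \<and> length ws \<le> nat \<lfloor>r\<rfloor>}" using u by blast
  qed
  then show ?thesis using finite_lists_length_le[OF S_finite] finite_subset by blast
qed

lemma geodesic_split:
  assumes "x \<in> carrier G" "n \<le> word_length G S x"
  obtains y z where "y \<in> carrier G" "z \<in> carrier G" "x = y \<otimes> z" "len y = real n" "len z = len x - real n"
proof -
  obtain u where u: "set u \<subseteq> S" "word_prod u = x" "length u = word_length G S x"
    by (rule shortest_word[OF assms(1)])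
  define y z where "y = word_prod (take n u)" and "z = word_prod (drop n u)"
  have sub: "set (take n u) \<subseteq> S" "set (drop n u) \<subseteq> S"
    using u set_take_subset[of n u] set_drop_subset[of n u] by auto
  have yz: "y \<in> carrier G" "z \<in> carrier G" unfolding y_def z_def using sub S_carrier by (auto intro!: word_prod_closed)
  have x: "x = y \<otimes> z" unfolding y_def z_def u(2)[symmetric] using sub S_carrier
    by (subst word_prod_append[symmetric]) auto
  have "len y \<le> real n" "len z \<le> len x - real n"
    using word_length_le[OF sub(1)] word_length_le[OF sub(2)] u(3) assms(2) 
    by (auto simp: y_def z_def)
  moreover have "len x \<le> len y + len z" using len_mult[OF yz] x by simp
  ultimately show ?thesis using that[of y z] yz x by simp
qed

abbreviation dist :: "'a \<Rightarrow> 'a \<Rightarrow> real" where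
  "dist \<equiv> word_metric G S"

lemma inv_solve: 
  assumes "x \<in> carrier G" "y \<in> carrier G" "z \<in> carrier G"
  shows "inv (x \<otimes> y) \<otimes> (x \<otimes> z) = inv y \<otimes> z"
  using assms by (simp add: inv_mult_group m_assoc) (simp add: m_assoc[symmetric])

lemma inv_trans:
  assumes "x \<in> carrier G" "y \<in> carrier G" "z \<in> carrier G"
  shows "inv x \<otimes> y \<otimes> (inv y \<otimes> z) = inv x \<otimes> z"
  using assms by (simp add: m_assoc) (simp add: m_assoc[symmetric])

lemma mult_inv_cancel: "\<lbrakk>x \<in> carrier G; y \<in> carrier G\<rbrakk> \<Longrightarrow> x \<otimes> (inv x \<otimes> y) = y"
  "\<lbrakk>x \<in> carrier G; y \<in> carrier G\<rbrakk> \<Longrightarrow> inv x \<otimes> (x \<otimes> y) = y"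
  by (simp_all add: m_assoc[symmetric])

lemma subadditive_le_len:
  assumes f: "\<And>x y. \<lbrakk>x \<in> carrier G; y \<in> carrier G\<rbrakk> \<Longrightarrow> f (x \<otimes> y) \<le> f x + (f y :: real)"
  obtains M where "1 \<le> M" "\<And>x. x \<in> carrier G \<Longrightarrow> f x \<le> M * len x + f \<one>"
proof -
  define M where "M = 1 + (\<Sum>s\<in>S. \<bar>f s\<bar>)"
  have M: "f s \<le> M" if "s \<in> S" for s
    using member_le_sum[of s S "\<lambda>s. \<bar>f s\<bar>"] S_finite that by (simp add: M_def)
  have words: "set u \<subseteq> S \<Longrightarrow> f (word_prod u) \<le> M * real (length u) + f \<one>" for u
  proof (induction u)
    case (Cons a u)
    then have "f (a \<otimes> word_prod u) \<le> f a + f (word_prod u)"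
      using S_carrier by (intro f) (auto intro!: word_prod_closed)
    then show ?case using Cons M[of a] by (simp add: algebra_simps)
  qed simp
  show ?thesis
  proof (rule that[of M])
    show "1 \<le> M" by (simp add: M_def sum_nonneg)
    show "f x \<le> M * len x + f \<one>" if "x \<in> carrier G" for x
      using shortest_word[OF that] words by metis
  qed
qed

end

locale hyperbolic_marked_group = marked_group G S for G (structure) and S :: "'a set" +
  fixes \<delta> :: real
  assumes hyp_word: "\<lbrakk>x \<in> carrier G; y \<in> carrier G; z \<in> carrier G; w \<in> carrier G\<rbrakk> \<Longrightarrow>
      gromov_product (word_metric G S) x z w \<ge>
        min (gromov_product (word_metric G S) x y w) (gromov_product (word_metric G S) y z w) - \<delta>"
    and delta0: "0 \<le> \<delta>"
begin

sublocale hyperbolic_pseudometric "carrier G" dist \<delta>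
proof
  fix x y z w assume x: "x \<in> carrier G" and y: "y \<in> carrier G" and z: "z \<in> carrier G" and w: "w \<in> carrier G"
  show "0 \<le> dist x y" by (simp add: word_metric_def)
  show "dist x x = 0" using x by (simp add: word_metric_def)
  show "dist x y = dist y x" using x y len_inv[of "inv x \<otimes> y"] by (simp add: word_metric_def inv_mult_group)
  show "dist x z \<le> dist x y + dist y z" 
    using len_mult[of "inv x \<otimes> y" "inv y \<otimes> z"] inv_trans[OF x y z] x y z by (simp add: word_metric_def)
  show "gromov_product dist x z w \<ge> min (gromov_product dist x y w) (gromov_product dist y z w) - \<delta>"
    using hyp_word x y z w .
qed (use delta0 in auto)

lemma dist_mult [simp]:
  "\<lbrakk>g \<in> carrier G; x \<in> carrier G; y \<in> carrier G\<rbrakk> \<Longrightarrow> dist (g \<otimes> x) (g \<otimes> y) = dist x y"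
  by (simp add: word_metric_def inv_solve)

lemma dist_one: "x \<in> carrier G \<Longrightarrow> dist \<one> x = len x" "x \<in> carrier G \<Longrightarrow> dist x \<one> = len x"
  by (simp_all add: word_metric_def)

lemma dist_mult_self: 
  "\<lbrakk>g \<in> carrier G; x \<in> carrier G\<rbrakk> \<Longrightarrow> dist g (g \<otimes> x) = len x"
  "\<lbrakk>g \<in> carrier G; x \<in> carrier G\<rbrakk> \<Longrightarrow> dist (g \<otimes> x) g = len x"
  using dist_mult[of g "\<one>" x] dist_mult[of g x "\<one>"] by (simp_all add: dist_one)

lemma gp_mult:
  "\<lbrakk>g \<in> carrier G; x \<in> carrier G; y \<in> carrier G; w \<in> carrier G\<rbrakk> \<Longrightarrow> gp (g \<otimes> x) (g \<otimes> y) (g \<otimes> w) = gp x y w"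
  by (simp add: gromov_product_def)

lemma gp_at_one:
  "\<lbrakk>x \<in> carrier G; y \<in> carrier G; w \<in> carrier G\<rbrakk> \<Longrightarrow> gp x y w = gp (inv w \<otimes> x) (inv w \<otimes> y) \<one>"
  using gp_mult[of "inv w" x y w] by simp

lemma left_invariant_word: "left_invariant G dist"
  by (simp add: left_invariant_def)

lemma word_metric_in_D: "dist \<in> metrics_D G"
proof -
  have "pseudometric_on (carrier G) dist" 
    unfolding pseudometric_on_def using nonneg refl triangle by blast
  moreover have "hyperbolic_on (carrier G) dist"
    unfolding hyperbolic_on_def using delta0 hyp_word by blast
  moreover have "quasi_isometric_id_on (carrier G) dist dist"
    unfolding quasi_isometric_id_on_def by (intro exI[of _ 1] exI[of _ 0] conjI) auto
  ultimately show ?thesis unfolding metrics_D_def using sym left_invariant_word gens by blast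
qed

end

section \<open>Potentials\<close>

context hyperbolic_marked_group
begin

lemma potential_left:
  assumes "\<psi> \<in> potentials_H G" "x \<in> carrier G" "y \<in> carrier G"
  shows "\<psi> x (x \<otimes> y) = \<psi> \<one> y"
proof -
  have "left_invariant G \<psi>" using assms(1) by (simp add: potentials_H_def)
  then have "\<psi> (x \<otimes> \<one>) (x \<otimes> y) = \<psi> \<one> y" using assms(2,3) unfolding left_invariant_def by blast
  then show ?thesis using assms(2) by simp
qed

text \<open>
  The Gromov product of \<open>1\<close> and \<open>x y\<close> at \<open>x\<close> is half the defect of additivity, and the word metric is
  one of the metrics against which a potential is tested.
\<close>

lemma potential_almost_additive:
  assumes \<psi>: "\<psi> \<in> potentials_H G"
  obtains K where "0 < K" "\<And>x y. \<lbrakk>x \<in> carrier G; y \<in> carrier G\<rbrakk> \<Longrightarrow>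
    \<bar>\<psi> \<one> (x \<otimes> y) - \<psi> \<one> x - \<psi> \<one> y\<bar> \<le> K * gp (inv x) y \<one> + K"
proof -
  have "\<exists>c>0. \<forall>x\<in>carrier G. \<forall>y\<in>carrier G. \<forall>w\<in>carrier G. \<bar>gromov_product \<psi> x y w\<bar> \<le> c * gp x y w + c"
    using \<psi> word_metric_in_D by (auto simp: potentials_H_def)
  then obtain c where c: "c > 0" "\<And>x y w. \<lbrakk>x \<in> carrier G; y \<in> carrier G; w \<in> carrier G\<rbrakk> \<Longrightarrow>
       \<bar>gromov_product \<psi> x y w\<bar> \<le> c * gp x y w + c" by blast
  have "\<bar>\<psi> \<one> (x \<otimes> y) - \<psi> \<one> x - \<psi> \<one> y\<bar> \<le> (2 * c) * gp (inv x) y \<one> + 2 * c"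
    if "x \<in> carrier G" "y \<in> carrier G" for x y
  proof -
    have "\<bar>(\<psi> \<one> x + \<psi> \<one> y - \<psi> \<one> (x \<otimes> y)) / 2\<bar> \<le> c * gp (inv x) y \<one> + c"
      using c(2)[of \<one> "x \<otimes> y" x] that potential_left[OF \<psi> that] gp_at_one[of \<one> "x \<otimes> y" x]
      by (simp add: mult_inv_cancel gromov_product_def[of \<psi>])
    then show ?thesis unfolding mult.assoc abs_le_iff by argo
  qed
  then show ?thesis using that[of "2 * c"] c(1) by simp
qed

lemma potential_lipschitz:
  assumes \<psi>: "\<psi> \<in> potentials_H G"
  obtains M where "0 < M"
    "\<And>x. x \<in> carrier G \<Longrightarrow> \<bar>\<psi> \<one> x\<bar> \<le> M * len x + M"
    "\<And>x y. \<lbrakk>x \<in> carrier G; y \<in> carrier G\<rbrakk> \<Longrightarrow> \<bar>\<psi> \<one> (x \<otimes> y) - \<psi> \<one> x\<bar> \<le> M * len y + M"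
    "\<And>x y. \<lbrakk>x \<in> carrier G; y \<in> carrier G\<rbrakk> \<Longrightarrow> \<bar>\<psi> \<one> (x \<otimes> y) - \<psi> \<one> y\<bar> \<le> M * len x + M"
proof -
  obtain K where K: "0 < K" "\<And>x y. \<lbrakk>x \<in> carrier G; y \<in> carrier G\<rbrakk> \<Longrightarrow>
    \<bar>\<psi> \<one> (x \<otimes> y) - \<psi> \<one> x - \<psi> \<one> y\<bar> \<le> K * gp (inv x) y \<one> + K"
    using potential_almost_additive[OF \<psi>] by blast
  define P where "P = (\<Sum>s\<in>S. \<bar>\<psi> \<one> s\<bar>)"
  have P: "\<bar>\<psi> \<one> s\<bar> \<le> P" if "s \<in> S" for s
    unfolding P_def using member_le_sum[of s S "\<lambda>s. \<bar>\<psi> \<one> s\<bar>"] S_finite that by simp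
  have P0: "0 \<le> P" by (simp add: P_def sum_nonneg)
  define Q where "Q = P + 2 * K"
  have len_S: "len s \<le> 1" if "s \<in> S" for s
    using word_length_le[of "[s]"] that S_carrier by auto
  have words: "set u \<subseteq> S \<Longrightarrow> \<bar>\<psi> \<one> (word_prod u)\<bar> \<le> Q * real (length u) + \<bar>\<psi> \<one> \<one>\<bar>" for u
  proof (induction u)
    case (Cons a u)
    have a: "a \<in> carrier G" "word_prod u \<in> carrier G" "a \<in> S"
      using Cons.prems S_carrier by (auto intro!: word_prod_closed)
    have "gp (inv a) (word_prod u) \<one> \<le> 1"
      using gp_le_dist(1)[of "inv a" "word_prod u" \<one>] a len_S[of a] by (simp add: dist_one)
    then have "K * gp (inv a) (word_prod u) \<one> \<le> K" using K(1) by simp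
    then have "\<bar>\<psi> \<one> (a \<otimes> word_prod u) - \<psi> \<one> a - \<psi> \<one> (word_prod u)\<bar> \<le> 2 * K"
      using K(2)[OF a(1,2)] by simp
    then show ?case using Cons P[of a] a by (simp add: algebra_simps Q_def)
  qed simp
  have bound: "\<bar>\<psi> \<one> x\<bar> \<le> Q * len x + \<bar>\<psi> \<one> \<one>\<bar>" if "x \<in> carrier G" for x
    by (rule shortest_word[OF that]) (metis words)
  define M where "M = Q + K + \<bar>\<psi> \<one> \<one>\<bar>"
  have KM: "K * t + (Q * t + \<bar>\<psi> \<one> \<one>\<bar>) + K \<le> M * t + M" if "0 \<le> t" for t
  proof -
    have "0 \<le> \<bar>\<psi> \<one> \<one>\<bar> * t" "0 \<le> Q" using that P0 K(1) by (auto simp: Q_def)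
    then show ?thesis by (simp add: M_def algebra_simps)
  qed
  show ?thesis
  proof (rule that[of M])
    show "0 < M" using K(1) P0 by (simp add: M_def Q_def)
    show "\<bar>\<psi> \<one> x\<bar> \<le> M * len x + M" if "x \<in> carrier G" for x
      using bound[OF that] KM[of "len x"] K(1) mult_nonneg_nonneg[of K "len x"] by linarith
    show "\<bar>\<psi> \<one> (x \<otimes> y) - \<psi> \<one> x\<bar> \<le> M * len y + M" if xy: "x \<in> carrier G" "y \<in> carrier G" for x y
    proof -
      have "K * gp (inv x) y \<one> \<le> K * len y"
        using gp_le_dist(2)[of "inv x" y \<one>] K(1) xy by (intro mult_left_mono) (auto simp: dist_one)
      then show ?thesis using K(2)[OF xy] bound[OF xy(2)] KM[of "len y"] by linarith
    qed
    show "\<bar>\<psi> \<one> (x \<otimes> y) - \<psi> \<one> y\<bar> \<le> M * len x + M" if xy: "x \<in> carrier G" "y \<in> carrier G" for x y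
    proof -
      have "K * gp (inv x) y \<one> \<le> K * len x"
        using gp_le_dist(1)[of "inv x" y \<one>] K(1) xy by (intro mult_left_mono) (auto simp: dist_one)
      then show ?thesis using K(2)[OF xy] bound[OF xy(1)] KM[of "len x"] by linarith
    qed
  qed
qed

text \<open>
  By properness \<open>\<psi>\<close> exceeds the additivity error on all elements of some length \<open>n\<close>. Cutting a geodesic
  word into pieces of this length, each piece contributes at least 1.
\<close>

lemma proper_potential_lower_bound:
  assumes \<psi>: "\<psi> \<in> potentials_Hpp G"
  obtains M B where "0 < M" "\<And>x. x \<in> carrier G \<Longrightarrow> len x \<le> M * \<psi> \<one> x + B"
proof -
  obtain K where K: "0 < K" "\<And>x y. \<lbrakk>x \<in> carrier G; y \<in> carrier G\<rbrakk> \<Longrightarrow>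
    \<bar>\<psi> \<one> (x \<otimes> y) - \<psi> \<one> x - \<psi> \<one> y\<bar> \<le> K * gp (inv x) y \<one> + K"
    using potential_almost_additive \<psi> unfolding potentials_Hpp_def by blast
  obtain b where b: "\<And>x y. \<lbrakk>x \<in> carrier G; y \<in> carrier G\<rbrakk> \<Longrightarrow> b \<le> \<psi> x y"
    using \<psi> unfolding potentials_Hpp_def by blast
  have "finite (word_length G S ` {g \<in> carrier G. \<psi> \<one> g \<le> K + 1})"
    using \<psi> unfolding potentials_Hpp_def by blast
  then obtain m where m: "\<And>g. g \<in> carrier G \<Longrightarrow> \<psi> \<one> g \<le> K + 1 \<Longrightarrow> word_length G S g \<le> m"
    using finite_nat_set_iff_bounded_le by auto
  define n where "n = Suc m"
  have n: "K + 1 < \<psi> \<one> g" if "g \<in> carrier G" "n \<le> word_length G S g" for g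
    using m[OF that(1)] that(2) unfolding n_def by fastforce
  define B where "B = real n * (1 + \<bar>b\<bar>)"
  have main: "g \<in> carrier G \<Longrightarrow> len g \<le> real n * \<psi> \<one> g + B" for g
  proof (induction "word_length G S g" arbitrary: g rule: less_induct)
    case less
    show ?case
    proof (cases "n \<le> word_length G S g")
      case False
      have "real n * b \<le> real n * \<psi> \<one> g" using b[of \<one> g] less.prems by (intro mult_left_mono) auto
      moreover have "0 \<le> real n * (b + \<bar>b\<bar>)" by (intro mult_nonneg_nonneg) auto
      moreover have "len g \<le> real n" using False by simp
      ultimately show ?thesis unfolding B_def distrib_left mult_1_right by linarith
    next
      case True
      obtain y z where yz: "y \<in> carrier G" "z \<in> carrier G" "g = y \<otimes> z" "len y = real n" "len z = len g - real n"
        using geodesic_split[OF less.prems True] by blast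
      have "gp (inv y) z \<one> = 0"
        using yz dist_mult_self(2) by (simp add: gromov_product_def dist_one word_metric_def)
      then have "\<bar>\<psi> \<one> g - \<psi> \<one> y - \<psi> \<one> z\<bar> \<le> K" using K(2)[OF yz(1,2)] yz by simp
      then have "\<psi> \<one> z + 1 \<le> \<psi> \<one> g" using n[OF yz(1)] yz(4) by auto
      then have "real n * (\<psi> \<one> z + 1) \<le> real n * \<psi> \<one> g" by (intro mult_left_mono) auto
      moreover have "len z \<le> real n * \<psi> \<one> z + B" using yz True n_def by (intro less.hyps) auto
      ultimately show ?thesis using yz by (simp add: algebra_simps)
    qed
  qed
  then show ?thesis using that[of "real n" B] by (simp add: n_def)
qed

end

section \<open>Weighted word lengths\<close>

context marked_group
begin

text \<open>
  A letter is a pair of a group element and its weight, so that an element may be available at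
  several weights and enlarging the set of letters can only shorten words.
\<close>

definition wlen :: "('a \<times> real) set \<Rightarrow> 'a \<Rightarrow> real" where
  "wlen W x = (INF ws \<in> {ws. set ws \<subseteq> W \<and> word_prod (map fst ws) = x}. sum_list (map snd ws))"

text \<open>
  Weights of at least 1 bound the number of letters of a word by its weight, and weights of at least half
  the length keep the weighted length comparable with the word length.
\<close>

definition admissible :: "('a \<times> real) set \<Rightarrow> bool" where
  "admissible W \<longleftrightarrow> finite W \<and> (\<forall>s\<in>S. (s, 1) \<in> W) \<and>
     (\<forall>(x, r)\<in>W. x \<in> carrier G \<and> 1 \<le> r \<and> len x \<le> 2 * r)"

context
  fixes W
  assumes W: "admissible W"
begin

lemma weighted_letters:
  assumes "set ws \<subseteq> W"
  shows "set (map fst ws) \<subseteq> carrier G" "real (length ws) \<le> sum_list (map snd ws)"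
proof -
  show "set (map fst ws) \<subseteq> carrier G" using assms W by (force simp: admissible_def)
  show "real (length ws) \<le> sum_list (map snd ws)" using assms
  proof (induction ws)
    case (Cons a ws)
    then have "1 \<le> snd a" using W by (cases a) (auto simp: admissible_def)
    then show ?case using Cons by simp
  qed simp
qed

lemma weight_nonneg: "set ws \<subseteq> W \<Longrightarrow> 0 \<le> sum_list (map snd ws)"
  using weighted_letters(2)[of ws] by linarith

lemma ex_weighted_word:
  assumes "x \<in> carrier G"
  shows "\<exists>ws. set ws \<subseteq> W \<and> word_prod (map fst ws) = x \<and> sum_list (map snd ws) = len x"
proof -
  obtain u where u: "set u \<subseteq> S" "word_prod u = x" "length u = word_length G S x"
    by (rule shortest_word[OF assms])
  have "set (map (\<lambda>s. (s, 1::real)) u) \<subseteq> W" using u W by (auto simp: admissible_def)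
  moreover have "map fst (map (\<lambda>s. (s, 1::real)) u) = u" by (simp add: o_def)
  moreover have "sum_list (map snd (map (\<lambda>s. (s, 1::real)) u)) = real (length u)"
    by (simp add: o_def sum_list_triv)
  ultimately show ?thesis using u by metis
qed

lemma wlen_le:
  assumes "set ws \<subseteq> W" "word_prod (map fst ws) = x"
  shows "wlen W x \<le> sum_list (map snd ws)"
  unfolding wlen_def
proof (rule cINF_lower)
  show "bdd_below ((\<lambda>ws. sum_list (map snd ws)) ` {ws. set ws \<subseteq> W \<and> word_prod (map fst ws) = x})"
    using weight_nonneg by (intro bdd_belowI2[of _ 0]) simp
qed (use assms in auto)

lemma wlen_le_len:
  assumes "x \<in> carrier G"
  shows "wlen W x \<le> len x"
proof -
  obtain ws where ws: "set ws \<subseteq> W \<and> word_prod (map fst ws) = x \<and> sum_list (map snd ws) = len x"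
    using ex_weighted_word[OF assms] ..
  then show ?thesis using wlen_le[of ws x] by simp
qed

lemma wlen_letter: "(x, r) \<in> W \<Longrightarrow> wlen W x \<le> r"
  using wlen_le[of "[(x, r)]" x] W by (auto simp: admissible_def)

lemma wlen_greatest:
  assumes "x \<in> carrier G"
    "\<And>ws. \<lbrakk>set ws \<subseteq> W; word_prod (map fst ws) = x\<rbrakk> \<Longrightarrow> c \<le> sum_list (map snd ws)"
  shows "c \<le> wlen W x"
proof -
  obtain ws where ws: "set ws \<subseteq> W \<and> word_prod (map fst ws) = x \<and> sum_list (map snd ws) = len x"
    using ex_weighted_word[OF assms(1)] ..
  then have "{ws. set ws \<subseteq> W \<and> word_prod (map fst ws) = x} \<noteq> {}" by (auto simp only: mem_Collect_eq)
  then show ?thesis unfolding wlen_def by (rule cINF_greatest) (use assms(2) in simp)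
qed

lemma wlen_near_optimal:
  assumes "x \<in> carrier G"
  obtains ws where "set ws \<subseteq> W" "word_prod (map fst ws) = x" "sum_list (map snd ws) \<le> wlen W x + 1"
proof (rule ccontr)
  assume neg: "\<not> thesis"
  have "wlen W x + 1 \<le> wlen W x"
    by (rule wlen_greatest[OF assms]) (use neg that in force)
  then show False by simp
qed

lemma wlen_nonneg: "x \<in> carrier G \<Longrightarrow> 0 \<le> wlen W x"
  by (rule wlen_greatest) (simp_all add: weight_nonneg)

text \<open>
  A function on pairs that obeys the triangle inequality and is bounded by the weights on the
  letters is bounded by the weighted length. This is how geometric lower bounds for weighted
  lengths are obtained.
\<close>

lemma wlen_dominates:
  assumes tri: "\<And>x y z. \<lbrakk>x \<in> carrier G; y \<in> carrier G; z \<in> carrier G\<rbrakk> \<Longrightarrow> \<Phi> x z \<le> \<Phi> x y + \<Phi> y z"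
    and zero: "\<And>x. x \<in> carrier G \<Longrightarrow> \<Phi> x x \<le> 0"
    and letter: "\<And>x y r. \<lbrakk>x \<in> carrier G; (y, r) \<in> W\<rbrakk> \<Longrightarrow> \<Phi> x (x \<otimes> y) \<le> r"
    and x: "x \<in> carrier G" and y: "y \<in> carrier G"
  shows "\<Phi> x (x \<otimes> y) \<le> wlen W y"
proof (rule wlen_greatest[OF y])
  fix ws assume "set ws \<subseteq> W" "word_prod (map fst ws) = y"
  then show "\<Phi> x (x \<otimes> y) \<le> sum_list (map snd ws)" using x
  proof (induction ws arbitrary: x y)
    case Nil
    then show ?case using zero by auto
  next
    case (Cons a ws)
    let ?z = "word_prod (map fst ws)"
    have ws: "set ws \<subseteq> W" using Cons.prems by simp
    have c: "fst a \<in> carrier G" "?z \<in> carrier G"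
      using weighted_letters(1)[OF Cons.prems(1)] by (auto intro!: word_prod_closed)
    have "\<Phi> x (x \<otimes> fst a) \<le> snd a" using Cons.prems by (intro letter) auto
    moreover have "\<Phi> (x \<otimes> fst a) (x \<otimes> fst a \<otimes> ?z) \<le> sum_list (map snd ws)"
      using ws c Cons.prems by (intro Cons.IH) auto
    moreover have "y = fst a \<otimes> ?z" using Cons.prems by simp
    ultimately show ?case using tri[of x "x \<otimes> fst a" "x \<otimes> y"] c Cons.prems(3) by (simp add: m_assoc)
  qed
qed

lemma wlen_mult:
  assumes "x \<in> carrier G" "y \<in> carrier G"
  shows "wlen W (x \<otimes> y) \<le> wlen W x + wlen W y"
proof -
  have "wlen W (x \<otimes> y) - wlen W x \<le> wlen W y"
  proof (rule wlen_greatest[OF assms(2)])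
    fix v assume v: "set v \<subseteq> W" "word_prod (map fst v) = y"
    have "wlen W (x \<otimes> y) - sum_list (map snd v) \<le> wlen W x"
    proof (rule wlen_greatest[OF assms(1)])
      fix u assume u: "set u \<subseteq> W" "word_prod (map fst u) = x"
      have "word_prod (map fst (u @ v)) = x \<otimes> y"
        using word_prod_append[OF weighted_letters(1)[OF u(1)] weighted_letters(1)[OF v(1)]] u(2) v(2)
        by (simp only: map_append)
      then have "wlen W (x \<otimes> y) \<le> sum_list (map snd (u @ v))"
        using u v by (intro wlen_le) auto
      then show "wlen W (x \<otimes> y) - sum_list (map snd v) \<le> sum_list (map snd u)" by simp
    qed
    then show "wlen W (x \<otimes> y) - wlen W x \<le> sum_list (map snd v)" by simp
  qed
  then show ?thesis by simp
qed

lemma len_le_wlen: 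
  assumes "x \<in> carrier G"
  shows "len x \<le> 2 * wlen W x"
proof -
  have "len (inv \<one> \<otimes> (\<one> \<otimes> x)) / 2 \<le> wlen W x"
  proof (rule wlen_dominates[where \<Phi> = "\<lambda>x y. len (inv x \<otimes> y) / 2"])
    show "len (inv x \<otimes> z) / 2 \<le> len (inv x \<otimes> y) / 2 + len (inv y \<otimes> z) / 2"
      if "x \<in> carrier G" "y \<in> carrier G" "z \<in> carrier G" for x y z
      using len_mult[of "inv x \<otimes> y" "inv y \<otimes> z"] inv_trans[OF that] that by simp
    show "len (inv x \<otimes> (x \<otimes> y)) / 2 \<le> r" if "x \<in> carrier G" "(y, r) \<in> W" for x y r
      using that W mult_inv_cancel(2)[of x y] by (auto simp: admissible_def)
  qed (use assms in auto)
  then show ?thesis using assms by simp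
qed

end

end

context hyperbolic_marked_group
begin

definition wmetric :: "('a \<times> real) set \<Rightarrow> 'a \<Rightarrow> 'a \<Rightarrow> real" where
  "wmetric W x y = wlen W (inv x \<otimes> y)"

lemma wmetric_one: "x \<in> carrier G \<Longrightarrow> wmetric W \<one> x = wlen W x"
  by (simp add: wmetric_def)

text \<open>
  The metrics in \<^term>\<open>metrics_D G\<close> may be controlled by any finite generating set; the word lengths of two
  generating sets bound each other because both are subadditive.
\<close>

lemma word_metric_quasi_isometric:
  assumes d: "d \<in> metrics_D G"
  obtains L where "1 \<le> L" "\<And>x y. \<lbrakk>x \<in> carrier G; y \<in> carrier G\<rbrakk> \<Longrightarrow> dist x y \<le> L * d x y + L"
    "\<And>x y. \<lbrakk>x \<in> carrier G; y \<in> carrier G\<rbrakk> \<Longrightarrow> d x y \<le> L * dist x y + L"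
proof -
  obtain S' where S': "finite_sym_gen_set G S'" "quasi_isometric_id_on (carrier G) d (word_metric G S')"
    using d by (auto simp: metrics_D_def)
  interpret M': marked_group G S' by unfold_locales (rule S')
  obtain l A where l: "1 \<le> l" "0 \<le> A" "\<And>x y. \<lbrakk>x \<in> carrier G; y \<in> carrier G\<rbrakk> \<Longrightarrow>
      word_metric G S' x y / l - A \<le> d x y \<and> d x y \<le> l * word_metric G S' x y + A"
    using S'(2) unfolding quasi_isometric_id_on_def by blast
  obtain M1 where M1: "1 \<le> M1" "\<And>x. x \<in> carrier G \<Longrightarrow> M'.len x \<le> M1 * len x + M'.len \<one>"
    using subadditive_le_len[of M'.len] M'.len_mult by blast
  obtain M2 where M2: "1 \<le> M2" "\<And>x. x \<in> carrier G \<Longrightarrow> len x \<le> M2 * M'.len x + len \<one>"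
    using M'.subadditive_le_len[of len] len_mult by blast
  define L where "L = (l + A) * (M1 + M2) * l"
  have A1: "A \<le> L" "l * M1 \<le> L" "M2 * l \<le> L" "M2 * l * A \<le> L" "1 \<le> L"
  proof -
    have "1 * 1 \<le> (M1 + M2) * l" using M1(1) M2(1) l(1) by (intro mult_mono) auto
    then have "(l + A) * 1 \<le> (l + A) * ((M1 + M2) * l)" using l by (intro mult_left_mono) auto
    then show "A \<le> L" "1 \<le> L" unfolding L_def mult.assoc mult_1_right using l(1,2) by linarith+
    have "l * M1 * 1 \<le> (l + A) * (M1 + M2) * l" using M1(1) M2(1) l by (intro mult_mono) auto
    then show "l * M1 \<le> L" by (simp add: L_def)
    have "1 * (M2 * l) \<le> (l + A) * ((M1 + M2) * l)" using M1(1) M2(1) l by (intro mult_mono) auto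
    then show "M2 * l \<le> L" by (simp add: L_def mult.assoc)
    have "A * (M2 * l) \<le> (l + A) * ((M1 + M2) * l)" using M1(1) M2(1) l by (intro mult_mono) auto
    then show "M2 * l * A \<le> L" by (simp add: L_def mult_ac)
  qed
  show ?thesis
  proof (rule that[OF A1(5)])
    fix x y assume xy: "x \<in> carrier G" "y \<in> carrier G"
    have "0 \<le> d x y" using d xy by (auto simp: metrics_D_def pseudometric_on_def)
    have "word_metric G S' x y \<le> l * d x y + l * A" using l(3)[OF xy] l(1) by (simp add: field_simps)
    then have "M2 * word_metric G S' x y \<le> M2 * (l * d x y + l * A)" using M2(1) by (intro mult_left_mono) auto
    moreover have "dist x y \<le> M2 * word_metric G S' x y" using M2(2)[of "inv x \<otimes> y"] xy by (simp add: word_metric_def)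
    moreover have "M2 * l * d x y \<le> L * d x y" using A1 \<open>0 \<le> d x y\<close> by (intro mult_right_mono) auto
    ultimately show "dist x y \<le> L * d x y + L" using A1(4) by (simp add: algebra_simps)
    have "l * word_metric G S' x y \<le> l * (M1 * dist x y)"
      using M1(2)[of "inv x \<otimes> y"] xy l(1) by (intro mult_left_mono) (auto simp: word_metric_def)
    moreover have "l * M1 * dist x y \<le> L * dist x y" using A1 nonneg[OF xy] by (intro mult_right_mono) auto
    ultimately show "d x y \<le> L * dist x y + L" using l(3)[OF xy] A1(1) by (simp add: mult.assoc)
  qed
qed

text \<open>
  A word of almost minimal weight traces a quasi-geodesic of every metric in \<^term>\<open>metrics_D G\<close>,
  hence passes near each point at which the Gromov product of its ends is small; there the
  weighted metric is almost additive.
\<close>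

lemma wmetric_in_H:
  assumes W: "admissible W"
  shows "wmetric W \<in> potentials_H G"
proof -
  have inv: "left_invariant G (wmetric W)"
    by (simp add: left_invariant_def wmetric_def inv_solve)
  have "\<exists>c>0. \<forall>x\<in>carrier G. \<forall>y\<in>carrier G. \<forall>w\<in>carrier G.
        \<bar>gromov_product (wmetric W) x y w\<bar> \<le> c * gromov_product d x y w + c" if d: "d \<in> metrics_D G" for d
  proof -
    obtain L where L: "1 \<le> L" "\<And>x y. \<lbrakk>x \<in> carrier G; y \<in> carrier G\<rbrakk> \<Longrightarrow> dist x y \<le> L * d x y + L"
      "\<And>x y. \<lbrakk>x \<in> carrier G; y \<in> carrier G\<rbrakk> \<Longrightarrow> d x y \<le> L * dist x y + L"
      using word_metric_quasi_isometric[OF d] by blast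
    obtain \<delta>' where "0 \<le> \<delta>'" "\<forall>x\<in>carrier G. \<forall>y\<in>carrier G. \<forall>z\<in>carrier G. \<forall>w\<in>carrier G.
        gromov_product d x z w \<ge> min (gromov_product d x y w) (gromov_product d y z w) - \<delta>'"
      using d by (auto simp: metrics_D_def hyperbolic_on_def)
    then interpret D: hyperbolic_pseudometric "carrier G" d \<delta>'
      using d by unfold_locales (auto simp: metrics_D_def pseudometric_on_def)
    have finW: "finite W" using W by (simp add: admissible_def)
    define R where "R = (\<Sum>a\<in>W. len (fst a))"
    have R: "len (fst a) \<le> R" if "a \<in> W" for a
      unfolding R_def using member_le_sum[of a W "\<lambda>a. len (fst a)"] finW that by simp
    have R0: "0 \<le> R" by (simp add: R_def sum_nonneg)
    have "0 \<le> L * R + L" "0 < 2 * L" using L(1) R0 by auto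
    then obtain C where C: "\<And>n (p :: nat \<Rightarrow> 'a) w.
      \<lbrakk>\<And>i. i \<le> n \<Longrightarrow> p i \<in> carrier G; \<And>i. i < n \<Longrightarrow> d (p i) (p (Suc i)) \<le> L * R + L;
       \<And>i j. \<lbrakk>i \<le> j; j \<le> n\<rbrakk> \<Longrightarrow> real (j - i) \<le> (2 * L) * d (p i) (p j) + 2 * L; w \<in> carrier G\<rbrakk>
      \<Longrightarrow> \<exists>i\<le>n. d w (p i) \<le> 2 * D.gp (p 0) (p n) w + C"
      using D.quasi_geodesic_near[of "L * R + L" "2 * L"] by blast
    have main: "gromov_product (wmetric W) x y w \<le> (2 * L) * D.gp x y w + (L * \<bar>C\<bar> + L + 1)"
      if xyw: "x \<in> carrier G" "y \<in> carrier G" "w \<in> carrier G" for x y w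
    proof -
      obtain ws where ws: "set ws \<subseteq> W" "word_prod (map fst ws) = inv x \<otimes> y"
        "sum_list (map snd ws) \<le> wmetric W x y + 1"
        using wlen_near_optimal[OF W, of "inv x \<otimes> y"] xyw unfolding wmetric_def by blast
      let ?c = "\<lambda>us. sum_list (map snd us)" and ?v = "\<lambda>us. word_prod (map fst us)"
      define p where "p = (\<lambda>i. x \<otimes> ?v (take i ws))"
      have sub: "set (take i ws) \<subseteq> W" "set (drop i ws) \<subseteq> W" for i
        using ws(1) set_take_subset[of i ws] set_drop_subset[of i ws] by auto
      have sub2: "set (drop i (take j ws)) \<subseteq> W" for i j
        using sub(1)[of j] set_drop_subset[of i "take j ws"] by auto
      have vc: "?v us \<in> carrier G" if "set us \<subseteq> W" for us
        using weighted_letters(1)[OF W that] by simp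
      have pc: "p i \<in> carrier G" for i unfolding p_def using vc[OF sub(1)] xyw by simp
      have app: "?v (us @ vs) = ?v us \<otimes> ?v vs" if "set us \<subseteq> W" "set vs \<subseteq> W" for us vs
        using word_prod_append[OF weighted_letters(1)[OF W that(1)] weighted_letters(1)[OF W that(2)]]
        by (simp only: map_append)
      have seg: "p j = p i \<otimes> ?v (drop i (take j ws))" if "i \<le> j" for i j
      proof -
        have "take j ws = take i ws @ drop i (take j ws)"
          using that by (metis append_take_drop_id min.absorb1 take_take)
        then have "?v (take j ws) = ?v (take i ws) \<otimes> ?v (drop i (take j ws))"
          using app[OF sub(1) sub2, of i i j] by simp
        then show ?thesis unfolding p_def using vc[OF sub(1)] vc[OF sub2] xyw by (simp add: m_assoc)
      qed
      have tail: "y = p i \<otimes> ?v (drop i ws)" for i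
      proof -
        have "?v ws = ?v (take i ws) \<otimes> ?v (drop i ws)" using app[OF sub, of i i] by simp
        then show ?thesis unfolding p_def using ws(2) vc[OF sub(1)] vc[OF sub(2)] xyw
          by (metis m_assoc mult_inv_cancel(1))
      qed
      have p0: "p 0 = x" using xyw by (simp add: p_def)
      have pn: "p (length ws) = y" using ws(2) xyw by (simp add: p_def mult_inv_cancel)
      have inv_p: "inv (p i) \<otimes> p j = ?v (drop i (take j ws))" if "i \<le> j" for i j
        unfolding seg[OF that] using pc[of i] vc[OF sub2] by (simp add: mult_inv_cancel)
      have inv_tail: "inv (p i) \<otimes> y = ?v (drop i ws)" for i
        using tail[of i] pc[of i] vc[OF sub(2), of i] by (metis mult_inv_cancel(2))
      have inv_head: "inv x \<otimes> p i = ?v (take i ws)" for i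
        unfolding p_def using vc[OF sub(1)] xyw by (simp add: mult_inv_cancel)
      have tri: "wmetric W a c \<le> wmetric W a b + wmetric W b c"
        if "a \<in> carrier G" "b \<in> carrier G" "c \<in> carrier G" for a b c
        using wlen_mult[OF W, of "inv a \<otimes> b" "inv b \<otimes> c"] inv_trans[OF that] that by (simp add: wmetric_def)
      have head_le: "wmetric W x (p i) \<le> ?c (take i ws)" for i
        unfolding wmetric_def inv_head by (intro wlen_le[OF W] sub HOL.refl)
      have tail_le: "wmetric W (p i) y \<le> ?c (drop i ws)" for i
        unfolding wmetric_def inv_tail by (intro wlen_le[OF W] sub HOL.refl)
      have split: "?c ws = ?c (take i ws) + ?c (drop i ws)" for i
        by (metis append_take_drop_id map_append sum_list.append)
      have "\<exists>i\<le>length ws. d w (p i) \<le> 2 * D.gp (p 0) (p (length ws)) w + C"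
      proof (rule C)
        fix i assume "i < length ws"
        then have "drop i (take (Suc i) ws) = [ws ! i]" by (simp add: take_Suc_conv_app_nth)
        moreover have "fst (ws ! i) \<in> carrier G"
          using weighted_letters(1)[OF W ws(1)] nth_mem[OF \<open>i < length ws\<close>] by auto
        ultimately have "inv (p i) \<otimes> p (Suc i) = fst (ws ! i)" using inv_p[of i "Suc i"] by simp
        then have "dist (p i) (p (Suc i)) \<le> R"
          using R[of "ws ! i"] ws(1) \<open>i < length ws\<close> nth_mem by (auto simp: word_metric_def)
        then have "L * dist (p i) (p (Suc i)) \<le> L * R" using L(1) by simp
        then show "d (p i) (p (Suc i)) \<le> L * R + L" using L(3)[OF pc pc, of i "Suc i"] by simp
      next
        fix i j assume ij: "i \<le> j" "j \<le> length ws"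
        let ?s = "drop i (take j ws)"
        have "ws = take i ws @ ?s @ drop j ws"
          using ij by (metis append.assoc append_take_drop_id min.absorb1 take_take)
        then have tot: "?c ws = ?c (take i ws) + ?c ?s + ?c (drop j ws)"
          by (metis add.assoc map_append sum_list.append)
        have "wmetric W x y \<le> wmetric W x (p i) + wmetric W (p i) (p j) + wmetric W (p j) y"
          using tri[of x "p i" y] tri[of "p i" "p j" y] xyw pc by force
        then have "?c ?s \<le> wmetric W (p i) (p j) + 1"
          using tot head_le[of i] tail_le[of j] ws(3) by linarith
        moreover have "real (j - i) \<le> ?c ?s"
          using weighted_letters(2)[OF W sub2, of i j] ij by simp
        moreover have "wmetric W (p i) (p j) \<le> dist (p i) (p j)"
          using wlen_le_len[OF W, of "inv (p i) \<otimes> p j"] pc by (simp add: wmetric_def word_metric_def)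
        moreover have "0 \<le> L * d (p i) (p j)" using L(1) D.nonneg[OF pc pc] by simp
        ultimately show "real (j - i) \<le> (2 * L) * d (p i) (p j) + 2 * L"
          using L(1) L(2)[OF pc pc, of i j] unfolding mult.assoc by linarith
      qed (use pc xyw in auto)
      then obtain i where i: "d w (p i) \<le> 2 * D.gp x y w + C" using p0 pn by auto
      have le: "wmetric W w (p i) \<le> dist w (p i)" "wmetric W (p i) w \<le> dist w (p i)"
        using wlen_le_len[OF W, of "inv (p i) \<otimes> w"] wlen_le_len[OF W, of "inv w \<otimes> p i"] pc[of i] xyw
          sym[of w "p i"] by (auto simp: wmetric_def word_metric_def)
      have "wmetric W x w + wmetric W w y \<le> wmetric W x y + 1 + 2 * dist w (p i)"
        using tri[of x "p i" w] tri[of w "p i" y] xyw pc[of i] head_le[of i] tail_le[of i] split[of i] ws(3) le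
        by force
      then have "gromov_product (wmetric W) x y w \<le> dist w (p i) + 1"
        by (simp add: gromov_product_def)
      moreover have "L * d w (p i) \<le> L * (2 * D.gp x y w + \<bar>C\<bar>)" using i L(1) by (intro mult_left_mono) auto
      moreover have "dist w (p i) \<le> L * d w (p i) + L" using L(2) xyw pc by blast
      ultimately show ?thesis by (simp add: algebra_simps)
    qed
    have pos: "0 \<le> gromov_product (wmetric W) x y w" if "x \<in> carrier G" "y \<in> carrier G" "w \<in> carrier G" for x y w
      using wlen_mult[OF W, of "inv x \<otimes> w" "inv w \<otimes> y"] inv_trans[of x w y] that
      by (simp add: wmetric_def gromov_product_def)
    define c where "c = 2 * L + L * \<bar>C\<bar> + L + 1"
    have "\<bar>gromov_product (wmetric W) x y w\<bar> \<le> c * D.gp x y w + c"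
      if "x \<in> carrier G" "y \<in> carrier G" "w \<in> carrier G" for x y w
    proof -
      have "(2 * L) * D.gp x y w \<le> c * D.gp x y w"
        using L(1) D.gp_nonneg that by (intro mult_right_mono) (auto simp: c_def)
      then show ?thesis using main[OF that] pos[OF that] L(1) by (simp add: c_def)
    qed
    moreover have "0 < c" using L(1) by (simp add: c_def add_pos_nonneg)
    ultimately show ?thesis by blast
  qed
  then show ?thesis using inv by (simp add: potentials_H_def)
qed

lemma wmetric_in_Hpp:
  assumes W: "admissible W"
  shows "wmetric W \<in> potentials_Hpp G"
proof -
  have "finite {g \<in> carrier G. wmetric W \<one> g \<le> T}" for T
  proof (rule finite_subset[OF _ finite_ball[of "2 * T"]])
    show "{g \<in> carrier G. wmetric W \<one> g \<le> T} \<subseteq> {x \<in> carrier G. len x \<le> 2 * T}"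
      using len_le_wlen[OF W] by (force simp: wmetric_one)
  qed
  moreover have "0 \<le> wmetric W x y" if "x \<in> carrier G" "y \<in> carrier G" for x y
    using wlen_nonneg[OF W] that by (simp add: wmetric_def)
  ultimately show ?thesis using wmetric_in_H[OF W] unfolding potentials_Hpp_def by blast
qed

end

section \<open>Infinite cyclic subgroups\<close>

locale torsion_free_hyperbolic_group = hyperbolic_marked_group G S \<delta>
  for G (structure) and S :: "'a set" and \<delta> +
  assumes torsion_free: "torsion_free G"
begin

lemma pow_eq_one:
  assumes "a \<in> carrier G" "a \<noteq> \<one>" "a [^] (n::nat) = \<one>"
  shows "n = 0"
proof (rule ccontr)
  assume "n \<noteq> 0"
  then have "torsion_elem G a" using assms(3) by (auto simp: torsion_elem_def)
  then show False using assms(1,2) torsion_free by (simp add: torsion_free_def)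
qed

lemma pow_inj:
  assumes a: "a \<in> carrier G" "a \<noteq> \<one>" and eq: "a [^] (i::nat) = a [^] j"
  shows "i = j"
proof -
  have "i = j" if "a [^] i = a [^] j" "i \<le> j" for i j :: nat
  proof -
    have "a [^] i \<otimes> a [^] (j - i) = a [^] j" using that(2) a by (simp add: nat_pow_mult)
    also have "\<dots> = a [^] i \<otimes> \<one>" using that(1) a by simp
    finally have "a [^] i \<otimes> a [^] (j - i) = a [^] i \<otimes> \<one>" .
    then have "a [^] (j - i) = \<one>" using a by (simp del: nat_pow_Suc)
    then show ?thesis using pow_eq_one[OF a] that(2) by fastforce
  qed
  then show ?thesis using eq by (metis nat_le_linear)
qed

lemma dist_pow:
  assumes "a \<in> carrier G" "x \<in> carrier G" "i \<le> j"
  shows "dist (x \<otimes> a [^] (i::nat)) (x \<otimes> a [^] j) = len (a [^] (j - i))"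
proof -
  have "a [^] j = a [^] i \<otimes> a [^] (j - i)" using assms by (simp add: nat_pow_mult)
  then show ?thesis using assms dist_mult_self(1)[of "a [^] i" "a [^] (j - i)"] by simp
qed

lemma dist_pow1:
  assumes "a \<in> carrier G" "i \<le> j"
  shows "dist (a [^] (i::nat)) (a [^] j) = len (a [^] (j - i))"
  using dist_pow[of a \<one> i j] assms by simp

lemma dist_on_geodesic:
  assumes "p \<in> carrier G" "q \<in> carrier G" "m \<in> carrier G" "z \<in> carrier G"
    and "gp p q m = 0"
  shows "dist m z \<le> dist p z - dist p m + 2 * \<delta> \<or> dist m z \<le> dist q z - dist q m + 2 * \<delta>"
proof -
  have "gp p z m \<le> 0 + \<delta> \<or> gp z q m \<le> 0 + \<delta>" using assms by (intro hyperbolic_cases) auto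
  then show ?thesis using sym[OF assms(3,4)] sym[of q z] sym[of q m] assms unfolding gromov_product_def by argo
qed

text \<open>
  Hyperbolic groups have no parabolic elements. If all doublings \<open>a\<^sup>n \<mapsto> a\<^sup>2\<^sup>n\<close> increased the length only
  by a constant, then the orbit \<open>{a\<^sup>j. j \<le> 2N}\<close> would have nearly the same diameter \<open>D\<close> as its first
  half, hence nearly the same centre \<open>m\<close> as all translates of this half. So the powers \<open>a\<^sup>j\<close>, \<open>j \<le> N\<close>,
  would move \<open>m\<close> by a bounded amount, and for large \<open>N\<close> two of them would coincide.
\<close>

lemma no_parabolic:
  assumes a: "a \<in> carrier G" "a \<noteq> \<one>"
  shows "\<exists>n::nat. len (a [^] n) + 3 * \<delta> + 1 \<le> len (a [^] (2 * n))"
proof (rule ccontr)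
  assume "\<not> ?thesis"
  then have dbl: "len (a [^] (2 * n)) \<le> len (a [^] n) + 3 * \<delta> + 1" for n :: nat
    by (meson linorder_le_cases)
  define C1 where "C1 = 3 * \<delta> + 1 + len a"
  define C where "C = C1 + 1 + 4 * \<delta>"
  define N where "N = card {x \<in> carrier G. len x \<le> C}"
  let ?lens = "(\<lambda>i. word_length G S (a [^] i)) ` {..N}"
  have "Max ?lens \<in> ?lens" by (intro Max_in) auto
  then obtain i0 where "i0 \<le> N" "Max ?lens = word_length G S (a [^] i0)" by blast
  then have i0: "i0 \<le> N" "\<And>i. i \<le> N \<Longrightarrow> word_length G S (a [^] i) \<le> word_length G S (a [^] i0)"
    using Max_ge[of ?lens] by (simp, metis atMost_iff finite_atMost finite_imageI image_eqI)
  define D where "D = len (a [^] i0)"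
  have D: "len (a [^] i) \<le> D" if "i \<le> N" for i using i0(2)[OF that] by (simp add: D_def)
  have D2: "len (a [^] j) \<le> D + C1" if "j \<le> 2 * N" for j
  proof -
    have "a [^] j = a [^] (2 * (j div 2)) \<otimes> a [^] (j mod 2)"
      using a by (simp add: nat_pow_mult)
    then have "len (a [^] j) \<le> len (a [^] (2 * (j div 2))) + len (a [^] (j mod 2))"
      using len_mult a by simp
    moreover have "len (a [^] (j mod 2)) \<le> len a"
      using a by (cases "j mod 2 = 0") (auto simp: not_mod_2_eq_0_eq_1)
    moreover have "len (a [^] (j div 2)) \<le> D" using that by (intro D) auto
    ultimately show ?thesis using dbl[of "j div 2"] by (simp add: C1_def)
  qed
  have pc: "a [^] (i::nat) \<in> carrier G" for i using a by simp
  have "word_length G S (a [^] i0) div 2 \<le> word_length G S (a [^] i0)" by simp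
  then obtain m z where mz: "m \<in> carrier G" "z \<in> carrier G" "a [^] i0 = m \<otimes> z"
    "len m = real (word_length G S (a [^] i0) div 2)" "len z = D - len m"
    using geodesic_split[OF pc] unfolding D_def by metis
  have half: "D / 2 - 1 / 2 \<le> len m" "D / 2 \<le> len z" unfolding mz(5) mz(4) D_def by linarith+
  have dm: "dist \<one> m = len m" "dist (a [^] i0) m = len z"
    using mz dist_mult_self(2)[OF mz(1,2)] by (simp_all add: dist_one)
  have geo: "gp \<one> (a [^] i0) m = 0"
    using dm mz sym[of m "a [^] i0"] pc by (simp add: gromov_product_def dist_one D_def)
  have near: "dist m (a [^] j) \<le> D / 2 + C1 + 1 / 2 + 2 * \<delta>" if j: "j \<le> 2 * N" for j
  proof -
    have "dist \<one> (a [^] j) \<le> D + C1" using D2[OF j] pc by (simp add: dist_one)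
    moreover have "dist (a [^] i0) (a [^] j) \<le> D + C1"
    proof (cases "i0 \<le> j")
      case True
      then show ?thesis using dist_pow1[of a i0 j] a D2[of "j - i0"] j by simp
    next
      case False
      then show ?thesis using dist_pow1[of a j i0] a D2[of "i0 - j"] i0 sym[OF pc pc, of i0 j] by simp
    qed
    ultimately show ?thesis
      using dist_on_geodesic[OF one_closed pc mz(1) pc geo, of j] half dm by argo
  qed
  have move: "len (inv m \<otimes> a [^] j \<otimes> m) \<le> C" if j: "j \<le> N" for j
  proof -
    have e: "a [^] (j + i0) = a [^] j \<otimes> a [^] i0" using a by (simp add: nat_pow_mult)
    have s: "dist (a [^] j \<otimes> \<one>) (a [^] j \<otimes> m) = len m"
      "dist (a [^] j \<otimes> a [^] i0) (a [^] j \<otimes> m) = len z"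
      using dm dist_mult[OF pc one_closed mz(1)] dist_mult[OF pc pc mz(1)] by simp_all
    have "gp (a [^] j \<otimes> \<one>) (a [^] j \<otimes> a [^] i0) (a [^] j \<otimes> m) = 0"
      using geo gp_mult[OF pc one_closed pc mz(1)] by simp
    then have "dist (a [^] j \<otimes> m) m \<le> dist (a [^] j \<otimes> \<one>) m - dist (a [^] j \<otimes> \<one>) (a [^] j \<otimes> m) + 2 * \<delta> \<or>
      dist (a [^] j \<otimes> m) m \<le> dist (a [^] j \<otimes> a [^] i0) m - dist (a [^] j \<otimes> a [^] i0) (a [^] j \<otimes> m) + 2 * \<delta>"
      using pc mz by (intro dist_on_geodesic) auto
    then have "dist (a [^] j \<otimes> m) m \<le> dist (a [^] j) m - len m + 2 * \<delta> \<or>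
      dist (a [^] j \<otimes> m) m \<le> dist (a [^] (j + i0)) m - len z + 2 * \<delta>"
      unfolding s by (simp only: e r_one[OF pc])
    moreover have "dist (a [^] j) m \<le> D / 2 + C1 + 1 / 2 + 2 * \<delta>"
      "dist (a [^] (j + i0)) m \<le> D / 2 + C1 + 1 / 2 + 2 * \<delta>"
      using near[of j] near[of "j + i0"] j i0 sym[OF mz(1) pc] by auto
    ultimately have "dist (a [^] j \<otimes> m) m \<le> C" using half delta0 by (simp add: C_def) argo
    then show ?thesis using sym[of "a [^] j \<otimes> m" m] mz pc by (simp add: word_metric_def m_assoc)
  qed
  have "inj_on (\<lambda>j. inv m \<otimes> a [^] j \<otimes> m) {..N}"
  proof (rule inj_onI)
    fix i j :: nat assume "inv m \<otimes> a [^] i \<otimes> m = inv m \<otimes> a [^] j \<otimes> m"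
    then have "inv m \<otimes> a [^] i = inv m \<otimes> a [^] j" using mz(1) pc by (subst (asm) right_cancel) auto
    then have "m \<otimes> (inv m \<otimes> a [^] i) = m \<otimes> (inv m \<otimes> a [^] j)" by (rule arg_cong)
    then have "a [^] i = a [^] j" using mult_inv_cancel(1)[OF mz(1) pc] by simp
    then show "i = j" by (rule pow_inj[OF a])
  qed
  moreover have "(\<lambda>j. inv m \<otimes> a [^] j \<otimes> m) ` {..N} \<subseteq> {x \<in> carrier G. len x \<le> C}"
    using move mz pc by auto
  ultimately have "card {..N} \<le> card {x \<in> carrier G. len x \<le> C}"
    using card_inj_on_le finite_ball by blast
  then show False by (simp add: N_def)
qed

text \<open>
  A power \<open>h\<close> of \<open>a\<close> whose length grows under doubling has backtracking \<open>(h\<inverse>|h)\<^sub>1\<close> small compared with \<open>|h|\<close>,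
  so its powers form a chain without accumulated backtracking; the remaining powers of \<open>a\<close> are at
  bounded distance from it.
\<close>

lemma powers_quasi_geodesic:
  assumes a: "a \<in> carrier G" "a \<noteq> \<one>"
  obtains c L where "0 \<le> c" "0 < L" "\<And>(m::nat) (l::nat). gp (inv (a [^] m)) (a [^] l) \<one> \<le> c"
    "\<And>m :: nat. real m \<le> L * len (a [^] m) + L"
proof -
  obtain n :: nat where n: "len (a [^] n) + 3 * \<delta> + 1 \<le> len (a [^] (2 * n))"
    using no_parabolic[OF a] by blast
  have pc: "a [^] (i::nat) \<in> carrier G" for i using a by simp
  have n0: "0 < n" using n delta0 by (cases n) auto
  define h where "h = a [^] n"
  have hc: "h \<in> carrier G" unfolding h_def by (rule pc)
  have hp: "h [^] (q::nat) = a [^] (n * q)" for q unfolding h_def using a by (simp add: nat_pow_pow)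
  define c where "c = len h - len (h [^] (2::nat)) / 2"
  have h2: "h [^] (2::nat) = h \<otimes> h" using hc by (simp add: numeral_2_eq_2)
  have c0: "0 \<le> c" using len_mult[OF hc hc] h2 by (simp add: c_def)
  have long: "2 * c + 3 * \<delta> + 1 \<le> len h"
    using n by (simp add: c_def hp mult.commute) (simp add: h_def)
  have chain: "gp (h [^] i) (h [^] (i + j + k)) (h [^] (i + j)) \<le> c + 2 * \<delta>"
    "real q \<le> dist (h [^] i) (h [^] (i + q))" for i j k q :: nat
  proof -
    have "gp (h [^] i) (h [^] (i + 2)) (h [^] (i + 1)) \<le> c" for i :: nat
      using dist_pow1[OF hc, of i "i+1"] dist_pow1[OF hc, of "i+1" "i+2"] dist_pow1[OF hc, of i "i+2"] hc
      by (simp add: gromov_product_def c_def)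
    moreover have "2 * c + 3 * \<delta> + 1 \<le> dist (h [^] i) (h [^] (i + 1))" for i :: nat
      using dist_pow1[OF hc, of i "i+1"] hc long by simp
    ultimately show "gp (h [^] i) (h [^] (i + j + k)) (h [^] (i + j)) \<le> c + 2 * \<delta>"
      "real q \<le> dist (h [^] i) (h [^] (i + q))"
      using local_to_global[of "\<lambda>i::nat. h [^] i" c] hc c0 by auto
  qed
  have hgp: "gp (inv (h [^] q)) (h [^] k) \<one> \<le> c + 2 * \<delta>" for q k :: nat
  proof -
    have "gp \<one> (h [^] (q + k)) (h [^] q) = gp (inv (h [^] q)) (h [^] k) \<one>"
      using gp_at_one[of \<one> "h [^] (q + k)" "h [^] q"] hc
      by (simp add: nat_pow_mult[symmetric] mult_inv_cancel)
    then show ?thesis using chain(1)[of 0 q k] by simp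
  qed
  define R where "R = (\<Sum>r<n. len (a [^] r))"
  have R: "len (a [^] r) \<le> R" if "r < n" for r
    unfolding R_def using member_le_sum[of r "{..<n}" "\<lambda>r. len (a [^] r)"] that by simp
  have R0: "0 \<le> R" by (simp add: R_def sum_nonneg)
  have dec: "a [^] m = h [^] (m div n) \<otimes> a [^] (m mod n)" for m
    unfolding hp using a by (simp add: nat_pow_mult)
  have dist_h: "dist (a [^] m) (h [^] (m div n)) \<le> R" for m
    using dec[of m] dist_mult_self(2)[of "h [^] (m div n)" "a [^] (m mod n)"] hc pc R[of "m mod n"] n0 by simp
  have dec': "a [^] m = a [^] (m mod n) \<otimes> h [^] (m div n)" for m
    unfolding hp using a by (simp add: nat_pow_mult)
  have dist_h': "dist (inv (a [^] m)) (inv (h [^] (m div n))) \<le> R" for m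
    using arg_cong[OF dec'[of m], of "m_inv G"] 
      dist_mult_self(2)[of "inv (h [^] (m div n))" "inv (a [^] (m mod n))"] hc pc R[of "m mod n"] n0
    by (simp add: inv_mult_group)
  show ?thesis
  proof (rule that[of "c + 2 * \<delta> + 2 * R" "real n * (1 + R)"])
    show "0 \<le> c + 2 * \<delta> + 2 * R" using c0 delta0 R0 by simp
    show "0 < real n * (1 + R)" using n0 R0 by simp
    show "gp (inv (a [^] m)) (a [^] l) \<one> \<le> c + 2 * \<delta> + 2 * R" for m l :: nat
      using gp_change_left[of "inv (a [^] m)" "a [^] l" \<one> "inv (h [^] (m div n))"]
        gp_change_right[of "inv (h [^] (m div n))" "a [^] l" \<one> "h [^] (l div n)"]
        dist_h'[of m] dist_h[of l] hgp[of "m div n" "l div n"] hc pc by simp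
    show "real m \<le> real n * (1 + R) * len (a [^] m) + real n * (1 + R)" for m :: nat
    proof -
      have "real (m div n) \<le> len (h [^] (m div n))"
        using chain(2)[of "m div n" 0] hc by (simp add: dist_one)
      also have "\<dots> \<le> len (a [^] m) + R"
        using dist_h[of m] triangle[of \<one> "a [^] m" "h [^] (m div n)"] pc hc by (simp add: dist_one)
      finally have 1: "real (m div n) + 1 \<le> len (a [^] m) + R + 1" by simp
      have "m \<le> n * (m div n + 1)" using n0 by (metis add.commute dividend_less_times_div less_imp_le_nat mult.commute mult_Suc_right plus_1_eq_Suc)
      then have "real m \<le> real n * (real (m div n) + 1)" by (metis of_nat_1 of_nat_add of_nat_le_iff of_nat_mult)
      also have "\<dots> \<le> real n * (len (a [^] m) + R + 1)" using 1 by (intro mult_left_mono) auto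
      also have "\<dots> \<le> real n * (1 + R) * len (a [^] m) + real n * (1 + R)"
        using R0 by (simp add: algebra_simps)
      finally show ?thesis .
    qed
  qed
qed

lemma powers_between:
  assumes a: "a \<in> carrier G" and c: "\<And>(m::nat) (l::nat). gp (inv (a [^] m)) (a [^] l) \<one> \<le> c"
    and "x \<in> carrier G" "i \<le> n"
  shows "gp x (x \<otimes> a [^] (n::nat)) (x \<otimes> a [^] i) \<le> c"
proof -
  have e: "a [^] n = a [^] i \<otimes> a [^] (n - i)" using assms by (simp add: nat_pow_mult)
  have "gp x (x \<otimes> a [^] n) (x \<otimes> a [^] i) = gp (inv (a [^] i)) (a [^] (n - i)) \<one>"
    using assms gp_mult[of x \<one> "a [^] n" "a [^] i"] gp_at_one[of \<one> "a [^] n" "a [^] i"]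
    by (simp add: e mult_inv_cancel)
  then show ?thesis using c by simp
qed

lemma near_axis:
  assumes b: "b \<in> carrier G" "b \<noteq> \<one>"
  obtains R where "\<And>y (n::nat) w. \<lbrakk>y \<in> carrier G; w \<in> carrier G; gp y (y \<otimes> b [^] n) w \<le> c\<rbrakk>
    \<Longrightarrow> \<exists>l::nat. dist (y \<otimes> b [^] l) w \<le> R"
proof -
  obtain c0 L where L: "0 < L" "\<And>m :: nat. real m \<le> L * len (b [^] m) + L"
    using powers_quasi_geodesic[OF b] by metis
  have "0 \<le> len b" by simp
  then obtain C where C: "\<And>n (p :: nat \<Rightarrow> 'a) w.
    \<lbrakk>\<And>i. i \<le> n \<Longrightarrow> p i \<in> carrier G; \<And>i. i < n \<Longrightarrow> dist (p i) (p (Suc i)) \<le> len b;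
     \<And>i j. \<lbrakk>i \<le> j; j \<le> n\<rbrakk> \<Longrightarrow> real (j - i) \<le> L * dist (p i) (p j) + L; w \<in> carrier G\<rbrakk>
    \<Longrightarrow> \<exists>i\<le>n. dist w (p i) \<le> 2 * gp (p 0) (p n) w + C"
    using quasi_geodesic_near[of "len b" L] L(1) by blast
  show ?thesis
  proof (rule that[of "2 * c + C"])
    fix y w and n :: nat assume yw: "y \<in> carrier G" "w \<in> carrier G" and gpw: "gp y (y \<otimes> b [^] n) w \<le> c"
    have "\<exists>i\<le>n. dist w (y \<otimes> b [^] i) \<le> 2 * gp (y \<otimes> b [^] (0::nat)) (y \<otimes> b [^] n) w + C"
    proof (rule C)
      show "dist (y \<otimes> b [^] i) (y \<otimes> b [^] Suc i) \<le> len b" for i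
        using dist_pow[of b y i "Suc i"] b yw by simp
      show "real (j - i) \<le> L * dist (y \<otimes> b [^] i) (y \<otimes> b [^] j) + L" if "i \<le> j" for i j
        using dist_pow[of b y i j] b yw that L(2)[of "j - i"] by simp
    qed (use b yw in auto)
    then obtain i :: nat where "dist w (y \<otimes> b [^] i) \<le> 2 * gp y (y \<otimes> b [^] n) w + C" using yw by auto
    then have "dist (y \<otimes> b [^] i) w \<le> 2 * c + C"
      using gpw sym[of w "y \<otimes> b [^] i"] b yw by simp
    then show "\<exists>l::nat. dist (y \<otimes> b [^] l) w \<le> 2 * c + C" by blast
  qed
qed

lemma conj_pow:
  assumes "x \<in> carrier G" "a \<in> carrier G"
  shows "(x \<otimes> a \<otimes> inv x) [^] (n::int) = x \<otimes> a [^] n \<otimes> inv x"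
proof -
  have nat: "(x \<otimes> a \<otimes> inv x) [^] (k::nat) = x \<otimes> a [^] k \<otimes> inv x" for k
  proof (induction k)
    case (Suc k)
    then show ?case using assms by (simp add: m_assoc mult_inv_cancel)
  qed (use assms in simp)
  have invs: "inv (x \<otimes> a [^] k \<otimes> inv x) = x \<otimes> inv (a [^] k) \<otimes> inv x" for k :: nat
    using assms by (simp add: inv_mult_group m_assoc)
  show ?thesis unfolding int_pow_def2 nat invs by simp
qed

text \<open>
  Pigeonhole on a coarse intersection of two axes: if the powers \<open>x a\<^sup>i\<close> stay near the axis of \<open>b\<close>
  through \<open>y\<close> for long enough, then two of them have the same offset from it, and a power of
  \<open>x a x\<inverse>\<close> is a power of \<open>y b y\<inverse>\<close>.
\<close>

lemma long_coincidence:
  assumes a: "a \<in> carrier G" and b: "b \<in> carrier G" "b \<noteq> \<one>"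
  obtains I :: nat where "\<And>x y (n::nat). \<lbrakk>x \<in> carrier G; y \<in> carrier G;
      \<And>i::nat. i \<le> I \<Longrightarrow> gp y (y \<otimes> b [^] n) (x \<otimes> a [^] i) \<le> c\<rbrakk>
    \<Longrightarrow> \<exists>(m::int) (n::int). 0 < m \<and> x \<otimes> a [^] m \<otimes> inv x = y \<otimes> b [^] n \<otimes> inv y"
proof -
  obtain R where R: "\<And>y (n::nat) w. \<lbrakk>y \<in> carrier G; w \<in> carrier G; gp y (y \<otimes> b [^] n) w \<le> c\<rbrakk>
    \<Longrightarrow> \<exists>l::nat. dist (y \<otimes> b [^] l) w \<le> R" using near_axis[OF b, of c] by blast
  define B where "B = {x \<in> carrier G. len x \<le> R}"
  show ?thesis
  proof (rule that[of "card B"])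
    fix x y and n :: nat assume xy: "x \<in> carrier G" "y \<in> carrier G"
      and near: "\<And>i::nat. i \<le> card B \<Longrightarrow> gp y (y \<otimes> b [^] n) (x \<otimes> a [^] i) \<le> c"
    have "\<exists>l::nat. dist (y \<otimes> b [^] l) (x \<otimes> a [^] i) \<le> R" if "i \<le> card B" for i
      using R near[OF that] xy a by simp
    then obtain l :: "nat \<Rightarrow> nat" where l: "\<And>i. i \<le> card B \<Longrightarrow> dist (y \<otimes> b [^] l i) (x \<otimes> a [^] i) \<le> R"
      by metis
    define r where "r i = inv (y \<otimes> b [^] l i) \<otimes> (x \<otimes> a [^] i)" for i
    have rB: "r i \<in> B" if "i \<le> card B" for i
      using l[OF that] xy a b by (simp add: r_def B_def word_metric_def)
    have "\<not> inj_on r {..card B}"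
    proof
      assume "inj_on r {..card B}"
      then have "card {..card B} \<le> card B"
        using rB finite_ball[of R] by (intro card_inj_on_le[of r]) (auto simp: B_def)
      then show False by simp
    qed
    then obtain i j where ij: "i \<le> card B" "j \<le> card B" "i < j" "r i = r j"
      unfolding inj_on_def by (metis atMost_iff linorder_neqE_nat)
    have rc: "r k \<in> carrier G" for k unfolding r_def using xy a b by simp
    have xr: "x \<otimes> a [^] k = y \<otimes> b [^] l k \<otimes> r k" for k
      unfolding r_def using xy a b by (simp add: mult_inv_cancel)
    have "x \<otimes> a [^] (int j - int i) \<otimes> inv x = x \<otimes> a [^] j \<otimes> inv (x \<otimes> a [^] i)"
      using xy a by (simp add: int_pow_diff int_pow_int inv_mult_group m_assoc)
    also have "\<dots> = y \<otimes> b [^] l j \<otimes> r i \<otimes> inv (y \<otimes> b [^] l i \<otimes> r i)"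
      using xr[of i] xr[of j] ij(4) by simp
    also have "\<dots> = y \<otimes> b [^] (int (l j) - int (l i)) \<otimes> inv y"
      using xy b rc[of i] by (simp add: int_pow_diff int_pow_int inv_mult_group m_assoc mult_inv_cancel)
    finally show "\<exists>(m::int) (n::int). 0 < m \<and> x \<otimes> a [^] m \<otimes> inv x = y \<otimes> b [^] n \<otimes> inv y"
      using ij(3) by (intro exI[of _ "int j - int i"] exI[of _ "int (l j) - int (l i)"]) simp
  qed
qed

text \<open>
  If the product were large, then a long initial part of the axis of \<open>a\<close> would run along the
  geodesic from \<open>x\<close> to \<open>x b\<^sup>k\<close>, against \<open>long_coincidence\<close>. Only rays are considered; the other
  directions are covered by replacing \<open>a\<close> or \<open>b\<close> by its inverse.
\<close>

lemma independent_directions: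
  assumes a: "a \<in> carrier G" "a \<noteq> \<one>" and b: "b \<in> carrier G" "b \<noteq> \<one>" and x: "x \<in> carrier G"
    and indep: "\<And>(m::int) (n::int). 0 < m \<Longrightarrow> a [^] m \<noteq> x \<otimes> b [^] n \<otimes> inv x"
  obtains C where "\<And>(j::nat) (k::nat). gp (a [^] j) (x \<otimes> b [^] k) \<one> \<le> C"
proof -
  obtain c0 where c0: "0 \<le> c0" "\<And>(m::nat) (l::nat). gp (inv (a [^] m)) (a [^] l) \<one> \<le> c0"
    using powers_quasi_geodesic[OF a] by metis
  obtain I :: nat where I: "\<And>u y (n::nat). \<lbrakk>u \<in> carrier G; y \<in> carrier G;
      \<And>i::nat. i \<le> I \<Longrightarrow> gp y (y \<otimes> b [^] n) (u \<otimes> a [^] i) \<le> c0 + \<delta> + len x\<rbrakk>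
    \<Longrightarrow> \<exists>(m::int) (n::int). 0 < m \<and> u \<otimes> a [^] m \<otimes> inv u = y \<otimes> b [^] n \<otimes> inv y"
    using long_coincidence[OF a(1) b, of "c0 + \<delta> + len x"] by blast
  define M where "M = c0 + \<delta> + (\<Sum>i\<le>I. len (a [^] i))"
  have M: "len (a [^] i) + c0 + \<delta> \<le> M" if "i \<le> I" for i
    unfolding M_def using member_le_sum[of i "{..I}" "\<lambda>i. len (a [^] i)"] that by simp
  have pc: "a [^] (i::nat) \<in> carrier G" "x \<otimes> b [^] (i::nat) \<in> carrier G" for i using a b x by simp_all
  show ?thesis
  proof (rule that[of M], rule ccontr)
    fix j k :: nat assume "\<not> gp (a [^] j) (x \<otimes> b [^] k) \<one> \<le> M"
    then have big: "M < gp (a [^] j) (x \<otimes> b [^] k) \<one>" by simp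
    have j: "I < j"
    proof (rule ccontr)
      assume "\<not> I < j"
      then have "len (a [^] j) + c0 + \<delta> \<le> M" by (intro M) simp
      then show False using big gp_le_dist(1)[OF pc(1)[of j] pc(2)[of k] one_closed] c0 delta0 pc
        by (simp add: dist_one)
    qed
    have "gp x (x \<otimes> b [^] k) (\<one> \<otimes> a [^] i) \<le> c0 + \<delta> + len x" if i: "i \<le> I" for i
    proof -
      let ?w = "a [^] i"
      have "gp \<one> (a [^] j) ?w \<le> c0" using powers_between[OF a(1) c0(2), of \<one> i j] i j pc by simp
      then have "gp \<one> (x \<otimes> b [^] k) ?w \<le> c0 + \<delta> \<or> gp (x \<otimes> b [^] k) (a [^] j) ?w \<le> c0 + \<delta>"
        using pc by (intro hyperbolic_cases) auto
      moreover have "gp (x \<otimes> b [^] k) (a [^] j) ?w > c0 + \<delta>"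
        using gp_change_base[OF pc(1)[of j] pc(2)[of k] one_closed pc(1)[of i]] big M[OF i]
          gp_commute[OF pc(1)[of j] pc(2)[of k] pc(1)[of i]] pc by (simp add: dist_one)
      ultimately have "gp \<one> (x \<otimes> b [^] k) ?w \<le> c0 + \<delta>" by simp
      then show ?thesis
        using gp_change_left[OF x pc(2)[of k] pc(1)[of i] one_closed] x pc by (simp add: dist_one)
    qed
    then have "\<exists>(m::int) (n::int). 0 < m \<and> \<one> \<otimes> a [^] m \<otimes> inv \<one> = x \<otimes> b [^] n \<otimes> inv x"
      by (intro I) (use x in auto)
    then show False using indep a by auto
  qed
qed

end

section \<open>Two independent axes\<close>

lemma (in group) elementary_if_coarsely_cyclic:
  assumes a: "a \<in> carrier G" and B: "finite B" "B \<subseteq> carrier G"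
    and cover: "\<And>t. t \<in> carrier G \<Longrightarrow> \<exists>(l::int). \<exists>r\<in>B. t = a [^] l \<otimes> r"
  shows "elementary_group G"
proof -
  define H where "H = range (\<lambda>n::int. a [^] n)"
  have H: "subgroup H G"
  proof (rule subgroupI)
    show "H \<subseteq> carrier G" "H \<noteq> {}" using a by (auto simp: H_def)
    show "inv x \<in> H" if x: "x \<in> H" for x
    proof -
      obtain n :: int where "x = a [^] n" using x by (auto simp: H_def)
      then have "inv x = a [^] (- n)" using a by (simp add: int_pow_neg)
      then show ?thesis unfolding H_def by (rule range_eqI)
    qed
    show "x \<otimes> y \<in> H" if xy: "x \<in> H" "y \<in> H" for x y
    proof -
      obtain n m :: int where "x = a [^] n" "y = a [^] m" using xy by (auto simp: H_def)
      then have "x \<otimes> y = a [^] (n + m)" using a by (simp add: int_pow_mult)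
      then show ?thesis unfolding H_def by (rule range_eqI)
    qed
  qed
  interpret H: group "G\<lparr>carrier := H\<rparr>" using H is_group by (rule subgroup.subgroup_is_group)
  have aH: "a \<in> H" unfolding H_def by (rule range_eqI[of _ _ 1]) (use a in simp)
  have e: "a [^]\<^bsub>G\<lparr>carrier := H\<rparr>\<^esub> n = a [^] n" for n :: int
    by (rule int_pow_consistent[OF H aH, symmetric])
  have "cyclic_group (G\<lparr>carrier := H\<rparr>)"
    unfolding H.cyclic_group
  proof (rule bexI[of _ a])
    show "carrier (G\<lparr>carrier := H\<rparr>) = range (\<lambda>n::int. a [^]\<^bsub>G\<lparr>carrier := H\<rparr>\<^esub> n)"
      unfolding e by (simp add: H_def)
  qed (use aH in simp)
  moreover have "rcosets H \<subseteq> (\<lambda>r. H #> r) ` B"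
  proof
    fix K assume "K \<in> rcosets H"
    then obtain t where t: "t \<in> carrier G" "K = H #> t" by (auto simp: RCOSETS_def)
    obtain l :: int and r where r: "r \<in> B" "t = a [^] l \<otimes> r" using cover[OF t(1)] by blast
    then have "t \<in> H #> r" by (auto simp: r_coset_def H_def)
    then have "H #> r = H #> t" using r B H by (intro repr_independence) auto
    then show "K \<in> (\<lambda>r. H #> r) ` B" using t r by auto
  qed
  then have "finite (rcosets H)" using B(1) finite_surj by blast
  ultimately show ?thesis unfolding elementary_group_def using H by blast
qed

locale nonelementary_hyperbolic_group = torsion_free_hyperbolic_group G S \<delta>
  for G (structure) and S :: "'a set" and \<delta> +
  assumes nonelementary: "\<not> elementary_group G"
begin

lemma ex_nontrivial: "\<exists>a\<in>carrier G. a \<noteq> \<one>"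
proof (rule ccontr)
  assume "\<not> ?thesis"
  then have "elementary_group G"
    by (intro elementary_if_coarsely_cyclic[of \<one> "{\<one>}"]) auto
  then show False using nonelementary by simp
qed

lemma int_pow_eq_one:
  assumes "a \<in> carrier G" "a \<noteq> \<one>" "a [^] (m::int) = \<one>"
  shows "m = 0"
proof -
  have "a [^] nat \<bar>m\<bar> = \<one>"
  proof (cases "0 \<le> m")
    case True
    then show ?thesis using assms int_pow_int[of G a "nat \<bar>m\<bar>"] by simp
  next
    case False
    then have "a [^] (- m) = \<one>" using assms by (simp add: int_pow_neg)
    then show ?thesis using False int_pow_int[of G a "nat \<bar>m\<bar>"] by simp
  qed
  then show ?thesis using pow_eq_one[OF assms(1,2)] by fastforce
qed

text \<open>
  If \<open>t a\<^sup>m t\<inverse> = a\<^sup>n\<close>, then the axis of \<open>a\<close> and its translate by \<open>t\<close> have the same ends; as \<open>t\<close> lies on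
  the latter, hyperbolicity puts it at a uniform distance from the former. So if this happened for all
  \<open>t\<close>, then finitely many cosets of \<open>\<langle>a\<rangle>\<close> would cover the group.
\<close>

lemma ex_not_commensurating:
  assumes a: "a \<in> carrier G" "a \<noteq> \<one>"
  shows "\<exists>t\<in>carrier G. \<forall>(m::int) (n::int). 0 < m \<longrightarrow> t \<otimes> a [^] m \<otimes> inv t \<noteq> a [^] n"
proof (rule ccontr)
  assume "\<not> ?thesis"
  then have comm: "\<exists>(m::int) (n::int). 0 < m \<and> t \<otimes> a [^] m \<otimes> inv t = a [^] n" if "t \<in> carrier G" for t
    using that by blast
  obtain c0 L where c0: "0 \<le> c0" "\<And>(m::nat) (l::nat). gp (inv (a [^] m)) (a [^] l) \<one> \<le> c0"
    and L: "0 < L" "\<And>m :: nat. real m \<le> L * len (a [^] m) + L"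
    using powers_quasi_geodesic[OF a] by metis
  obtain R where R: "\<And>y (n::nat) w. \<lbrakk>y \<in> carrier G; w \<in> carrier G; gp y (y \<otimes> a [^] n) w \<le> c0 + 2 * \<delta>\<rbrakk>
    \<Longrightarrow> \<exists>l::nat. dist (y \<otimes> a [^] l) w \<le> R" using near_axis[OF a, of "c0 + 2 * \<delta>"] by blast
  have pc: "a [^] (i::nat) \<in> carrier G" "a [^] (j::int) \<in> carrier G" for i j using a by simp_all
  have "\<exists>l::int. \<exists>r\<in>{x \<in> carrier G. len x \<le> R}. t = a [^] l \<otimes> r" if t: "t \<in> carrier G" for t
  proof -
    obtain m n :: int where mn: "0 < m" "t \<otimes> a [^] m \<otimes> inv t = a [^] n" using comm[OF t] by blast
    define q where "q = nat \<lceil>L * (c0 + 2 * \<delta> + 1 + len t) + L\<rceil>"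
    define e where "e = a [^] (nat m * q)"
    define f where "f = a [^] (n * int q)"
    have ec: "e \<in> carrier G" "f \<in> carrier G" using a by (simp_all add: e_def f_def)
    have "L * (c0 + 2 * \<delta> + 1 + len t) + L \<le> real q" unfolding q_def by (rule real_nat_ceiling_ge)
    also have "\<dots> \<le> real (nat m * q)"
    proof -
      have "1 * q \<le> nat m * q" using mn(1) by (intro mult_le_mono1) simp
      then show ?thesis by (simp only: of_nat_le_iff mult_1)
    qed
    also have "\<dots> \<le> L * len e + L" unfolding e_def by (rule L(2))
    finally have long: "c0 + 2 * \<delta> + 1 + len t \<le> len e" using L(1) by simp
    have e_int: "e = (a [^] m) [^] int q"
      using a mn(1) int_pow_pow[of a m "int q"] int_pow_int[of G a "nat m * q"] by (simp add: e_def)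
    have "t \<otimes> e \<otimes> inv t = f"
      unfolding e_int f_def conj_pow[OF t pc(2), symmetric] mn(2) using a by (simp add: int_pow_pow)
    then have te: "t \<otimes> e = f \<otimes> t" using t ec by (metis inv_solve_right' m_closed)
    have "inv f \<otimes> (t \<otimes> e) \<otimes> inv e = inv f \<otimes> (f \<otimes> t) \<otimes> inv e" by (simp only: te)
    then have te': "t \<otimes> inv e = inv f \<otimes> t" using t ec by (simp add: m_assoc mult_inv_cancel)
    have d: "dist (t \<otimes> inv e) (inv f) = len t" "dist (t \<otimes> e) f = len t"
      unfolding te te' using t ec by (simp_all add: dist_mult_self)
    have dt: "dist t (t \<otimes> inv e) = len e" "dist t (t \<otimes> e) = len e"
      using t ec by (simp_all add: dist_mult_self)
    have "gp (t \<otimes> inv e) (t \<otimes> e) t \<le> c0"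
      using c0(2)[of "nat m * q" "nat m * q"] gp_mult[of t "inv e" e \<one>] t ec by (simp add: e_def)
    then have "gp (t \<otimes> inv e) (inv f) t \<le> c0 + \<delta> \<or> gp (inv f) (t \<otimes> e) t \<le> c0 + \<delta>"
      using t ec by (intro hyperbolic_cases) auto
    moreover have "c0 + \<delta> < gp (t \<otimes> inv e) (inv f) t"
      using gp_ge_dist[of "t \<otimes> inv e" "inv f" t] t ec d dt long delta0 by simp
    ultimately have "gp (inv f) (t \<otimes> e) t \<le> c0 + \<delta>" by simp
    then have "gp (inv f) f t \<le> (c0 + \<delta>) + \<delta> \<or> gp f (t \<otimes> e) t \<le> (c0 + \<delta>) + \<delta>"
      using t ec by (intro hyperbolic_cases) auto
    moreover have "c0 + \<delta> + \<delta> < gp f (t \<otimes> e) t"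
      using gp_ge_dist[of "t \<otimes> e" f t] gp_commute[of f "t \<otimes> e" t] t ec d dt long delta0 by simp
    ultimately have fgp: "gp (inv f) f t \<le> c0 + 2 * \<delta>" by simp
    define N where "N = nat \<bar>n\<bar> * q"
    have "gp (inv (a [^] N)) (a [^] N) t \<le> c0 + 2 * \<delta>"
    proof (cases "0 \<le> n")
      case True
      then have "f = a [^] N" using int_pow_int[of G a N] by (simp add: f_def N_def)
      then show ?thesis using fgp by simp
    next
      case False
      then have "inv f = a [^] N" using int_pow_int[of G a N] int_pow_neg[OF a(1), of "n * int q"]
        by (simp add: f_def N_def)
      then show ?thesis using fgp gp_commute[OF _ _ t, of "inv f" f] ec by (metis inv_inv inv_closed)
    qed
    moreover have "inv (a [^] N) \<otimes> a [^] (N + N) = a [^] N"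
      using a by (simp add: nat_pow_mult[symmetric] mult_inv_cancel)
    ultimately have "gp (inv (a [^] N)) (inv (a [^] N) \<otimes> a [^] (N + N)) t \<le> c0 + 2 * \<delta>" by simp
    then have "\<exists>l::nat. dist (inv (a [^] N) \<otimes> a [^] l) t \<le> R" using t pc by (intro R) auto
    then obtain l :: nat where l: "dist (inv (a [^] N) \<otimes> a [^] l) t \<le> R" by blast
    have e: "inv (a [^] N) \<otimes> a [^] l = a [^] (int l - int N)"
      using a int_pow_mult[OF a(1), of "- int N" "int l"] by (simp add: int_pow_neg int_pow_int)
    let ?r = "inv (a [^] (int l - int N)) \<otimes> t"
    have "t = a [^] (int l - int N) \<otimes> ?r" using t pc by (simp add: mult_inv_cancel)
    moreover have "len ?r \<le> R" using l unfolding e by (simp add: word_metric_def)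
    moreover have "?r \<in> carrier G" using t pc by simp
    ultimately show ?thesis by blast
  qed
  then have "elementary_group G"
    using elementary_if_coarsely_cyclic[OF a(1) finite_ball] by blast
  then show False using nonelementary by simp
qed

lemma axis_pair:
  obtains a t C where "a \<in> carrier G" "a \<noteq> \<one>" "t \<in> carrier G"
    "\<And>(m::int) (n::int). m \<noteq> 0 \<Longrightarrow> t \<otimes> a [^] m \<otimes> inv t \<noteq> a [^] n"
    "\<And>(j::int) (k::int). gp (a [^] j) (t \<otimes> a [^] k) \<one> \<le> C"
proof -
  obtain a where a: "a \<in> carrier G" "a \<noteq> \<one>" using ex_nontrivial by blast
  obtain t where t: "t \<in> carrier G" and
    t0: "\<And>(m::int) (n::int). 0 < m \<Longrightarrow> t \<otimes> a [^] m \<otimes> inv t \<noteq> a [^] n"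
    using ex_not_commensurating[OF a] by blast
  have pc: "a [^] (i::nat) \<in> carrier G" "a [^] (j::int) \<in> carrier G" for i j using a by simp_all
  have invs: "t \<otimes> a [^] (- m) \<otimes> inv t = inv (t \<otimes> a [^] m \<otimes> inv t)" for m :: int
    using t a by (simp add: int_pow_neg inv_mult_group m_assoc)
  have indep: "t \<otimes> a [^] m \<otimes> inv t \<noteq> a [^] n" if "m \<noteq> 0" for m n :: int
  proof (cases "0 < m")
    case True
    then show ?thesis by (rule t0)
  next
    case False
    show ?thesis
    proof
      assume "t \<otimes> a [^] m \<otimes> inv t = a [^] n"
      then have "t \<otimes> a [^] (- m) \<otimes> inv t = a [^] (- n)" unfolding invs using a by (simp add: int_pow_neg)
      then show False using t0[of "- m" "- n"] False that by simp
    qed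
  qed
  have indep': "a [^] m \<noteq> t \<otimes> a [^] n \<otimes> inv t" if "m \<noteq> 0" for m n :: int
  proof
    assume e: "a [^] m = t \<otimes> a [^] n \<otimes> inv t"
    then have "n \<noteq> 0" using int_pow_eq_one[OF a, of m] that t by auto
    then show False using indep[of n m] e by simp
  qed
  have ia: "inv a \<in> carrier G" "inv a \<noteq> \<one>" using a by simp_all
  have ip: "(inv a) [^] n = a [^] (- n)" for n :: int using a by (simp add: int_pow_inv int_pow_neg)
  obtain C1 where C1: "\<And>(j::nat) (k::nat). gp (a [^] j) (t \<otimes> a [^] k) \<one> \<le> C1"
    by (rule independent_directions[OF a a t]) (use indep' in auto)
  obtain C2 where C2: "\<And>(j::nat) (k::nat). gp (a [^] j) (t \<otimes> (inv a) [^] k) \<one> \<le> C2"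
    by (rule independent_directions[OF a ia t]) (use indep' ip in auto)
  obtain C3 where C3: "\<And>(j::nat) (k::nat). gp ((inv a) [^] j) (t \<otimes> a [^] k) \<one> \<le> C3"
    by (rule independent_directions[OF ia a t]) (use indep' ip in auto)
  obtain C4 where C4: "\<And>(j::nat) (k::nat). gp ((inv a) [^] j) (t \<otimes> (inv a) [^] k) \<one> \<le> C4"
    by (rule independent_directions[OF ia ia t]) (use indep' ip in auto)
  define C where "C = max (max C1 C2) (max C3 C4)"
  have signs: "(\<exists>k::nat. a [^] i = a [^] k) \<or> (\<exists>k::nat. a [^] i = (inv a) [^] k)" for i :: int
  proof (cases "0 \<le> i")
    case True
    then show ?thesis using int_pow_int[of G a "nat i"] by (metis nat_0_le)
  next
    case False
    then have "a [^] i = (inv a) [^] nat (- i)"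
      using int_pow_int[of G "inv a" "nat (- i)"] ip[of "- i"] by simp
    then show ?thesis by blast
  qed
  have "gp (a [^] j) (t \<otimes> a [^] k) \<one> \<le> C" for j k :: int
    using signs[of j] signs[of k] C1 C2 C3 C4 unfolding C_def by (metis max.coboundedI1 max.coboundedI2)
  then show ?thesis using that[OF a t indep] by blast
qed

context
  fixes a t C
  assumes a: "a \<in> carrier G" "a \<noteq> \<one>" and t: "t \<in> carrier G"
    and indep: "\<And>(m::int) (n::int). m \<noteq> 0 \<Longrightarrow> t \<otimes> a [^] m \<otimes> inv t \<noteq> a [^] n"
    and C: "\<And>(j::int) (k::int). gp (a [^] j) (t \<otimes> a [^] k) \<one> \<le> C"
begin

lemma C_nat: "gp (inv (a [^] (j::nat))) (t \<otimes> a [^] (k::nat)) \<one> \<le> C"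
  using C[of "- int j" "int k"] a by (simp add: int_pow_neg int_pow_int)

lemma len_corner:
  "len (a [^] (p::nat)) + len (t \<otimes> a [^] p) \<le> len (a [^] p \<otimes> t \<otimes> a [^] p) + 2 * C"
proof -
  have "gp (inv (a [^] p)) (t \<otimes> a [^] p) \<one> \<le> C" by (rule C_nat)
  moreover have "dist (inv (a [^] p)) (t \<otimes> a [^] p) = len (a [^] p \<otimes> t \<otimes> a [^] p)"
    using a t by (simp add: word_metric_def m_assoc)
  ultimately show ?thesis using a t by (simp add: gromov_product_def dist_one)
qed

text \<open>
  If both products were smaller than \<open>f\<close>, then the broken geodesic from \<open>x\<close> to \<open>y = x a\<^sup>p t a\<^sup>p\<close> would follow
  the axis of \<open>a\<close> up to a bounded excess. So would both of its long parts, and comparing their coincidences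
  with the axis would conjugate a power of \<open>a\<close> by \<open>t\<close> to a power of \<open>a\<close>. The sum of the two products
  is the amount by which the signed distance along the axis grows less than \<open>d(x, y)\<close>.
\<close>

lemma translates_avoid_axis:
  assumes f: "0 \<le> f"
  shows "\<exists>p0. \<forall>p\<ge>p0. \<forall>k::nat. \<forall>x\<in>carrier G.
    f \<le> gp \<one> (x \<otimes> (a [^] (p::nat) \<otimes> t \<otimes> a [^] p)) x + gp x (a [^] k) (x \<otimes> (a [^] p \<otimes> t \<otimes> a [^] p))"
proof -
  obtain c0 L where c0: "0 \<le> c0" "\<And>(m::nat) (l::nat). gp (inv (a [^] m)) (a [^] l) \<one> \<le> c0"
    and L: "0 < L" "\<And>m :: nat. real m \<le> L * len (a [^] m) + L"
    using powers_quasi_geodesic[OF a] by metis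
  have C0: "0 \<le> C" using C[of 0 0] gp_nonneg[of \<one> t \<one>] t by simp
  define c where "c = 2 * f + \<delta> + c0 + C + len t"
  obtain I :: nat where I: "\<And>u y (n::nat). \<lbrakk>u \<in> carrier G; y \<in> carrier G;
      \<And>i::nat. i \<le> I \<Longrightarrow> gp y (y \<otimes> a [^] n) (u \<otimes> a [^] i) \<le> c\<rbrakk>
    \<Longrightarrow> \<exists>(m::int) (n::int). 0 < m \<and> u \<otimes> a [^] m \<otimes> inv u = y \<otimes> a [^] n \<otimes> inv y"
    using long_coincidence[OF a(1) a, of c] by blast
  have pc: "a [^] (i::nat) \<in> carrier G" "a [^] (j::int) \<in> carrier G" for i j using a by simp_all
  define p0 where "p0 = max I (nat \<lceil>L * (2 * f + \<delta> + len t + 2 * C + 1) + L\<rceil>)"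
  show ?thesis
  proof (intro exI[of _ p0] allI impI ballI, rule ccontr)
    fix p k :: nat and x assume p: "p0 \<le> p" and x: "x \<in> carrier G"
    define g where "g = a [^] p \<otimes> t \<otimes> a [^] p"
    define y where "y = x \<otimes> g"
    define z where "z = x \<otimes> a [^] p"
    define z' where "z' = z \<otimes> t"
    define B where "B = a [^] k"
    assume "\<not> f \<le> gp \<one> (x \<otimes> (a [^] p \<otimes> t \<otimes> a [^] p)) x + gp x (a [^] k) (x \<otimes> (a [^] p \<otimes> t \<otimes> a [^] p))"
    then have less: "gp \<one> y x + gp x B y < f" by (simp add: y_def g_def B_def)
    have cc: "g \<in> carrier G" "y \<in> carrier G" "z \<in> carrier G" "z' \<in> carrier G" "B \<in> carrier G"
      using a t x by (simp_all add: g_def y_def z_def z'_def B_def)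
    have less': "gp \<one> y x \<le> f" "gp x B y \<le> f"
      using less gp_nonneg[of \<one> y x] gp_nonneg[of x B y] cc x by simp_all
    have yz: "y = z \<otimes> (t \<otimes> a [^] p)" "y = z' \<otimes> a [^] p"
      using a t x by (simp_all add: y_def g_def z_def z'_def m_assoc)
    have dxy: "dist x y = len g" using x cc by (simp add: y_def dist_mult_self)
    have dxz: "dist x z = len (a [^] p)" using x pc by (simp add: z_def dist_mult_self)
    have dzz: "dist z z' = len t" using cc t by (simp add: z'_def dist_mult_self)
    have dzy: "dist z y = len (t \<otimes> a [^] p)" using cc t pc by (simp add: yz(1) dist_mult_self)
    have corner: "dist x z + dist z y \<le> dist x y + 2 * C"
      using len_corner[of p] by (simp add: dxz dzy dxy g_def)
    have "L * (2 * f + \<delta> + len t + 2 * C + 1) + L \<le> real p"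
      using p unfolding p0_def by linarith
    then have "L * (2 * f + \<delta> + len t + 2 * C + 1) \<le> L * len (a [^] p)" using L(2)[of p] by simp
    then have "2 * f + \<delta> + len t + 2 * C + 1 \<le> len (a [^] p)" using L(1) by simp
    then have long: "2 * f + \<delta> < dist x y" 
      using corner triangle[of z' z y] dzz nonneg[of z y] cc by (simp add: dxz)
    have "gp \<one> B x \<le> f + \<delta> \<or> gp B y x \<le> f + \<delta>"
      using less'(1) cc x by (intro hyperbolic_cases) auto
    moreover have "f + \<delta> < gp B y x"
      using gp_add_gp[of x y B] gp_commute[of B y x] less'(2) long cc x by simp
    ultimately have xB: "gp \<one> B x \<le> f + \<delta>" by simp
    have near: "gp \<one> B w \<le> c" if w: "w \<in> carrier G"
      "dist x w + dist w y \<le> dist x y + 2 * (c0 + C + len t)" for w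
      using xB less'(2) triangle[of \<one> x w] triangle[of w y B] x w cc
      unfolding gromov_product_def c_def by (simp add: field_simps)
    have pows: "dist u (u \<otimes> a [^] i) + dist (u \<otimes> a [^] i) (u \<otimes> a [^] p) \<le> dist u (u \<otimes> a [^] p) + 2 * c0"
      if "u \<in> carrier G" "i \<le> p" for u and i :: nat
      using powers_between[OF a(1) c0(2) that] unfolding gromov_product_def by argo
    have Ip: "i \<le> p" if "i \<le> I" for i using that p by (simp add: p0_def)
    have "\<exists>(m::int) (n::int). 0 < m \<and> x \<otimes> a [^] m \<otimes> inv x = \<one> \<otimes> a [^] n \<otimes> inv \<one>"
    proof (rule I)
      fix i :: nat assume i: "i \<le> I"
      have "gp \<one> B (x \<otimes> a [^] i) \<le> c"
      proof (rule near)
        show "dist x (x \<otimes> a [^] i) + dist (x \<otimes> a [^] i) y \<le> dist x y + 2 * (c0 + C + len t)"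
          using pows[OF x Ip[OF i]] corner triangle[of "x \<otimes> a [^] i" z y] x cc pc
          by (simp add: z_def[symmetric])
      qed (use x pc in simp)
      then show "gp \<one> (\<one> \<otimes> a [^] k) (x \<otimes> a [^] i) \<le> c" using pc by (simp add: B_def)
    qed (use x in auto)
    then obtain m n :: int where mn: "0 < m" "x \<otimes> a [^] m \<otimes> inv x = a [^] n" using a by auto
    have "\<exists>(m::int) (n::int). 0 < m \<and> z' \<otimes> a [^] m \<otimes> inv z' = \<one> \<otimes> a [^] n \<otimes> inv \<one>"
    proof (rule I)
      fix i :: nat assume i: "i \<le> I"
      have "gp \<one> B (z' \<otimes> a [^] i) \<le> c"
      proof (rule near)
        show "dist x (z' \<otimes> a [^] i) + dist (z' \<otimes> a [^] i) y \<le> dist x y + 2 * (c0 + C + len t)"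
          using pows[OF cc(4) Ip[OF i]] corner triangle[of x z "z' \<otimes> a [^] i"]
            triangle[of z z' "z' \<otimes> a [^] i"] triangle[of z' z y] sym[of z z'] dzz x cc pc
          by (simp add: yz(2)[symmetric])
      qed (use cc pc in simp)
      then show "gp \<one> (\<one> \<otimes> a [^] k) (z' \<otimes> a [^] i) \<le> c" using pc by (simp add: B_def)
    qed (use cc in auto)
    then obtain m' n' :: int where mn': "0 < m'" "z' \<otimes> a [^] m' \<otimes> inv z' = a [^] n'" using a by auto
    \<comment> \<open>Raised to the powers \<open>n'\<close> and \<open>n\<close>, the two coincidences have the same right-hand side;
      as \<open>z' = z t\<close>, cancelling \<open>z\<close> leaves a relation for \<open>t\<close>, which is nontrivial because \<open>n \<noteq> 0\<close>.\<close>
    have "n \<noteq> 0"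
    proof
      assume "n = 0"
      then have "x \<otimes> a [^] m = \<one> \<otimes> x" using mn(2) x pc
        by (metis int_pow_0 inv_solve_right' m_closed one_closed)
      then have "a [^] m = \<one>" using x pc by simp
      then show False using int_pow_eq_one[OF a] mn(1) by fastforce
    qed
    have zm: "z \<otimes> a [^] m \<otimes> inv z = a [^] n"
    proof -
      have "a [^] p \<otimes> a [^] m = a [^] m \<otimes> a [^] p"
        using int_pow_mult[OF a(1), of "int p" m] int_pow_mult[OF a(1), of m "int p"]
        by (simp add: int_pow_int add.commute)
      then have "z \<otimes> a [^] m \<otimes> inv z = x \<otimes> (a [^] m \<otimes> a [^] p) \<otimes> inv (x \<otimes> a [^] p)"
        unfolding z_def using x pc by (simp add: m_assoc)
      also have "\<dots> = x \<otimes> a [^] m \<otimes> inv x"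
        using x pc by (simp add: m_assoc inv_mult_group mult_inv_cancel)
      finally show ?thesis using mn(2) by simp
    qed
    have 1: "z \<otimes> a [^] (m * n') \<otimes> inv z = a [^] (n * n')"
      using conj_pow[of z "a [^] m" n'] cc pc zm a by (simp add: int_pow_pow)
    have 2: "z' \<otimes> a [^] (m' * n) \<otimes> inv z' = a [^] (n' * n)"
      using conj_pow[of z' "a [^] m'" n] cc pc mn'(2) a by (simp add: int_pow_pow)
    have "z' \<otimes> a [^] (m' * n) \<otimes> inv z' = z \<otimes> (t \<otimes> a [^] (m' * n) \<otimes> inv t) \<otimes> inv z"
      unfolding z'_def using cc t pc by (simp add: m_assoc inv_mult_group)
    then have "z \<otimes> (t \<otimes> a [^] (m' * n) \<otimes> inv t) \<otimes> inv z = z \<otimes> a [^] (m * n') \<otimes> inv z"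
      using 1 2 by (simp add: mult.commute)
    then have "t \<otimes> a [^] (m' * n) \<otimes> inv t = a [^] (m * n')" using cc t pc by simp
    then show False using indep[of "m' * n" "m * n'"] mn'(1) \<open>n \<noteq> 0\<close> by simp
  qed
qed

end

text \<open>
  Every long element becomes cyclically straight after right multiplication by one of three fixed elements,
  two on the axis of \<open>a\<close> and one on its translate by \<open>t\<close>: their directions are pairwise distinct, so at
  most one of the three is close to the direction of \<open>g\<inverse>\<close>, and at most one has its inverse close
  to the direction of \<open>g\<close>.
\<close>

lemma straight_closing:
  obtains M where "0 \<le> M" "\<And>g. \<lbrakk>g \<in> carrier G; M \<le> len g\<rbrakk> \<Longrightarrow>
    \<exists>h\<in>carrier G. h \<noteq> \<one> \<and> len (inv g \<otimes> h) \<le> M \<and>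
      (\<forall>(j::nat) (k::nat). gp (inv (h [^] j)) (h [^] k) \<one> \<le> M)"
proof -
  obtain a t C where a: "a \<in> carrier G" "a \<noteq> \<one>" and t: "t \<in> carrier G"
    and C: "\<And>(j::int) (k::int). gp (a [^] j) (t \<otimes> a [^] k) \<one> \<le> C"
    using axis_pair by metis
  obtain c0 L where c0: "0 \<le> c0" "\<And>(m::nat) (l::nat). gp (inv (a [^] m)) (a [^] l) \<one> \<le> c0"
    and L: "0 < L" "\<And>m :: nat. real m \<le> L * len (a [^] m) + L"
    using powers_quasi_geodesic[OF a] by metis
  define C' where "C' = max c0 (C + len t)"
  define c where "c = C' + \<delta>"
  have c: "0 \<le> c" using c0 delta0 by (simp add: c_def C'_def)
  define N where "N = nat \<lceil>L * (2 * c + 3 * \<delta> + 1 + 2 * len t) + L\<rceil>"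
  define u1 where "u1 = a [^] N"
  define u2 where "u2 = inv u1"
  define u3 where "u3 = t \<otimes> u1 \<otimes> inv t"
  have uc: "u1 \<in> carrier G" "u2 \<in> carrier G" "u3 \<in> carrier G"
    using a t by (simp_all add: u1_def u2_def u3_def)
  have "L * (2 * c + 3 * \<delta> + 1 + 2 * len t) + L \<le> L * len u1 + L"
    using L(2)[of N] real_nat_ceiling_ge[of "L * (2 * c + 3 * \<delta> + 1 + 2 * len t) + L"]
    unfolding N_def[symmetric] u1_def by linarith
  then have len1: "2 * c + 3 * \<delta> + 1 + 2 * len t \<le> len u1" using L(1) by simp
  have len3: "len u1 \<le> len u3 + 2 * len t"
  proof -
    have "u1 = inv t \<otimes> u3 \<otimes> t" unfolding u3_def using t uc by (simp add: m_assoc mult_inv_cancel)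
    then show ?thesis using len_mult[of "inv t \<otimes> u3" t] len_mult[of "inv t" u3] t uc by simp
  qed
  define U where "U = {u1, u2, u3}"
  have long: "2 * c + 3 * \<delta> + 1 \<le> len u" if "u \<in> U" for u
    using that len1 len3 uc by (auto simp: U_def u2_def)
  have u12: "gp u1 u2 \<one> \<le> C'"
    using c0(2)[of N N] gp_commute[of u1 u2 \<one>] uc by (simp add: C'_def u1_def u2_def)
  have pair: "gp (a [^] i) (t \<otimes> a [^] j \<otimes> inv t) \<one> \<le> C'" for i j :: int
  proof -
    have "gp (a [^] i) (t \<otimes> a [^] j \<otimes> inv t) \<one> \<le> gp (a [^] i) (t \<otimes> a [^] j) \<one> + len (inv t)"
      using gp_change_right[of "a [^] i" "t \<otimes> a [^] j \<otimes> inv t" \<one> "t \<otimes> a [^] j"]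
        dist_mult_self(2)[of "t \<otimes> a [^] j" "inv t"] a t by simp
    then show ?thesis using C[of i j] t by (simp add: C'_def)
  qed
  have ui: "u1 = a [^] int N" "u2 = a [^] (- int N)" "u3 = t \<otimes> a [^] int N \<otimes> inv t"
    "inv u3 = t \<otimes> a [^] (- int N) \<otimes> inv t" "inv u1 = a [^] (- int N)" "inv u2 = a [^] int N"
    using a t by (simp_all add: u1_def u2_def u3_def int_pow_neg int_pow_int inv_mult_group m_assoc)
  have p13: "gp u1 u3 \<one> \<le> C'" by (subst ui(1), subst ui(3), rule pair)
  have p23: "gp u2 u3 \<one> \<le> C'" by (subst ui(2), subst ui(3), rule pair)
  have q13: "gp (inv u1) (inv u3) \<one> \<le> C'" by (subst ui(5), subst ui(4), rule pair)
  have q23: "gp (inv u2) (inv u3) \<one> \<le> C'" by (subst ui(6), subst ui(4), rule pair)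
  have q12: "gp (inv u1) (inv u2) \<one> \<le> C'"
    using u12 gp_commute[of u1 u2 \<one>] uc by (simp add: u2_def)
  have one_bad: "gp x v \<one> \<le> c \<or> gp x w \<one> \<le> c"
    if "gp v w \<one> \<le> C'" "x \<in> carrier G" "v \<in> carrier G" "w \<in> carrier G" for x v w
    using hyperbolic_cases[of v x w \<one> C'] gp_commute[of x v \<one>] that by (simp add: c_def)
  define M where "M = (2 * c + 3 * \<delta> + 1) + (c + 2 * \<delta>) + (len u1 + len u2 + len u3)"
  show ?thesis
  proof (rule that[of M])
    show "0 \<le> M" using c delta0 by (simp add: M_def)
    fix g assume g: "g \<in> carrier G" and gM: "M \<le> len g"
    have "\<exists>u\<in>U. gp (inv g) u \<one> \<le> c \<and> gp (inv u) g \<one> \<le> c"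
    proof -
      have "gp (inv g) u1 \<one> \<le> c \<or> gp (inv g) u2 \<one> \<le> c" "gp (inv g) u1 \<one> \<le> c \<or> gp (inv g) u3 \<one> \<le> c"
        "gp (inv g) u2 \<one> \<le> c \<or> gp (inv g) u3 \<one> \<le> c"
        using one_bad[OF u12, of "inv g"] one_bad[OF p13, of "inv g"] one_bad[OF p23, of "inv g"] g uc by auto
      moreover have "gp g (inv u1) \<one> \<le> c \<or> gp g (inv u2) \<one> \<le> c" "gp g (inv u1) \<one> \<le> c \<or> gp g (inv u3) \<one> \<le> c"
        "gp g (inv u2) \<one> \<le> c \<or> gp g (inv u3) \<one> \<le> c"
        using one_bad[OF q12, of g] one_bad[OF q13, of g] one_bad[OF q23, of g] g uc by auto
      moreover have "gp g (inv u) \<one> = gp (inv u) g \<one>" if "u \<in> U" for u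
        using that g uc by (intro gp_commute) (auto simp: U_def)
      ultimately show ?thesis unfolding U_def by auto
    qed
    then obtain u where u: "u \<in> U" "gp (inv g) u \<one> \<le> c" "gp (inv u) g \<one> \<le> c" by blast
    have uc': "u \<in> carrier G" using u(1) uc by (auto simp: U_def)
    define h where "h = g \<otimes> u"
    have h: "h \<in> carrier G" using g uc' by (simp add: h_def)
    have hc: "h [^] (i::nat) \<in> carrier G" for i using h by simp
    \<comment> \<open>The chain \<open>1, g, g u, g u g, ...\<close> alternates between the steps \<open>g\<close> and \<open>u\<close>, both long; its
      points of even index are the powers of \<open>h\<close>.\<close>
    define x where "x i = (if even i then h [^] (i div 2) else h [^] (i div 2) \<otimes> g)" for i :: nat
    have x_even: "x (2 * i) = h [^] i" and x_odd: "x (2 * i + 1) = h [^] i \<otimes> g" for i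
      by (simp_all add: x_def)
    have step: "h [^] Suc i = h [^] i \<otimes> (g \<otimes> u)" for i by (simp add: h_def)
    have cycle: "h [^] i \<otimes> g = h [^] Suc i \<otimes> inv u" for i
      using hc[of i] g uc' by (simp add: h_def m_assoc)
    have xc: "x i \<in> carrier G" for i using hc g by (simp add: x_def)
    have turn: "gp (x i) (x (i + 2)) (x (i + 1)) \<le> c" for i
    proof (cases "even i")
      case True
      then obtain k where k: "i = 2 * k" by blast
      have e: "x i = h [^] k \<otimes> \<one>" "x (i + 2) = h [^] k \<otimes> (g \<otimes> u)" "x (i + 1) = h [^] k \<otimes> g"
        using x_even[of k] x_even[of "Suc k"] x_odd[of k] hc[of k] k by (simp_all add: h_def)
      have "gp (x i) (x (i + 2)) (x (i + 1)) = gp \<one> (g \<otimes> u) g"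
        unfolding e using hc[of k] g uc' by (intro gp_mult) auto
      also have "\<dots> = gp (inv g) u \<one>"
        using gp_at_one[of \<one> "g \<otimes> u" g] g uc' by (simp add: mult_inv_cancel)
      finally show ?thesis using u(2) by simp
    next
      case False
      then obtain k where k: "i = 2 * k + 1" using oddE by blast
      have e: "x i = h [^] Suc k \<otimes> inv u" "x (i + 2) = h [^] Suc k \<otimes> g" "x (i + 1) = h [^] Suc k \<otimes> \<one>"
        using x_odd[of k] x_odd[of "Suc k"] x_even[of "Suc k"] hc[of "Suc k"] cycle[of k] k by simp_all
      have "gp (x i) (x (i + 2)) (x (i + 1)) = gp (inv u) g \<one>"
        unfolding e using hc[of "Suc k"] g uc' by (intro gp_mult) auto
      then show ?thesis using u(3) by simp
    qed
    have len_g: "2 * c + 3 * \<delta> + 1 \<le> len g" using gM c delta0 by (simp add: M_def)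
    have far: "2 * c + 3 * \<delta> + 1 \<le> dist (x i) (x (i + 1))" for i
    proof (cases "even i")
      case True
      then obtain k where k: "i = 2 * k" by blast
      show ?thesis using x_even[of k] x_odd[of k] k dist_mult_self(1)[OF hc g, of k] len_g by simp
    next
      case False
      then obtain k where k: "i = 2 * k + 1" using oddE by blast
      have "dist (x i) (x (i + 1)) = len (inv u)"
        using x_odd[of k] x_even[of "Suc k"] k cycle[of k] dist_mult_self(2)[OF hc, of "inv u" "Suc k"] uc' by simp
      then show ?thesis using long[OF u(1)] uc' by simp
    qed
    note chain = local_to_global[of x c, OF xc c turn far]
    have "gp (inv (h [^] j)) (h [^] k) \<one> \<le> M" for j k :: nat
    proof -
      have "gp (x 0) (x (0 + 2 * j + 2 * k)) (x (0 + 2 * j)) \<le> c + 2 * \<delta>" by (rule chain(1))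
      moreover have "x (0 + 2 * j + 2 * k) = h [^] j \<otimes> h [^] k"
        using x_even[of "j + k"] h by (simp add: nat_pow_mult distrib_left)
      moreover have "x 0 = \<one>" "x (0 + 2 * j) = h [^] j" using x_even[of 0] x_even[of j] by simp_all
      ultimately have "gp (inv (h [^] j)) (h [^] k) \<one> \<le> c + 2 * \<delta>"
        using gp_at_one[of \<one> "h [^] j \<otimes> h [^] k" "h [^] j"] h by (simp add: mult_inv_cancel)
      then show ?thesis using c delta0 by (simp add: M_def)
    qed
    moreover have "h \<noteq> \<one>"
    proof
      assume "h = \<one>"
      then have "x 2 = x 0" using x_even[of 1] x_even[of 0] by simp
      moreover have "real 2 \<le> dist (x 0) (x (0 + 2))" by (rule chain(2))
      ultimately show False using refl[OF xc[of 0]] by (simp add: numeral_2_eq_2)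
    qed
    moreover have "len (inv g \<otimes> h) \<le> M"
      using u(1) g uc' c delta0 by (auto simp: h_def mult_inv_cancel U_def M_def)
    ultimately show "\<exists>h\<in>carrier G. h \<noteq> \<one> \<and> len (inv g \<otimes> h) \<le> M \<and>
      (\<forall>(j::nat) (k::nat). gp (inv (h [^] j)) (h [^] k) \<one> \<le> M)" using h by blast
  qed
qed

end

section \<open>Stable lengths and the distance\<close>

text \<open>
  The averages \<open>f(j) / j\<close> and \<open>f(k) / k\<close> are both within \<open>C / j\<close> or \<open>C / k\<close> of the average at \<open>j k\<close>.
\<close>

lemma almost_additive_sequence:
  fixes f :: "nat \<Rightarrow> real"
  assumes f: "\<And>j k. \<bar>f (j + k) - f j - f k\<bar> \<le> C"
  obtains l where "(\<lambda>k. f k / real k) \<longlonglongrightarrow> l" "\<And>k. \<bar>f k - real k * l\<bar> \<le> C"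
proof -
  have C0: "0 \<le> C" using f[of 0 0] by linarith
  have mult: "\<bar>f (Suc j * k) - real (Suc j) * f k\<bar> \<le> real j * C" for j k
  proof (induction j)
    case (Suc j)
    have "f (Suc (Suc j) * k) = f (k + Suc j * k)" by simp
    then have "\<bar>f (Suc (Suc j) * k) - f k - f (Suc j * k)\<bar> \<le> C" using f[of k "Suc j * k"] by simp
    then show ?case using Suc by (simp add: algebra_simps)
  qed simp
  have avg: "\<bar>f (j * k) / real (j * k) - f k / real k\<bar> \<le> C / real k" if jk: "0 < j" "0 < k" for j k
  proof -
    obtain i where i: "j = Suc i" using jk(1) gr0_implies_Suc by blast
    have "\<bar>f (j * k) - real j * f k\<bar> \<le> real i * C" using mult[of i k] i by simp
    also have "\<dots> \<le> real j * C" using i C0 by (intro mult_right_mono) auto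
    finally have "\<bar>f (j * k) - real j * f k\<bar> / real (j * k) \<le> real j * C / real (j * k)"
      by (intro divide_right_mono) auto
    moreover have "\<bar>f (j * k) - real j * f k\<bar> / real (j * k) = \<bar>f (j * k) / real (j * k) - f k / real k\<bar>"
    proof -
      have "f (j * k) / real (j * k) - f k / real k = (f (j * k) - real j * f k) / real (j * k)"
        using jk by (simp add: diff_divide_distrib)
      then show ?thesis by (simp add: abs_divide)
    qed
    ultimately show ?thesis using jk by simp
  qed
  have "Cauchy (\<lambda>k. f k / real k)"
  proof (rule CauchyI)
    fix e :: real assume e: "0 < e"
    define N where "N = Suc (nat \<lceil>2 * C / e\<rceil>)"
    have N: "2 * C / e < real k" if "N \<le> k" for k
      using that real_nat_ceiling_ge[of "2 * C / e"] unfolding N_def by linarith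
    have small: "C / real k < e / 2" if "N \<le> k" for k
    proof -
      have "0 < real k" using that by (simp add: N_def)
      then show ?thesis using N[OF that] e by (simp add: field_simps)
    qed
    have "norm (f m / real m - f n / real n) < e" if mn: "N \<le> m" "N \<le> n" for m n
    proof -
      have p: "0 < m" "0 < n" using mn by (simp_all add: N_def)
      show ?thesis using avg[OF p] avg[OF p(2,1)] small[OF mn(1)] small[OF mn(2)]
        unfolding real_norm_def by (simp only: mult.commute[of n m])
    qed
    then show "\<exists>M. \<forall>m\<ge>M. \<forall>n\<ge>M. norm (f m / real m - f n / real n) < e" by blast
  qed
  then obtain l where l: "(\<lambda>k. f k / real k) \<longlonglongrightarrow> l" using Cauchy_convergent convergent_def by blast
  have "\<bar>f k - real k * l\<bar> \<le> C" for k
  proof (cases "k = 0")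
    case True
    then show ?thesis using f[of 0 0] by simp
  next
    case False
    have "strict_mono (\<lambda>j. Suc j * k)" using False by (intro strict_monoI) simp
    then have "(\<lambda>j. f (Suc j * k) / real (Suc j * k)) \<longlonglongrightarrow> l"
      using LIMSEQ_subseq_LIMSEQ[OF l, of "\<lambda>j. Suc j * k"] by (simp only: o_def)
    then have "(\<lambda>j. \<bar>f (Suc j * k) / real (Suc j * k) - f k / real k\<bar>) \<longlonglongrightarrow> \<bar>l - f k / real k\<bar>"
      by (intro tendsto_intros)
    moreover have "\<bar>f (Suc j * k) / real (Suc j * k) - f k / real k\<bar> \<le> C / real k" for j
      using False by (intro avg) auto
    ultimately have "\<bar>l - f k / real k\<bar> \<le> C / real k" by (intro LIMSEQ_le_const2) auto
    then have "real k * \<bar>l - f k / real k\<bar> \<le> C" using False by (simp add: field_simps)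
    moreover have "real k * \<bar>l - f k / real k\<bar> = \<bar>real k * (l - f k / real k)\<bar>" by (simp add: abs_mult)
    moreover have "real k * (l - f k / real k) = real k * l - f k" using False by (simp add: field_simps)
    ultimately show ?thesis by (simp only: abs_minus_commute[of "f k"])
  qed
  then show ?thesis using that l by blast
qed

context nonelementary_hyperbolic_group
begin

abbreviation nontrivial :: "'a set" where
  "nontrivial \<equiv> carrier G - {\<one>}"

definition slen :: "('a \<Rightarrow> 'a \<Rightarrow> real) \<Rightarrow> 'a \<Rightarrow> real" where
  "slen \<psi> g = lim (\<lambda>k::nat. \<psi> \<one> (g [^] k) / real k)"

text \<open>
  The error depends on \<open>g\<close> only through the backtracking \<open>c\<close> of its powers. For \<open>k = 1\<close> this bounds the
  difference between \<open>\<psi>(1, g)\<close> and its stable length uniformly over all cyclically straight \<open>g\<close>.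
\<close>

lemma slen_straight:
  assumes \<psi>: "\<psi> \<in> potentials_H G"
  obtains K where "0 < K" "\<And>g c k. \<lbrakk>g \<in> carrier G; \<And>(i::nat) (j::nat). gp (inv (g [^] i)) (g [^] j) \<one> \<le> c\<rbrakk> \<Longrightarrow>
    (\<lambda>k::nat. \<psi> \<one> (g [^] k) / real k) \<longlonglongrightarrow> slen \<psi> g \<and> \<bar>\<psi> \<one> (g [^] (k::nat)) - real k * slen \<psi> g\<bar> \<le> K * c + K"
proof -
  obtain K where K: "0 < K" "\<And>x y. \<lbrakk>x \<in> carrier G; y \<in> carrier G\<rbrakk> \<Longrightarrow>
    \<bar>\<psi> \<one> (x \<otimes> y) - \<psi> \<one> x - \<psi> \<one> y\<bar> \<le> K * gp (inv x) y \<one> + K"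
    using potential_almost_additive[OF \<psi>] by blast
  show ?thesis
  proof (rule that[OF K(1)])
    fix g c and k :: nat
    assume g: "g \<in> carrier G" and c: "\<And>(i::nat) (j::nat). gp (inv (g [^] i)) (g [^] j) \<one> \<le> c"
    have "\<bar>\<psi> \<one> (g [^] (i + j)) - \<psi> \<one> (g [^] i) - \<psi> \<one> (g [^] j)\<bar> \<le> K * c + K" for i j :: nat
    proof -
      have "K * gp (inv (g [^] i)) (g [^] j) \<one> \<le> K * c" using c K(1) by simp
      then show ?thesis using K(2)[of "g [^] i" "g [^] j"] g by (simp add: nat_pow_mult)
    qed
    then obtain l where l: "(\<lambda>k. \<psi> \<one> (g [^] k) / real k) \<longlonglongrightarrow> l"
      "\<And>k::nat. \<bar>\<psi> \<one> (g [^] k) - real k * l\<bar> \<le> K * c + K"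
      using almost_additive_sequence[of "\<lambda>k::nat. \<psi> \<one> (g [^] k)" "K * c + K"] by blast
    have "slen \<psi> g = l" unfolding slen_def using l(1) by (rule limI)
    then show "(\<lambda>k::nat. \<psi> \<one> (g [^] k) / real k) \<longlonglongrightarrow> slen \<psi> g \<and> \<bar>\<psi> \<one> (g [^] k) - real k * slen \<psi> g\<bar> \<le> K * c + K"
      using l by simp
  qed
qed

lemma slen_bounded:
  assumes "\<psi> \<in> potentials_H G" "g \<in> nontrivial"
  obtains C where "\<And>k::nat. \<bar>\<psi> \<one> (g [^] k) - real k * slen \<psi> g\<bar> \<le> C"
proof -
  have g: "g \<in> carrier G" "g \<noteq> \<one>" using assms(2) by auto
  obtain c where c: "\<And>(m::nat) (l::nat). gp (inv (g [^] m)) (g [^] l) \<one> \<le> c"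
    using powers_quasi_geodesic[OF g] by metis
  obtain K where "0 < K" "\<And>g c k. \<lbrakk>g \<in> carrier G; \<And>(i::nat) (j::nat). gp (inv (g [^] i)) (g [^] j) \<one> \<le> c\<rbrakk> \<Longrightarrow>
    (\<lambda>k::nat. \<psi> \<one> (g [^] k) / real k) \<longlonglongrightarrow> slen \<psi> g \<and> \<bar>\<psi> \<one> (g [^] (k::nat)) - real k * slen \<psi> g\<bar> \<le> K * c + K"
    by (rule slen_straight[OF assms(1)]) (rule that; blast)
  then show ?thesis using that[of "K * c + K"] g(1) c by blast
qed

lemma slen_lim:
  assumes "\<psi> \<in> potentials_H G" "g \<in> nontrivial"
  shows "(\<lambda>k::nat. \<psi> \<one> (g [^] k) / real k) \<longlonglongrightarrow> slen \<psi> g"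
proof -
  have g: "g \<in> carrier G" "g \<noteq> \<one>" using assms(2) by auto
  obtain c where c: "\<And>(m::nat) (l::nat). gp (inv (g [^] m)) (g [^] l) \<one> \<le> c"
    using powers_quasi_geodesic[OF g] by metis
  obtain K where "0 < K" "\<And>g c k. \<lbrakk>g \<in> carrier G; \<And>(i::nat) (j::nat). gp (inv (g [^] i)) (g [^] j) \<one> \<le> c\<rbrakk> \<Longrightarrow>
    (\<lambda>k::nat. \<psi> \<one> (g [^] k) / real k) \<longlonglongrightarrow> slen \<psi> g \<and> \<bar>\<psi> \<one> (g [^] (k::nat)) - real k * slen \<psi> g\<bar> \<le> K * c + K"
    by (rule slen_straight[OF assms(1)]) (rule that; blast)
  then show ?thesis using g(1) c by blast
qed

lemma slen_le:
  assumes \<phi>: "\<phi> \<in> potentials_H G" and \<psi>: "\<psi> \<in> potentials_H G" and g: "g \<in> nontrivial"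
    and le: "\<And>x. x \<in> carrier G \<Longrightarrow> \<phi> \<one> x \<le> r * \<psi> \<one> x + C"
  shows "slen \<phi> g \<le> r * slen \<psi> g"
proof -
  have "(\<lambda>k::nat. r * (\<psi> \<one> (g [^] k) / real k) + C / real k) \<longlonglongrightarrow> r * slen \<psi> g + 0"
    by (intro tendsto_intros slen_lim \<psi> g lim_const_over_n)
  moreover have "\<phi> \<one> (g [^] k) / real k \<le> r * (\<psi> \<one> (g [^] k) / real k) + C / real k" for k :: nat
  proof -
    have "\<phi> \<one> (g [^] k) / real k \<le> (r * \<psi> \<one> (g [^] k) + C) / real k"
      using g by (intro divide_right_mono le) auto
    then show ?thesis by (simp add: add_divide_distrib)
  qed
  ultimately show ?thesis using LIMSEQ_le[OF slen_lim[OF \<phi> g]] by fastforce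
qed

lemma slen_rough:
  assumes \<phi>: "\<phi> \<in> potentials_H G" and \<psi>: "\<psi> \<in> potentials_H G" and g: "g \<in> nontrivial"
    and r: "0 < r" and rough: "\<And>x. x \<in> carrier G \<Longrightarrow> \<bar>\<phi> \<one> x - r * \<psi> \<one> x\<bar> \<le> C"
  shows "slen \<phi> g = r * slen \<psi> g"
proof (rule antisym)
  have "\<phi> \<one> x \<le> r * \<psi> \<one> x + C" if "x \<in> carrier G" for x using rough[OF that] by linarith
  then show "slen \<phi> g \<le> r * slen \<psi> g" by (rule slen_le[OF \<phi> \<psi> g])
  have "\<psi> \<one> x \<le> (1 / r) * \<phi> \<one> x + C / r" if "x \<in> carrier G" for x
  proof -
    have "r * \<psi> \<one> x \<le> \<phi> \<one> x + C" using rough[OF that] by linarith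
    then show ?thesis using r by (simp add: field_simps)
  qed
  then have "slen \<psi> g \<le> (1 / r) * slen \<phi> g" by (rule slen_le[OF \<psi> \<phi> g])
  then show "r * slen \<psi> g \<le> slen \<phi> g" using r by (simp add: field_simps)
qed

lemma Hpp_H: "\<psi> \<in> potentials_Hpp G \<Longrightarrow> \<psi> \<in> potentials_H G"
  by (simp add: potentials_Hpp_def)

lemma slen_pos:
  assumes \<psi>: "\<psi> \<in> potentials_Hpp G" and g: "g \<in> nontrivial"
  shows "0 < slen \<psi> g"
proof (rule ccontr)
  assume neg: "\<not> 0 < slen \<psi> g"
  have g': "g \<in> carrier G" "g \<noteq> \<one>" using g by auto
  obtain M B where M: "0 < M" "\<And>x. x \<in> carrier G \<Longrightarrow> len x \<le> M * \<psi> \<one> x + B"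
    using proper_potential_lower_bound[OF \<psi>] by blast
  obtain C where C: "\<And>k::nat. \<bar>\<psi> \<one> (g [^] k) - real k * slen \<psi> g\<bar> \<le> C"
    using slen_bounded[OF Hpp_H[OF \<psi>] g] by blast
  obtain L where L: "0 < L" "\<And>m :: nat. real m \<le> L * len (g [^] m) + L"
    using powers_quasi_geodesic[OF g'] by metis
  have "real k \<le> L * (M * C + B) + L" for k :: nat
  proof -
    have "real k * slen \<psi> g \<le> 0" using neg by (simp add: mult_nonneg_nonpos)
    then have "\<psi> \<one> (g [^] k) \<le> C" using C[of k] by linarith
    then have "M * \<psi> \<one> (g [^] k) \<le> M * C" using M(1) by simp
    then have "len (g [^] k) \<le> M * C + B" using M(2)[of "g [^] k"] g' by simp
    then have "L * len (g [^] k) \<le> L * (M * C + B)" using L(1) by simp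
    then show ?thesis using L(2)[of k] by linarith
  qed
  then show False using reals_Archimedean2 linorder_not_le by blast
qed

lemma stable_length_eq:
  assumes \<psi>: "\<psi> \<in> potentials_H G" and g: "g \<in> nontrivial"
  shows "stable_length G \<psi> (conj_class G g) = slen \<psi> g"
proof -
  have gc: "g \<in> carrier G" using g by auto
  obtain M where M: "0 < M"
    "\<And>x y. \<lbrakk>x \<in> carrier G; y \<in> carrier G\<rbrakk> \<Longrightarrow> \<bar>\<psi> \<one> (x \<otimes> y) - \<psi> \<one> x\<bar> \<le> M * len y + M"
    "\<And>x y. \<lbrakk>x \<in> carrier G; y \<in> carrier G\<rbrakk> \<Longrightarrow> \<bar>\<psi> \<one> (x \<otimes> y) - \<psi> \<one> y\<bar> \<le> M * len x + M"
    by (rule potential_lipschitz[OF \<psi>]) (rule that)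
  have all: "(\<lambda>k::nat. \<psi> \<one> (h [^] k) / real k) \<longlonglongrightarrow> slen \<psi> g" if h: "h \<in> conj_class G g" for h
  proof -
    obtain x where x: "x \<in> carrier G" "h = x \<otimes> g \<otimes> inv x" using h by (auto simp: conj_class_def)
    have hk: "h [^] k = x \<otimes> (g [^] k \<otimes> inv x)" for k :: nat
      using conj_pow[OF x(1) gc, of "int k"] x gc by (simp add: int_pow_int m_assoc)
    define D where "D k = \<psi> \<one> (h [^] k) - \<psi> \<one> (g [^] k)" for k :: nat
    have D: "\<bar>D k\<bar> \<le> 2 * (M * len x + M)" for k
      using M(2)[of "g [^] k" "inv x"] M(3)[of x "g [^] k \<otimes> inv x"] x gc unfolding D_def hk by simp
    have "(\<lambda>k. D k / real k) \<longlonglongrightarrow> 0"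
    proof (rule Lim_null_comparison)
      show "(\<lambda>k. (2 * (M * len x + M)) / real k) \<longlonglongrightarrow> 0" by (rule lim_const_over_n)
      show "\<forall>\<^sub>F k in sequentially. norm (D k / real k) \<le> (2 * (M * len x + M)) / real k"
        using D by (intro always_eventually allI) (simp add: divide_right_mono)
    qed
    then have "(\<lambda>k. \<psi> \<one> (g [^] k) / real k + D k / real k) \<longlonglongrightarrow> slen \<psi> g + 0"
      by (intro tendsto_add slen_lim \<psi> g)
    then show ?thesis by (simp add: D_def add_divide_distrib[symmetric])
  qed
  have self: "g \<in> conj_class G g"
    unfolding conj_class_def using gc by (intro CollectI exI[of _ \<one>]) simp
  show ?thesis unfolding stable_length_def
  proof (rule the_equality)
    show "\<forall>h\<in>conj_class G g. (\<lambda>k::nat. \<psi> \<one> (h [^] k) / real k) \<longlonglongrightarrow> slen \<psi> g" using all by blast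
    fix l assume "\<forall>h\<in>conj_class G g. (\<lambda>k::nat. \<psi> \<one> (h [^] k) / real k) \<longlonglongrightarrow> l"
    then show "l = slen \<psi> g" using self all LIMSEQ_unique by blast
  qed
qed

lemma nontorsion_iff: "g \<in> carrier G \<Longrightarrow> \<not> torsion_elem G g \<longleftrightarrow> g \<noteq> \<one>"
  using torsion_free unfolding torsion_free_def torsion_elem_def
  by (metis nat_pow_one zero_less_one)

lemma Dil_eq:
  assumes "\<phi> \<in> potentials_H G" "\<psi> \<in> potentials_H G"
  shows "Dil G \<phi> \<psi> = (SUP g\<in>nontrivial. slen \<phi> g / slen \<psi> g)"
proof -
  have "nontorsion_classes G = conj_class G ` nontrivial"
    using nontorsion_iff by (auto simp: nontorsion_classes_def)
  then have "Dil G \<phi> \<psi> = (SUP g\<in>nontrivial. stable_length G \<phi> (conj_class G g) / stable_length G \<psi> (conj_class G g))"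
    by (simp add: Dil_def image_image)
  also have "\<dots> = (SUP g\<in>nontrivial. slen \<phi> g / slen \<psi> g)"
    by (intro SUP_cong HOL.refl) (simp only: stable_length_eq[OF assms(1)] stable_length_eq[OF assms(2)])
  finally show ?thesis .
qed

lemma nontrivial_nonempty: "nontrivial \<noteq> {}"
  using ex_nontrivial by blast

text \<open>
  Potentials are at most linear in the word length and proper ones at least linear, so the supremum
  that defines the dilation is finite.
\<close>

lemma Dil_upper:
  assumes \<phi>: "\<phi> \<in> potentials_Hpp G" and \<psi>: "\<psi> \<in> potentials_Hpp G" and g: "g \<in> nontrivial"
  shows "slen \<phi> g \<le> Dil G \<phi> \<psi> * slen \<psi> g"
proof -
  obtain M where M: "0 < M" "\<And>x. x \<in> carrier G \<Longrightarrow> \<bar>\<phi> \<one> x\<bar> \<le> M * len x + M"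
    by (rule potential_lipschitz[OF Hpp_H[OF \<phi>]]) (rule that)
  obtain N B where N: "0 < N" "\<And>x. x \<in> carrier G \<Longrightarrow> len x \<le> N * \<psi> \<one> x + B"
    using proper_potential_lower_bound[OF \<psi>] by blast
  have "\<phi> \<one> x \<le> (M * N) * \<psi> \<one> x + (M * B + M)" if x: "x \<in> carrier G" for x
  proof -
    have "M * len x \<le> M * (N * \<psi> \<one> x + B)" using N(2)[OF x] M(1) by simp
    then show ?thesis using M(2)[OF x] by (simp add: algebra_simps)
  qed
  then have "slen \<phi> h \<le> (M * N) * slen \<psi> h" if "h \<in> nontrivial" for h
    using slen_le[OF Hpp_H[OF \<phi>] Hpp_H[OF \<psi>] that] by blast
  then have "slen \<phi> h / slen \<psi> h \<le> M * N" if "h \<in> nontrivial" for h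
    using slen_pos[OF \<psi> that] that by (simp add: pos_divide_le_eq)
  then have "bdd_above ((\<lambda>h. slen \<phi> h / slen \<psi> h) ` nontrivial)" by (intro bdd_aboveI2) auto
  then have "slen \<phi> g / slen \<psi> g \<le> Dil G \<phi> \<psi>"
    unfolding Dil_eq[OF Hpp_H[OF \<phi>] Hpp_H[OF \<psi>]] using g by (intro cSUP_upper)
  then show ?thesis using slen_pos[OF \<psi> g] by (simp add: pos_divide_le_eq)
qed

lemma Dil_least:
  assumes \<phi>: "\<phi> \<in> potentials_Hpp G" and \<psi>: "\<psi> \<in> potentials_Hpp G"
    and le: "\<And>g. g \<in> nontrivial \<Longrightarrow> slen \<phi> g \<le> r * slen \<psi> g"
  shows "Dil G \<phi> \<psi> \<le> r"
  unfolding Dil_eq[OF Hpp_H[OF \<phi>] Hpp_H[OF \<psi>]]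
  using nontrivial_nonempty le slen_pos[OF \<psi>] by (intro cSUP_least) (auto simp: pos_divide_le_eq)

lemma Dil_pos:
  assumes "\<phi> \<in> potentials_Hpp G" "\<psi> \<in> potentials_Hpp G"
  shows "0 < Dil G \<phi> \<psi>"
proof -
  obtain g where g: "g \<in> nontrivial" using nontrivial_nonempty by blast
  have "0 < Dil G \<phi> \<psi> * slen \<psi> g"
    using Dil_upper[OF assms g] slen_pos[OF assms(1) g] by linarith
  then show ?thesis using slen_pos[OF assms(2) g] by (simp add: zero_less_mult_iff)
qed

lemma Dil_scale:
  assumes "\<phi> \<in> potentials_Hpp G" "\<psi> \<in> potentials_Hpp G" "\<phi>' \<in> potentials_Hpp G" "\<psi>' \<in> potentials_Hpp G"
    and r: "0 < r" "0 < s" "\<And>g. g \<in> nontrivial \<Longrightarrow> slen \<phi> g = r * slen \<phi>' g"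
      "\<And>g. g \<in> nontrivial \<Longrightarrow> slen \<psi> g = s * slen \<psi>' g"
  shows "Dil G \<phi> \<psi> = r / s * Dil G \<phi>' \<psi>'"
proof (rule antisym)
  show "Dil G \<phi> \<psi> \<le> r / s * Dil G \<phi>' \<psi>'"
  proof (rule Dil_least[OF assms(1,2)])
    fix g assume g: "g \<in> nontrivial"
    have "r * slen \<phi>' g \<le> r * (Dil G \<phi>' \<psi>' * slen \<psi>' g)" using Dil_upper[OF assms(3,4) g] r(1) by simp
    then show "slen \<phi> g \<le> r / s * Dil G \<phi>' \<psi>' * slen \<psi> g" using r g by simp
  qed
  have "Dil G \<phi>' \<psi>' \<le> s / r * Dil G \<phi> \<psi>"
  proof (rule Dil_least[OF assms(3,4)])
    fix g assume g: "g \<in> nontrivial"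
    have "r * slen \<phi>' g \<le> Dil G \<phi> \<psi> * (s * slen \<psi>' g)" using Dil_upper[OF assms(1,2) g] r g by simp
    then show "slen \<phi>' g \<le> s / r * Dil G \<phi> \<psi> * slen \<psi>' g" using r(1) by (simp add: field_simps)
  qed
  then show "r / s * Dil G \<phi>' \<psi>' \<le> Dil G \<phi> \<psi>" using r(1,2) by (simp add: field_simps)
qed

definition logdil :: "('a \<Rightarrow> 'a \<Rightarrow> real) \<Rightarrow> ('a \<Rightarrow> 'a \<Rightarrow> real) \<Rightarrow> real" where
  "logdil \<phi> \<psi> = ln (Dil G \<phi> \<psi> * Dil G \<psi> \<phi>)"

lemma rough_similarity_iff:
  "(\<phi>, \<psi>) \<in> rough_similarity G \<longleftrightarrow> \<phi> \<in> potentials_Hpp G \<and> \<psi> \<in> potentials_Hpp G \<and>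
     (\<exists>c>0. \<exists>M. \<forall>g\<in>carrier G. \<bar>\<phi> \<one> g - c * \<psi> \<one> g\<bar> \<le> M)"
  by (simp add: rough_similarity_def bdd_above_def)

lemma rough_similarity_slen:
  assumes "(\<phi>, \<psi>) \<in> rough_similarity G"
  obtains c where "0 < c" "\<And>g. g \<in> nontrivial \<Longrightarrow> slen \<phi> g = c * slen \<psi> g"
proof -
  obtain c M where "0 < c" "\<And>g. g \<in> carrier G \<Longrightarrow> \<bar>\<phi> \<one> g - c * \<psi> \<one> g\<bar> \<le> M"
    and "\<phi> \<in> potentials_Hpp G" "\<psi> \<in> potentials_Hpp G"
    using assms unfolding rough_similarity_iff by blast
  then show ?thesis using that[of c] slen_rough Hpp_H by metis
qed

lemma equiv_rough_similarity: "equiv (potentials_Hpp G) (rough_similarity G)"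
proof (rule equivI)
  show "rough_similarity G \<subseteq> potentials_Hpp G \<times> potentials_Hpp G"
    by (auto simp: rough_similarity_iff)
  show "refl_on (potentials_Hpp G) (rough_similarity G)"
  proof (rule refl_onI)
    fix \<psi> assume "\<psi> \<in> potentials_Hpp G"
    then show "(\<psi>, \<psi>) \<in> rough_similarity G" unfolding rough_similarity_iff
      by (intro conjI exI[of _ 1] exI[of _ 0]) auto
  qed
  show "sym (rough_similarity G)"
  proof (rule symI)
    fix \<phi> \<psi> assume "(\<phi>, \<psi>) \<in> rough_similarity G"
    then obtain c M where h: "\<phi> \<in> potentials_Hpp G" "\<psi> \<in> potentials_Hpp G" "0 < c"
      "\<And>g. g \<in> carrier G \<Longrightarrow> \<bar>\<phi> \<one> g - c * \<psi> \<one> g\<bar> \<le> M" unfolding rough_similarity_iff by blast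
    have "\<bar>\<psi> \<one> g - 1 / c * \<phi> \<one> g\<bar> \<le> M / c" if g: "g \<in> carrier G" for g
    proof -
      have "\<psi> \<one> g - 1 / c * \<phi> \<one> g = - ((\<phi> \<one> g - c * \<psi> \<one> g) / c)" using h(3) by (simp add: field_simps)
      then have "\<bar>\<psi> \<one> g - 1 / c * \<phi> \<one> g\<bar> = \<bar>\<phi> \<one> g - c * \<psi> \<one> g\<bar> / c" using h(3) by (simp add: abs_divide)
      then show ?thesis using h(4)[OF g] h(3) by (simp add: divide_right_mono)
    qed
    then show "(\<psi>, \<phi>) \<in> rough_similarity G" unfolding rough_similarity_iff using h
      by (intro conjI exI[of _ "1 / c"] exI[of _ "M / c"]) auto
  qed
  show "trans (rough_similarity G)"
  proof (rule transI)
    fix \<phi> \<psi> \<theta> assume "(\<phi>, \<psi>) \<in> rough_similarity G" "(\<psi>, \<theta>) \<in> rough_similarity G"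
    then obtain c M c' M' where h: "\<phi> \<in> potentials_Hpp G" "\<theta> \<in> potentials_Hpp G" "0 < c" "0 < c'"
      "\<And>g. g \<in> carrier G \<Longrightarrow> \<bar>\<phi> \<one> g - c * \<psi> \<one> g\<bar> \<le> M"
      "\<And>g. g \<in> carrier G \<Longrightarrow> \<bar>\<psi> \<one> g - c' * \<theta> \<one> g\<bar> \<le> M'" unfolding rough_similarity_iff by blast
    have "\<bar>\<phi> \<one> g - c * c' * \<theta> \<one> g\<bar> \<le> M + c * M'" if g: "g \<in> carrier G" for g
    proof -
      have "\<phi> \<one> g - c * c' * \<theta> \<one> g = (\<phi> \<one> g - c * \<psi> \<one> g) + c * (\<psi> \<one> g - c' * \<theta> \<one> g)"
        by (simp add: algebra_simps)
      moreover have "\<bar>c * (\<psi> \<one> g - c' * \<theta> \<one> g)\<bar> \<le> c * M'" using h(3) h(6)[OF g] by (simp add: abs_mult)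
      ultimately show ?thesis using h(5)[OF g] by linarith
    qed
    then show "(\<phi>, \<theta>) \<in> rough_similarity G" unfolding rough_similarity_iff using h
      by (intro conjI exI[of _ "c * c'"] exI[of _ "M + c * M'"]) auto
  qed
qed

abbreviation rclass :: "('a \<Rightarrow> 'a \<Rightarrow> real) \<Rightarrow> ('a \<Rightarrow> 'a \<Rightarrow> real) set" where
  "rclass \<psi> \<equiv> rough_similarity G `` {\<psi>}"

lemma rclass_in: "\<psi> \<in> potentials_Hpp G \<Longrightarrow> rclass \<psi> \<in> space_Hpp G"
  unfolding space_Hpp_def by (rule quotientI)

lemma space_rclass:
  assumes "A \<in> space_Hpp G"
  obtains \<psi> where "\<psi> \<in> potentials_Hpp G" "A = rclass \<psi>"
  using assms unfolding space_Hpp_def by (rule quotientE)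

lemma logdil_cong:
  assumes "(\<phi>, \<phi>') \<in> rough_similarity G" "(\<psi>, \<psi>') \<in> rough_similarity G"
  shows "logdil \<phi> \<psi> = logdil \<phi>' \<psi>'"
proof -
  have H: "\<phi> \<in> potentials_Hpp G" "\<psi> \<in> potentials_Hpp G" "\<phi>' \<in> potentials_Hpp G" "\<psi>' \<in> potentials_Hpp G"
    using assms unfolding rough_similarity_iff by auto
  obtain r where r: "0 < r" "\<And>g. g \<in> nontrivial \<Longrightarrow> slen \<phi> g = r * slen \<phi>' g"
    using rough_similarity_slen[OF assms(1)] by blast
  obtain s where s: "0 < s" "\<And>g. g \<in> nontrivial \<Longrightarrow> slen \<psi> g = s * slen \<psi>' g"
    using rough_similarity_slen[OF assms(2)] by blast
  have "Dil G \<phi> \<psi> = r / s * Dil G \<phi>' \<psi>'" by (rule Dil_scale[OF H r(1) s(1) r(2) s(2)])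
  moreover have "Dil G \<psi> \<phi> = s / r * Dil G \<psi>' \<phi>'"
    by (rule Dil_scale[OF H(2,1,4,3) s(1) r(1) s(2) r(2)])
  ultimately show ?thesis using r(1) s(1) by (simp add: logdil_def)
qed

lemma Delta_rclass:
  assumes "\<phi> \<in> potentials_Hpp G" "\<psi> \<in> potentials_Hpp G"
  shows "Delta_dist G (rclass \<phi>) (rclass \<psi>) = logdil \<phi> \<psi>"
proof -
  have self: "\<phi> \<in> rclass \<phi>" "\<psi> \<in> rclass \<psi>"
    by (rule equiv_class_self[OF equiv_rough_similarity], rule assms)+
  have "(THE r. \<forall>f\<in>rclass \<phi>. \<forall>g\<in>rclass \<psi>. r = ln (Dil G f g * Dil G g f)) = logdil \<phi> \<psi>"
  proof (rule the_equality)
    show "\<forall>f\<in>rclass \<phi>. \<forall>g\<in>rclass \<psi>. logdil \<phi> \<psi> = ln (Dil G f g * Dil G g f)"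
      using logdil_cong unfolding logdil_def by blast
    fix r assume "\<forall>f\<in>rclass \<phi>. \<forall>g\<in>rclass \<psi>. r = ln (Dil G f g * Dil G g f)"
    then show "r = logdil \<phi> \<psi>" using self unfolding logdil_def by blast
  qed
  then show ?thesis using rclass_in assms by (simp add: Delta_dist_def)
qed

lemma Dil_mult_ge_1:
  assumes "\<phi> \<in> potentials_Hpp G" "\<psi> \<in> potentials_Hpp G"
  shows "1 \<le> Dil G \<phi> \<psi> * Dil G \<psi> \<phi>"
proof -
  obtain g where g: "g \<in> nontrivial" using nontrivial_nonempty by blast
  have "slen \<phi> g \<le> Dil G \<phi> \<psi> * slen \<psi> g" by (rule Dil_upper[OF assms g])
  also have "\<dots> \<le> Dil G \<phi> \<psi> * (Dil G \<psi> \<phi> * slen \<phi> g)"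
    using Dil_upper[OF assms(2,1) g] Dil_pos[OF assms] by simp
  finally have "1 * slen \<phi> g \<le> (Dil G \<phi> \<psi> * Dil G \<psi> \<phi>) * slen \<phi> g" by (simp add: mult.assoc)
  then show ?thesis using slen_pos[OF assms(1) g] by (simp only: mult_le_cancel_right_pos)
qed

lemma Dil_mult_triangle:
  assumes "\<phi> \<in> potentials_Hpp G" "\<psi> \<in> potentials_Hpp G" "\<theta> \<in> potentials_Hpp G"
  shows "Dil G \<phi> \<theta> \<le> Dil G \<phi> \<psi> * Dil G \<psi> \<theta>"
proof (rule Dil_least[OF assms(1,3)])
  fix g assume g: "g \<in> nontrivial"
  have "slen \<phi> g \<le> Dil G \<phi> \<psi> * slen \<psi> g" by (rule Dil_upper[OF assms(1,2) g])
  also have "\<dots> \<le> Dil G \<phi> \<psi> * (Dil G \<psi> \<theta> * slen \<theta> g)"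
    using Dil_upper[OF assms(2,3) g] Dil_pos[OF assms(1,2)] by simp
  finally show "slen \<phi> g \<le> Dil G \<phi> \<psi> * Dil G \<psi> \<theta> * slen \<theta> g" by (simp add: mult.assoc)
qed

lemma logdil_triangle:
  assumes H: "\<phi> \<in> potentials_Hpp G" "\<psi> \<in> potentials_Hpp G" "\<theta> \<in> potentials_Hpp G"
  shows "logdil \<phi> \<theta> \<le> logdil \<phi> \<psi> + logdil \<psi> \<theta>"
proof -
  note pos = Dil_pos[OF H(1,2)] Dil_pos[OF H(2,1)] Dil_pos[OF H(2,3)] Dil_pos[OF H(3,2)]
    Dil_pos[OF H(1,3)] Dil_pos[OF H(3,1)]
  have "Dil G \<phi> \<theta> * Dil G \<theta> \<phi> \<le> (Dil G \<phi> \<psi> * Dil G \<psi> \<theta>) * (Dil G \<theta> \<psi> * Dil G \<psi> \<phi>)"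
    using Dil_mult_triangle[OF H] Dil_mult_triangle[OF H(3,2,1)] pos by (intro mult_mono) auto
  also have "\<dots> = (Dil G \<phi> \<psi> * Dil G \<psi> \<phi>) * (Dil G \<psi> \<theta> * Dil G \<theta> \<psi>)" by (simp add: mult_ac)
  finally have "logdil \<phi> \<theta> \<le> ln ((Dil G \<phi> \<psi> * Dil G \<psi> \<phi>) * (Dil G \<psi> \<theta> * Dil G \<theta> \<psi>))"
    unfolding logdil_def using pos by (subst ln_le_cancel_iff) (auto intro!: mult_pos_pos)
  then show ?thesis unfolding logdil_def using pos by (simp add: ln_mult)
qed

lemma straight_closing_potential:
  assumes \<psi>: "\<psi> \<in> potentials_H G" and M: "0 \<le> M"
  obtains E where "\<And>g h. \<lbrakk>g \<in> carrier G; h \<in> carrier G; len (inv g \<otimes> h) \<le> M;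
      \<And>(j::nat) (k::nat). gp (inv (h [^] j)) (h [^] k) \<one> \<le> M\<rbrakk> \<Longrightarrow> \<bar>\<psi> \<one> g - slen \<psi> h\<bar> \<le> E"
proof -
  obtain K where "0 < K" and K: "\<And>g c k. \<lbrakk>g \<in> carrier G; \<And>(i::nat) (j::nat). gp (inv (g [^] i)) (g [^] j) \<one> \<le> c\<rbrakk> \<Longrightarrow>
    (\<lambda>k::nat. \<psi> \<one> (g [^] k) / real k) \<longlonglongrightarrow> slen \<psi> g \<and> \<bar>\<psi> \<one> (g [^] (k::nat)) - real k * slen \<psi> g\<bar> \<le> K * c + K"
    by (rule slen_straight[OF \<psi>]) (rule that; blast)
  obtain P where P: "0 < P" 
    "\<And>x y. \<lbrakk>x \<in> carrier G; y \<in> carrier G\<rbrakk> \<Longrightarrow> \<bar>\<psi> \<one> (x \<otimes> y) - \<psi> \<one> x\<bar> \<le> P * len y + P"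
    by (rule potential_lipschitz[OF \<psi>]) (rule that)
  show ?thesis
  proof (rule that[of "(K * M + K) + (P * M + P)"])
    fix g h assume gh: "g \<in> carrier G" "h \<in> carrier G" "len (inv g \<otimes> h) \<le> M"
      "\<And>(j::nat) (k::nat). gp (inv (h [^] j)) (h [^] k) \<one> \<le> M"
    have "\<bar>\<psi> \<one> (h [^] (1::nat)) - real 1 * slen \<psi> h\<bar> \<le> K * M + K" using K[OF gh(2,4)] by blast
    then have "\<bar>\<psi> \<one> h - slen \<psi> h\<bar> \<le> K * M + K" using gh(2) by simp
    moreover have "\<bar>\<psi> \<one> h - \<psi> \<one> g\<bar> \<le> P * len (inv g \<otimes> h) + P"
      using P(2)[of g "inv g \<otimes> h"] gh(1,2) by (simp add: mult_inv_cancel)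
    moreover have "P * len (inv g \<otimes> h) \<le> P * M" using gh(3) P(1) by simp
    ultimately show "\<bar>\<psi> \<one> g - slen \<psi> h\<bar> \<le> (K * M + K) + (P * M + P)" by linarith
  qed
qed

text \<open>
  Marked length spectrum rigidity: up to a bounded error, the value of a potential at a long \<open>g\<close> is
  the stable length of a cyclically straight element near \<open>g\<close>, which depends on \<open>g\<close> only.
\<close>

lemma rigidity:
  assumes \<phi>: "\<phi> \<in> potentials_Hpp G" and \<psi>: "\<psi> \<in> potentials_Hpp G" and c: "0 < c"
    and eq: "\<And>g. g \<in> nontrivial \<Longrightarrow> slen \<phi> g = c * slen \<psi> g"
  shows "(\<phi>, \<psi>) \<in> rough_similarity G"
proof -
  obtain M where M: "0 \<le> M" "\<And>g. \<lbrakk>g \<in> carrier G; M \<le> len g\<rbrakk> \<Longrightarrow>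
    \<exists>h\<in>carrier G. h \<noteq> \<one> \<and> len (inv g \<otimes> h) \<le> M \<and>
      (\<forall>(j::nat) (k::nat). gp (inv (h [^] j)) (h [^] k) \<one> \<le> M)" using straight_closing by blast
  obtain E where E: "\<And>g h. \<lbrakk>g \<in> carrier G; h \<in> carrier G; len (inv g \<otimes> h) \<le> M;
      \<And>(j::nat) (k::nat). gp (inv (h [^] j)) (h [^] k) \<one> \<le> M\<rbrakk> \<Longrightarrow> \<bar>\<phi> \<one> g - slen \<phi> h\<bar> \<le> E"
    by (rule straight_closing_potential[OF Hpp_H[OF \<phi>] M(1)]) (rule that; blast)
  obtain F where F: "\<And>g h. \<lbrakk>g \<in> carrier G; h \<in> carrier G; len (inv g \<otimes> h) \<le> M;
      \<And>(j::nat) (k::nat). gp (inv (h [^] j)) (h [^] k) \<one> \<le> M\<rbrakk> \<Longrightarrow> \<bar>\<psi> \<one> g - slen \<psi> h\<bar> \<le> F"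
    by (rule straight_closing_potential[OF Hpp_H[OF \<psi>] M(1)]) (rule that; blast)
  obtain P where P: "0 < P" "\<And>x. x \<in> carrier G \<Longrightarrow> \<bar>\<phi> \<one> x\<bar> \<le> P * len x + P"
    by (rule potential_lipschitz[OF Hpp_H[OF \<phi>]]) (rule that)
  obtain Q where Q: "0 < Q" "\<And>x. x \<in> carrier G \<Longrightarrow> \<bar>\<psi> \<one> x\<bar> \<le> Q * len x + Q"
    by (rule potential_lipschitz[OF Hpp_H[OF \<psi>]]) (rule that)
  have "\<bar>\<phi> \<one> g - c * \<psi> \<one> g\<bar> \<le> max (E + c * F) ((P * M + P) + c * (Q * M + Q))"
    if g: "g \<in> carrier G" for g
  proof (cases "M \<le> len g")
    case True
    then obtain h where h: "h \<in> carrier G" "h \<noteq> \<one>" "len (inv g \<otimes> h) \<le> M"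
      "\<And>(j::nat) (k::nat). gp (inv (h [^] j)) (h [^] k) \<one> \<le> M" using M(2)[OF g] by blast
    have "\<bar>\<phi> \<one> g - slen \<phi> h\<bar> \<le> E" "\<bar>\<psi> \<one> g - slen \<psi> h\<bar> \<le> F"
      using E[OF g h(1,3,4)] F[OF g h(1,3,4)] by auto
    moreover have "slen \<phi> h = c * slen \<psi> h" using h by (intro eq) auto
    moreover have "\<bar>c * \<psi> \<one> g - c * slen \<psi> h\<bar> \<le> c * F"
      using calculation(2) c by (simp add: right_diff_distrib[symmetric] abs_mult)
    ultimately show ?thesis by linarith
  next
    case False
    then have "P * len g \<le> P * M" "Q * len g \<le> Q * M" using P(1) Q(1) by simp_all
    then have "\<bar>\<phi> \<one> g\<bar> \<le> P * M + P" "\<bar>\<psi> \<one> g\<bar> \<le> Q * M + Q" using P(2)[OF g] Q(2)[OF g] by simp_all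
    moreover have "\<bar>c * \<psi> \<one> g\<bar> \<le> c * (Q * M + Q)" using calculation(2) c by (simp add: abs_mult)
    ultimately show ?thesis by linarith
  qed
  then show ?thesis unfolding rough_similarity_iff using \<phi> \<psi> c by blast
qed

lemma logdil_zero_iff:
  assumes H: "\<phi> \<in> potentials_Hpp G" "\<psi> \<in> potentials_Hpp G"
  shows "logdil \<phi> \<psi> = 0 \<longleftrightarrow> (\<phi>, \<psi>) \<in> rough_similarity G"
proof
  let ?r = "Dil G \<phi> \<psi>" and ?s = "Dil G \<psi> \<phi>"
  note pos = Dil_pos[OF H] Dil_pos[OF H(2,1)]
  assume "logdil \<phi> \<psi> = 0"
  then have rs: "?r * ?s = 1" using pos by (simp add: logdil_def)
  show "(\<phi>, \<psi>) \<in> rough_similarity G"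
  proof (rule rigidity[OF H pos(1)], rule antisym)
    fix g assume g: "g \<in> nontrivial"
    show "slen \<phi> g \<le> ?r * slen \<psi> g" by (rule Dil_upper[OF H g])
    have "?r * slen \<psi> g \<le> ?r * (?s * slen \<phi> g)" using Dil_upper[OF H(2,1) g] pos(1) by simp
    also have "\<dots> = slen \<phi> g" using rs by (simp add: mult.assoc[symmetric])
    finally show "?r * slen \<psi> g \<le> slen \<phi> g" .
  qed
next
  assume rel: "(\<phi>, \<psi>) \<in> rough_similarity G"
  have "(\<psi>, \<psi>) \<in> rough_similarity G" using equiv_class_self[OF equiv_rough_similarity H(2)] by simp
  then have "logdil \<phi> \<psi> = logdil \<psi> \<psi>" by (rule logdil_cong[OF rel])
  moreover have "Dil G \<psi> \<psi> \<le> 1" by (rule Dil_least[OF H(2) H(2)]) simp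
  then have "Dil G \<psi> \<psi> * Dil G \<psi> \<psi> \<le> 1 * 1" using Dil_pos[OF H(2) H(2)] by (intro mult_mono) auto
  then have "Dil G \<psi> \<psi> * Dil G \<psi> \<psi> = 1" using Dil_mult_ge_1[OF H(2) H(2)] by simp
  ultimately show "logdil \<phi> \<psi> = 0" by (simp add: logdil_def)
qed

lemma Metric_space_Hpp: "Metric_space (space_Hpp G) (Delta_dist G)"
proof
  fix A B C
  have off: "Delta_dist G A B = 0" if "\<not> (A \<in> space_Hpp G \<and> B \<in> space_Hpp G)" for A B
    unfolding Delta_dist_def using that by (rule if_not_P)
  show "0 \<le> Delta_dist G A B"
  proof (cases "A \<in> space_Hpp G \<and> B \<in> space_Hpp G")
    case True
    then obtain \<phi> \<psi> where H: "\<phi> \<in> potentials_Hpp G" "A = rclass \<phi>" "\<psi> \<in> potentials_Hpp G" "B = rclass \<psi>"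
      using space_rclass by metis
    then show ?thesis using Dil_mult_ge_1[OF H(1,3)] by (simp add: Delta_rclass logdil_def)
  qed (simp add: off)
  show "Delta_dist G A B = Delta_dist G B A"
  proof (cases "A \<in> space_Hpp G \<and> B \<in> space_Hpp G")
    case True
    then obtain \<phi> \<psi> where H: "\<phi> \<in> potentials_Hpp G" "A = rclass \<phi>" "\<psi> \<in> potentials_Hpp G" "B = rclass \<psi>"
      using space_rclass by metis
    then show ?thesis by (simp add: Delta_rclass logdil_def mult.commute)
  next
    case False
    then show ?thesis using off[of A B] off[of B A] by auto
  qed
  assume A: "A \<in> space_Hpp G" and B: "B \<in> space_Hpp G"
  obtain \<phi> where \<phi>: "\<phi> \<in> potentials_Hpp G" "A = rclass \<phi>" by (rule space_rclass[OF A])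
  obtain \<psi> where \<psi>: "\<psi> \<in> potentials_Hpp G" "B = rclass \<psi>" by (rule space_rclass[OF B])
  show "Delta_dist G A B = 0 \<longleftrightarrow> A = B"
    using \<phi> \<psi> logdil_zero_iff[OF \<phi>(1) \<psi>(1)] eq_equiv_class_iff[OF equiv_rough_similarity \<phi>(1) \<psi>(1)]
    by (simp add: Delta_rclass)
  assume C: "C \<in> space_Hpp G"
  obtain \<theta> where \<theta>: "\<theta> \<in> potentials_Hpp G" "C = rclass \<theta>" by (rule space_rclass[OF C])
  show "Delta_dist G A C \<le> Delta_dist G A B + Delta_dist G B C"
    using \<phi> \<psi> \<theta> logdil_triangle by (simp add: Delta_rclass)
qed

end

section \<open>A Cauchy sequence without limit\<close>

context nonelementary_hyperbolic_group
begin

text \<open>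
  The letter \<open>g\<^sub>i\<close> saves \<open>i\<close>. Its inverse is not made a shortcut: the weighted metric is then not
  symmetric, and only one orientation has to be compared with the axis of \<open>a\<close>.
\<close>

definition shortcuts :: "(nat \<Rightarrow> 'a) \<Rightarrow> nat \<Rightarrow> ('a \<times> real) set" where
  "shortcuts g n = (\<lambda>s. (s, 1)) ` S \<union> (\<lambda>i. (g i, len (g i) - real i)) ` {..n}"

lemma len_gen: "s \<in> S \<Longrightarrow> len s \<le> 1"
  using word_length_le[of "[s]"] S_carrier by simp

context
  fixes g :: "nat \<Rightarrow> 'a"
  assumes g: "\<And>i. g i \<in> carrier G" and g_long: "\<And>i. real i * (real i + 1) + 1 \<le> len (g i)"
begin

text \<open>
  The quadratic growth of \<open>|g\<^sub>i|\<close> makes the saving at most \<open>1 / i\<close> of the weight that remains.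
\<close>

lemma saving_small: "1 \<le> len (g i) - real i" "len (g i) \<le> 2 * (len (g i) - real i)"
  and saving_relative: "n < i \<Longrightarrow> len (g i) \<le> (1 + 1 / (real n + 1)) * (len (g i) - real i)"
proof -
  have sq: "real i * real i + real i + 1 \<le> len (g i)" using g_long[of i] by (simp add: distrib_left)
  have "real i \<le> real i * real i" by (cases i) auto
  then have "2 * real i + 1 \<le> len (g i)" using sq by linarith
  then show "1 \<le> len (g i) - real i" "len (g i) \<le> 2 * (len (g i) - real i)" by simp_all
  assume n: "n < i"
  then have "(real n + 1) * real i \<le> real i * real i" by (intro mult_right_mono) auto
  then have "(real n + 1) * real i \<le> len (g i) - real i" using sq by linarith
  then have "real i \<le> (len (g i) - real i) / (real n + 1)" by (simp add: field_simps)
  then show "len (g i) \<le> (1 + 1 / (real n + 1)) * (len (g i) - real i)" by (simp add: distrib_right)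
qed

lemma shortcuts_admissible: "admissible (shortcuts g n)"
  unfolding admissible_def shortcuts_def using S_finite S_carrier len_gen g saving_small
  by (auto intro: order.trans[OF len_gen])

lemma shortcuts_decrease:
  assumes "n \<le> m" "x \<in> carrier G"
  shows "wlen (shortcuts g m) x \<le> wlen (shortcuts g n) x"
proof (rule wlen_greatest[OF shortcuts_admissible assms(2)])
  fix ws assume "set ws \<subseteq> shortcuts g n" "word_prod (map fst ws) = x"
  moreover have "shortcuts g n \<subseteq> shortcuts g m" using assms(1) by (auto simp: shortcuts_def)
  ultimately show "wlen (shortcuts g m) x \<le> sum_list (map snd ws)"
    by (intro wlen_le[OF shortcuts_admissible]) auto
qed

text \<open>
  A shortcut that is missing at stage \<open>n\<close> costs at most the factor \<open>1 + 1 / (n + 1)\<close>, since it is one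
  of the \<open>g\<^sub>i\<close> with \<open>i > n\<close>.
\<close>

lemma shortcuts_decrease_little:
  assumes x: "x \<in> carrier G"
  shows "wlen (shortcuts g n) x \<le> (1 + 1 / (real n + 1)) * wlen (shortcuts g m) x"
proof -
  let ?q = "1 + 1 / (real n + 1)"
  have q: "1 \<le> ?q" by simp
  have "wlen (shortcuts g n) (inv \<one> \<otimes> (\<one> \<otimes> x)) / ?q \<le> wlen (shortcuts g m) x"
  proof (rule wlen_dominates[OF shortcuts_admissible, where \<Phi> = "\<lambda>x y. wlen (shortcuts g n) (inv x \<otimes> y) / ?q"])
    fix x y z assume xyz: "x \<in> carrier G" "y \<in> carrier G" "z \<in> carrier G"
    have "wlen (shortcuts g n) (inv x \<otimes> z) \<le> wlen (shortcuts g n) (inv x \<otimes> y) + wlen (shortcuts g n) (inv y \<otimes> z)"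
      using wlen_mult[OF shortcuts_admissible, of "inv x \<otimes> y" "inv y \<otimes> z" n] inv_trans[OF xyz] xyz by simp
    then have "wlen (shortcuts g n) (inv x \<otimes> z) / ?q
        \<le> (wlen (shortcuts g n) (inv x \<otimes> y) + wlen (shortcuts g n) (inv y \<otimes> z)) / ?q"
      using q by (intro divide_right_mono) linarith+
    then show "wlen (shortcuts g n) (inv x \<otimes> z) / ?q
        \<le> wlen (shortcuts g n) (inv x \<otimes> y) / ?q + wlen (shortcuts g n) (inv y \<otimes> z) / ?q"
      by (simp only: add_divide_distrib)
  next
    fix x assume "x \<in> carrier G"
    then show "wlen (shortcuts g n) (inv x \<otimes> x) / ?q \<le> 0"
      using wlen_le_len[OF shortcuts_admissible one_closed, of n] q
      by (simp add: divide_le_0_iff)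
  next
    fix x y r assume x: "x \<in> carrier G" and yr: "(y, r) \<in> shortcuts g m"
    have y: "y \<in> carrier G" and r1: "1 \<le> r" using yr shortcuts_admissible[of m] by (auto simp: admissible_def)
    have "wlen (shortcuts g n) y \<le> ?q * r"
    proof (cases "(y, r) \<in> shortcuts g n")
      case True
      then have "wlen (shortcuts g n) y \<le> 1 * r" using wlen_letter[OF shortcuts_admissible] by simp
      also have "\<dots> \<le> ?q * r" using q r1 by (intro mult_right_mono) auto
      finally show ?thesis .
    next
      case False
      then obtain i where i': "y = g i" "r = len (g i) - real i" using yr by (auto simp: shortcuts_def)
      then have "n < i" using False by (force simp: shortcuts_def)
      note i = this i'
      then show ?thesis
        using wlen_le_len[OF shortcuts_admissible y, of n] saving_relative[OF i(1)] by simp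
    qed
    then have "wlen (shortcuts g n) y / ?q \<le> r" using q by (subst pos_divide_le_eq) (linarith, simp only: mult.commute)
    then show "wlen (shortcuts g n) (inv x \<otimes> (x \<otimes> y)) / ?q \<le> r" using x y by (simp only: mult_inv_cancel)
  qed (use x in auto)
  then have "wlen (shortcuts g n) x / ?q \<le> wlen (shortcuts g m) x" using x by simp
  then show ?thesis using q by (subst (asm) pos_divide_le_eq) (linarith, simp only: mult.commute)
qed

abbreviation dn :: "nat \<Rightarrow> 'a \<Rightarrow> 'a \<Rightarrow> real" where
  "dn n \<equiv> wmetric (shortcuts g n)"

lemma dn_Hpp: "dn n \<in> potentials_Hpp G" and dn_H: "dn n \<in> potentials_H G"
  using wmetric_in_Hpp[OF shortcuts_admissible] Hpp_H by blast+

lemma slen_dn: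
  assumes h: "h \<in> nontrivial"
  shows "n \<le> m \<Longrightarrow> slen (dn m) h \<le> slen (dn n) h"
    and "slen (dn n) h \<le> (1 + 1 / (real n + 1)) * slen (dn m) h"
    and "slen (dn n) h \<le> wlen (shortcuts g n) h"
proof -
  show "slen (dn m) h \<le> slen (dn n) h" if nm: "n \<le> m"
    using slen_le[OF dn_H dn_H h, of m 1 n 0] shortcuts_decrease[OF nm] by (simp add: wmetric_one)
  show "slen (dn n) h \<le> (1 + 1 / (real n + 1)) * slen (dn m) h"
  proof (rule slen_le[OF dn_H dn_H h, where C = 0])
    fix x assume x: "x \<in> carrier G"
    show "dn n \<one> x \<le> (1 + 1 / (real n + 1)) * dn m \<one> x + 0"
      using shortcuts_decrease_little[OF x, of n m] x by (simp only: wmetric_one add_0_right)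
  qed
  have hc: "h \<in> carrier G" using h by simp
  have "wlen (shortcuts g n) (h [^] k) \<le> real k * wlen (shortcuts g n) h" for k :: nat
  proof (induction k)
    case 0
    then show ?case using wlen_le_len[OF shortcuts_admissible one_closed, of n] by simp
  next
    case (Suc k)
    then show ?case
      using wlen_mult[OF shortcuts_admissible, of "h [^] k" h n] hc by (simp add: algebra_simps)
  qed
  then have "dn n \<one> (h [^] k) / real k \<le> wlen (shortcuts g n) h" if "0 < k" for k :: nat
    using that hc by (simp add: wmetric_one pos_divide_le_eq mult.commute)
  then have "\<exists>N. \<forall>k\<ge>N. dn n \<one> (h [^] (k::nat)) / real k \<le> wlen (shortcuts g n) h"
    by (intro exI[of _ 1]) auto
  then show "slen (dn n) h \<le> wlen (shortcuts g n) h" by (rule LIMSEQ_le_const2[OF slen_lim[OF dn_H h]])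
qed

lemma logdil_dn:
  assumes "n \<le> m"
  shows "logdil (dn n) (dn m) \<le> 1 / (real n + 1)"
proof -
  have "Dil G (dn n) (dn m) \<le> 1 + 1 / (real n + 1)"
    by (rule Dil_least[OF dn_Hpp dn_Hpp]) (rule slen_dn(2))
  moreover have "Dil G (dn m) (dn n) \<le> 1"
    by (rule Dil_least[OF dn_Hpp dn_Hpp]) (use slen_dn(1) assms in simp)
  ultimately have "Dil G (dn n) (dn m) * Dil G (dn m) (dn n) \<le> (1 + 1 / (real n + 1)) * 1"
    using Dil_pos[OF dn_Hpp dn_Hpp] by (intro mult_mono) (auto intro: less_imp_le)
  then have "logdil (dn n) (dn m) \<le> ln (1 + 1 / (real n + 1))"
    unfolding logdil_def using Dil_pos[OF dn_Hpp dn_Hpp]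
    by (subst ln_le_cancel_iff) (auto intro!: mult_pos_pos add_pos_nonneg)
  also have "\<dots> \<le> 1 / (real n + 1)" by (rule ln_add_one_self_le_self) simp
  finally show ?thesis .
qed

lemma MCauchy_dn: "Metric_space.MCauchy (space_Hpp G) (Delta_dist G) (\<lambda>n. rclass (dn n))"
proof -
  interpret M: Metric_space "space_Hpp G" "Delta_dist G" by (rule Metric_space_Hpp)
  have le: "Delta_dist G (rclass (dn n)) (rclass (dn m)) \<le> 1 / (real N + 1)" if "N \<le> n" "N \<le> m" for N n m
  proof -
    have "logdil (dn n) (dn m) \<le> 1 / (real (min n m) + 1)"
      using logdil_dn[of n m] logdil_dn[of m n] by (cases "n \<le> m") (auto simp: logdil_def mult.commute)
    also have "\<dots> \<le> 1 / (real N + 1)" using that by (intro divide_left_mono) auto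
    finally show ?thesis by (simp add: Delta_rclass dn_Hpp)
  qed
  show ?thesis unfolding M.MCauchy_def
  proof (intro conjI allI impI)
    show "range (\<lambda>n. rclass (dn n)) \<subseteq> space_Hpp G" using rclass_in[OF dn_Hpp] by blast
    fix e :: real assume e: "0 < e"
    obtain N where N: "inverse (real (Suc N)) < e" using reals_Archimedean[OF e] by blast
    have "Delta_dist G (rclass (dn n)) (rclass (dn m)) < e" if "N \<le> n" "N \<le> m" for n m
      using le[OF that] N by (simp add: inverse_eq_divide add.commute)
    then show "\<exists>N. \<forall>n m. N \<le> n \<longrightarrow> N \<le> m \<longrightarrow> Delta_dist G (rclass (dn n)) (rclass (dn m)) < e" by blast
  qed
qed

text \<open>
  The signed distance along the axis, half of \<open>d(1, x) - d(x, a\<^sup>k)\<close>, is a function of \<open>x\<close> that no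
  letter increases by more than its weight: for generators because it is 1-Lipschitz, for a shortcut
  \<open>g\<^sub>i\<close> because the two Gromov products eat up at least the saving \<open>i\<close>.
\<close>

lemma wlen_axis:
  assumes a: "a \<in> carrier G"
    and avoid: "\<And>i k x. x \<in> carrier G \<Longrightarrow> real i \<le> gp \<one> (x \<otimes> g i) x + gp x (a [^] (k::nat)) (x \<otimes> g i)"
  shows "wlen (shortcuts g n) (a [^] (k::nat)) = len (a [^] k)"
proof (rule antisym)
  let ?B = "a [^] k"
  have B: "?B \<in> carrier G" using a by simp
  show "wlen (shortcuts g n) ?B \<le> len ?B" by (rule wlen_le_len[OF shortcuts_admissible B])
  let ?\<Phi> = "\<lambda>x y. ((dist \<one> y - dist y ?B) - (dist \<one> x - dist x ?B)) / 2"
  have "?\<Phi> \<one> (\<one> \<otimes> ?B) \<le> wlen (shortcuts g n) ?B"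
  proof (rule wlen_dominates[OF shortcuts_admissible, where \<Phi> = ?\<Phi>])
    fix x y r assume x: "x \<in> carrier G" and "(y, r) \<in> shortcuts g n"
    then consider "y \<in> S" "r = 1" | i where "y = g i" "r = len (g i) - real i"
      by (auto simp: shortcuts_def)
    then show "?\<Phi> x (x \<otimes> y) \<le> r"
    proof cases
      case 1
      then have y: "y \<in> carrier G" using S_carrier by simp
      then show ?thesis
        using triangle[OF one_closed x, of "x \<otimes> y"] triangle[OF x _ B, of "x \<otimes> y"]
          dist_mult_self(1)[OF x y] len_gen[OF 1(1)] 1(2) x by simp
    next
      case 2
      let ?y = "x \<otimes> g i"
      have "?\<Phi> x ?y = dist x ?y - gp \<one> ?y x - gp x ?B ?y"
        using sym[of ?y x] x g by (simp add: gromov_product_def field_simps)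
      then show ?thesis using avoid[OF x, of i k] dist_mult_self(1)[OF x g, of i] 2 by simp
    qed
  qed (use B in \<open>auto simp: field_simps\<close>)
  then show "len ?B \<le> wlen (shortcuts g n) ?B" using B refl by (simp add: dist_one)
qed

text \<open>
  Convergence says that the ratio of stable lengths of \<open>\<psi>\<close> and \<open>d\<^sub>n\<close> oscillates less and less over the
  group; its value at \<open>a\<close> does not depend on \<open>n\<close>, and \<open>d\<^sub>n\<close> decreases with \<open>n\<close>.
\<close>

lemma limit_le_shortcuts:
  assumes a: "a \<in> nontrivial" and axis: "\<And>n m. slen (dn n) a = slen (dn m) a"
    and \<psi>: "\<psi> \<in> potentials_Hpp G" and lim: "(\<lambda>n. logdil (dn n) \<psi>) \<longlonglongrightarrow> 0" and h: "h \<in> nontrivial"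
  shows "slen \<psi> h \<le> slen \<psi> a / slen (dn 0) a * slen (dn m) h"
proof -
  define s where "s = slen \<psi> a / slen (dn 0) a"
  define D where "D n = Dil G (dn n) \<psi> * Dil G \<psi> (dn n)" for n
  have \<alpha>: "0 < slen (dn 0) a" by (rule slen_pos[OF dn_Hpp a])
  have s: "0 < s" "slen \<psi> a = s * slen (dn 0) a" using \<alpha> slen_pos[OF \<psi> a] by (simp_all add: s_def)
  have Dpos: "0 < D n" for n using Dil_pos[OF dn_Hpp \<psi>] Dil_pos[OF \<psi> dn_Hpp] by (simp add: D_def)
  have "(\<lambda>n. exp (logdil (dn n) \<psi>)) \<longlonglongrightarrow> exp 0" using lim by (intro tendsto_intros)
  then have "D \<longlonglongrightarrow> 1" using Dpos by (simp add: logdil_def D_def[symmetric])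
  then have "(\<lambda>n. s * slen (dn m) h * D n) \<longlonglongrightarrow> s * slen (dn m) h * 1" by (intro tendsto_intros)
  moreover have "slen \<psi> h \<le> s * slen (dn m) h * D n" if nm: "m \<le> n" for n
  proof -
    have "slen (dn 0) a \<le> Dil G (dn n) \<psi> * (s * slen (dn 0) a)"
      using Dil_upper[OF dn_Hpp \<psi> a, of n] axis[of n 0] s(2) by simp
    then have "1 * slen (dn 0) a \<le> (s * Dil G (dn n) \<psi>) * slen (dn 0) a" by (simp add: mult_ac)
    then have "1 \<le> s * Dil G (dn n) \<psi>" using \<alpha> by (simp only: mult_le_cancel_right_pos)
    then have "Dil G \<psi> (dn n) * 1 \<le> Dil G \<psi> (dn n) * (s * Dil G (dn n) \<psi>)"
      using Dil_pos[OF \<psi> dn_Hpp] by (intro mult_left_mono) (auto intro: less_imp_le)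
    then have "Dil G \<psi> (dn n) \<le> s * D n" by (simp add: D_def mult_ac)
    then have "Dil G \<psi> (dn n) * slen (dn n) h \<le> s * D n * slen (dn m) h"
      using slen_dn(1)[OF h nm] slen_pos[OF dn_Hpp h] s(1) Dpos
      by (intro mult_mono) (auto intro: less_imp_le mult_nonneg_nonneg)
    then show ?thesis using Dil_upper[OF \<psi> dn_Hpp h, of n] by (simp add: mult_ac)
  qed
  ultimately have "slen \<psi> h \<le> s * slen (dn m) h * 1" by (intro LIMSEQ_le_const) auto
  then show ?thesis by (simp add: s_def)
qed

end

text \<open>
  The shortcuts are taken for \<open>g\<^sub>n = a\<^sup>p t a\<^sup>p\<close> with \<open>p\<close> large. A limit \<open>\<psi>\<close> would, suitably scaled, agree
  with the word metric on the powers of \<open>a\<close>, hence be at least \<open>|g\<^sub>n| - O(1)\<close> at \<open>g\<^sub>n\<close> because potentials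
  are almost additive at corners of bounded backtracking; but it is at most \<open>d\<^sub>n(1, g\<^sub>n) + O(1)\<close>, which is
  \<open>|g\<^sub>n| - n + O(1)\<close>.
\<close>

lemma not_mcomplete: "\<not> Metric_space.mcomplete (space_Hpp G) (Delta_dist G)"
proof
  interpret MS: Metric_space "space_Hpp G" "Delta_dist G" by (rule Metric_space_Hpp)
  assume complete: "MS.mcomplete"
  obtain a t C where a: "a \<in> carrier G" "a \<noteq> \<one>" and t: "t \<in> carrier G"
    and indep: "\<And>(m::int) (n::int). m \<noteq> 0 \<Longrightarrow> t \<otimes> a [^] m \<otimes> inv t \<noteq> a [^] n"
    and C: "\<And>(j::int) (k::int). gp (a [^] j) (t \<otimes> a [^] k) \<one> \<le> C"
    using axis_pair by metis
  have an: "a \<in> nontrivial" using a by simp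
  have pc: "a [^] (k::nat) \<in> carrier G" for k using a by simp
  obtain L where L: "0 < L" "\<And>m :: nat. real m \<le> L * len (a [^] m) + L"
    using powers_quasi_geodesic[OF a] by metis
  define gg where "gg p = a [^] p \<otimes> t \<otimes> a [^] p" for p :: nat
  have gg: "gg p \<in> carrier G" for p using a t by (simp add: gg_def)
  have "\<exists>p. (\<forall>k. \<forall>x\<in>carrier G. real n \<le> gp \<one> (x \<otimes> gg p) x + gp x (a [^] (k::nat)) (x \<otimes> gg p)) \<and>
    real n * (real n + 1) + 1 \<le> len (gg p)" for n
  proof -
    obtain p0 where p0: "\<And>p k x. \<lbrakk>p0 \<le> p; x \<in> carrier G\<rbrakk> \<Longrightarrow>
        real n \<le> gp \<one> (x \<otimes> gg p) x + gp x (a [^] (k::nat)) (x \<otimes> gg p)"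
      using translates_avoid_axis[OF a t indep C, of "real n"] unfolding gg_def by auto
    define r where "r = real n * (real n + 1) + 1 + 2 * C"
    define p where "p = max p0 (nat \<lceil>L * r + L\<rceil>)"
    have "L * r + L \<le> real p" unfolding p_def by linarith
    then have "L * r \<le> L * len (a [^] p)" using L(2)[of p] by simp
    then have "r \<le> len (a [^] p)" using L(1) by simp
    then have "real n * (real n + 1) + 1 \<le> len (gg p)"
      using len_corner[OF a t indep C, of p] by (simp add: gg_def r_def)
    moreover have "p0 \<le> p" by (simp add: p_def)
    ultimately show ?thesis using p0 by blast
  qed
  then obtain P where P: "\<And>n k x. x \<in> carrier G \<Longrightarrow>
      real n \<le> gp \<one> (x \<otimes> gg (P n)) x + gp x (a [^] (k::nat)) (x \<otimes> gg (P n))"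
    "\<And>n. real n * (real n + 1) + 1 \<le> len (gg (P n))" by metis
  define g where "g n = gg (P n)" for n
  have g: "g i \<in> carrier G" and g_long: "real i * (real i + 1) + 1 \<le> len (g i)" for i
    using gg P(2) by (simp_all add: g_def)
  let ?d = "\<lambda>n. wmetric (shortcuts g n)"
  note H = dn_Hpp[of g, OF g g_long]
  have axis: "wlen (shortcuts g n) (a [^] k) = len (a [^] k)" for n and k :: nat
    by (rule wlen_axis[of g, OF g g_long a(1)]) (use P(1) in \<open>simp add: g_def\<close>)
  have slen_axis: "slen (?d n) a = slen (?d m) a" for n m
    using pc by (simp add: slen_def wmetric_one axis)
  obtain A where A: "A \<in> space_Hpp G" and limA: "(\<lambda>n. Delta_dist G (rclass (?d n)) A) \<longlonglongrightarrow> 0"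
    using complete MCauchy_dn[of g, OF g g_long] unfolding MS.mcomplete_def MS.limitin_metric_dist_null by blast
  obtain \<psi> where \<psi>: "\<psi> \<in> potentials_Hpp G" "A = rclass \<psi>" by (rule space_rclass[OF A])
  have lim: "(\<lambda>n. logdil (?d n) \<psi>) \<longlonglongrightarrow> 0" using limA by (simp add: \<psi> Delta_rclass H)
  define \<alpha> where "\<alpha> = slen (?d 0) a"
  define s where "s = slen \<psi> a / \<alpha>"
  have \<alpha>: "0 < \<alpha>" unfolding \<alpha>_def by (rule slen_pos[OF H an])
  have s: "0 < s" "slen \<psi> a = s * \<alpha>" using \<alpha> slen_pos[OF \<psi>(1) an] by (simp_all add: s_def)
  have upper_slen: "slen \<psi> h \<le> s * wlen (shortcuts g n) h" if h: "h \<in> nontrivial" for h n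
  proof -
    have "slen \<psi> h \<le> s * slen (?d n) h"
      using limit_le_shortcuts[of g, OF g g_long an slen_axis \<psi>(1) lim h] by (simp add: s_def \<alpha>_def)
    also have "\<dots> \<le> s * wlen (shortcuts g n) h"
      using slen_dn(3)[of g, OF g g_long h] s(1) by simp
    finally show ?thesis .
  qed
  obtain K where K: "0 < K" "\<And>x y. \<lbrakk>x \<in> carrier G; y \<in> carrier G\<rbrakk> \<Longrightarrow>
    \<bar>\<psi> \<one> (x \<otimes> y) - \<psi> \<one> x - \<psi> \<one> y\<bar> \<le> K * gp (inv x) y \<one> + K"
    using potential_almost_additive[OF Hpp_H[OF \<psi>(1)]] by blast
  obtain Q where Q: "0 < Q"
    "\<And>x y. \<lbrakk>x \<in> carrier G; y \<in> carrier G\<rbrakk> \<Longrightarrow> \<bar>\<psi> \<one> (x \<otimes> y) - \<psi> \<one> y\<bar> \<le> Q * len x + Q"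
    by (rule potential_lipschitz[OF Hpp_H[OF \<psi>(1)]]) (rule that)
  obtain E1 where E1: "\<And>k::nat. \<bar>\<psi> \<one> (a [^] k) - real k * slen \<psi> a\<bar> \<le> E1"
    using slen_bounded[OF Hpp_H[OF \<psi>(1)] an] by blast
  obtain E2 where E2: "\<And>k::nat. \<bar>?d 0 \<one> (a [^] k) - real k * slen (?d 0) a\<bar> \<le> E2"
    using slen_bounded[OF Hpp_H[OF H] an] by blast
  define E3 where "E3 = K * C + K + Q * len t + Q + 2 * E1 + 2 * s * E2 + s * len t"
  have lower: "s * len (g n) - E3 \<le> \<psi> \<one> (g n)" for n
  proof -
    let ?p = "P n"
    have ge: "g n = a [^] ?p \<otimes> (t \<otimes> a [^] ?p)" using pc t by (simp add: g_def gg_def m_assoc)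
    have "K * gp (inv (a [^] ?p)) (t \<otimes> a [^] ?p) \<one> \<le> K * C"
      using C_nat[OF a t indep C, of ?p ?p] K(1) by simp
    then have 1: "\<psi> \<one> (a [^] ?p) + \<psi> \<one> (t \<otimes> a [^] ?p) - (K * C + K) \<le> \<psi> \<one> (g n)"
      using K(2)[of "a [^] ?p" "t \<otimes> a [^] ?p"] pc t unfolding ge by simp
    have 2: "\<psi> \<one> (a [^] ?p) - (Q * len t + Q) \<le> \<psi> \<one> (t \<otimes> a [^] ?p)"
      using Q(2)[OF t pc, of ?p] by linarith
    have "len (a [^] ?p) - E2 \<le> real ?p * \<alpha>"
      using E2[of ?p] pc by (simp add: wmetric_one axis \<alpha>_def)
    then have "s * (len (a [^] ?p) - E2) \<le> s * (real ?p * \<alpha>)" using s(1) by simp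
    then have 3: "s * len (a [^] ?p) - s * E2 - E1 \<le> \<psi> \<one> (a [^] ?p)"
      using E1[of ?p] by (simp add: s(2) algebra_simps)
    have "len (g n) \<le> len (a [^] ?p) + (len t + len (a [^] ?p))"
      unfolding ge using len_mult[of "a [^] ?p" "t \<otimes> a [^] ?p"] len_mult[of t "a [^] ?p"] pc t by simp
    then have "s * len (g n) \<le> s * (2 * len (a [^] ?p) + len t)" using s(1) by simp
    then have 4: "s * len (g n) \<le> 2 * (s * len (a [^] ?p)) + s * len t" by (simp add: algebra_simps)
    show ?thesis using 1 2 3 4 unfolding E3_def by (simp add: mult.assoc)
  qed
  obtain M where M: "0 \<le> M" "\<And>g. \<lbrakk>g \<in> carrier G; M \<le> len g\<rbrakk> \<Longrightarrow>
    \<exists>h\<in>carrier G. h \<noteq> \<one> \<and> len (inv g \<otimes> h) \<le> M \<and>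
      (\<forall>(j::nat) (k::nat). gp (inv (h [^] j)) (h [^] k) \<one> \<le> M)" using straight_closing by blast
  obtain E where E: "\<And>g h. \<lbrakk>g \<in> carrier G; h \<in> carrier G; len (inv g \<otimes> h) \<le> M;
      \<And>(j::nat) (k::nat). gp (inv (h [^] j)) (h [^] k) \<one> \<le> M\<rbrakk> \<Longrightarrow> \<bar>\<psi> \<one> g - slen \<psi> h\<bar> \<le> E"
    by (rule straight_closing_potential[OF Hpp_H[OF \<psi>(1)] M(1)]) (rule that; blast)
  have upper: "\<psi> \<one> (g n) \<le> s * (len (g n) - real n + M) + E" if n: "M \<le> real n" for n
  proof -
    have "0 \<le> real n * real n" by simp
    then have "M \<le> len (g n)" using g_long[of n] n unfolding distrib_left mult_1_right by linarith
    then obtain h where h: "h \<in> carrier G" "h \<noteq> \<one>" "len (inv (g n) \<otimes> h) \<le> M"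
      "\<And>(j::nat) (k::nat). gp (inv (h [^] j)) (h [^] k) \<one> \<le> M" using M(2)[OF g] by blast
    note adm = shortcuts_admissible[of g, OF g g_long]
    have "wlen (shortcuts g n) h \<le> wlen (shortcuts g n) (g n) + wlen (shortcuts g n) (inv (g n) \<otimes> h)"
      using wlen_mult[OF adm, of "g n" "inv (g n) \<otimes> h" n] h(1) g by (simp add: mult_inv_cancel)
    moreover have "wlen (shortcuts g n) (g n) \<le> len (g n) - real n"
      by (rule wlen_letter[OF adm]) (simp add: shortcuts_def)
    moreover have "wlen (shortcuts g n) (inv (g n) \<otimes> h) \<le> M"
      using wlen_le_len[OF adm, of "inv (g n) \<otimes> h" n] h(1,3) g by simp
    ultimately have "wlen (shortcuts g n) h \<le> len (g n) - real n + M" by linarith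
    then have "s * wlen (shortcuts g n) h \<le> s * (len (g n) - real n + M)" using s(1) by simp
    moreover have "slen \<psi> h \<le> s * wlen (shortcuts g n) h" using h by (intro upper_slen) auto
    moreover have "\<bar>\<psi> \<one> (g n) - slen \<psi> h\<bar> \<le> E" by (rule E[OF g h(1,3,4)])
    ultimately show ?thesis by linarith
  qed
  obtain n :: nat where n: "max M ((E + E3 + s * M) / s) < real n" using reals_Archimedean2 by blast
  have "(E + E3 + s * M) / s < real n" using n by simp
  then have "E + E3 + s * M < s * real n" using s(1) by (simp add: pos_divide_less_eq mult.commute)
  moreover have "s * len (g n) - E3 \<le> s * (len (g n) - real n + M) + E"
    using lower[of n] upper[of n] n by simp
  ultimately show False by (simp add: algebra_simps)
qed

end

theorem theorem3:
  fixes \<Gamma> :: "('a, 'b) monoid_scheme"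
  assumes "hyperbolic_group \<Gamma>"
    and "\<not> elementary_group \<Gamma>"
    and "torsion_free \<Gamma>"
  shows "Metric_space (space_Hpp \<Gamma>) (Delta_dist \<Gamma>) \<and>
         \<not> Metric_space.mcomplete (space_Hpp \<Gamma>) (Delta_dist \<Gamma>)"
proof -
  obtain S where S: "group \<Gamma>" "finite_sym_gen_set \<Gamma> S" "hyperbolic_on (carrier \<Gamma>) (word_metric \<Gamma> S)"
    using assms(1) unfolding hyperbolic_group_def by blast
  obtain \<delta> where \<delta>: "0 \<le> \<delta>" "\<forall>x\<in>carrier \<Gamma>. \<forall>y\<in>carrier \<Gamma>. \<forall>z\<in>carrier \<Gamma>. \<forall>w\<in>carrier \<Gamma>.
      gromov_product (word_metric \<Gamma> S) x z w \<ge>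
        min (gromov_product (word_metric \<Gamma> S) x y w) (gromov_product (word_metric \<Gamma> S) y z w) - \<delta>"
    using S(3) unfolding hyperbolic_on_def by blast
  interpret group \<Gamma> by (rule S(1))
  interpret nonelementary_hyperbolic_group \<Gamma> S \<delta>
    by unfold_locales (use S(2) \<delta> assms(2,3) in auto)
  show ?thesis using Metric_space_Hpp not_mcomplete by blast
qed

end
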